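(* No $\mathbb{Z}_2$-lattice of rank $8$ is primitively $4$-universal. Therefore, $u^\ast_{\mathbb{Z}_2}(4) = 9$.
   Context: A $\mathbb{Z}_2$-lattice is a finitely generated $\mathbb{Z}_2$-submodule of a quadratic space $(V,B)$ over $\mathbb{Q}_2$, assumed integral ($B(L,L)\subseteq\mathbb{Z}_2$) and nondegenerate. A representation is a $\mathbb{Z}_2$-linear map preserving $B$; it is primitive if its image is a direct summand. A lattice is primitively $n$-universal if it primitively represents every $\mathbb{Z}_2$-lattice of rank $n$; $u^\ast_{\mathbb{Z}_2}(n)$ is the minimal rank of such a lattice. *)

theory Defs
  imports Main
begin

text \<open>A 2-adic integer is a compatible system of residues: its n-th component is
the residue modulo 2^n (represented in 0..<2^n).\<close>

typedef padic2 = "{f :: nat \<Rightarrow> int. \<forall>n. 0 \<le> f n \<and> f n < 2^n \<and> f (Suc n) mod 2^n = f n}"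
  morphisms res Abs_padic2
  by (rule exI[of _ "\<lambda>_. 0"]) simp

setup_lifting type_definition_padic2

lemma res_bounds: "0 \<le> res x n" "res x n < 2^n"
  using res[of x] by auto

lemma res_mod[simp]: "res x n mod 2^n = res x n"
  using res_bounds[of x n] by simp

lemma mod_pow_Suc_compat: "(a::int) mod (2 * 2^n) mod 2^n = a mod 2^n"
  by (simp add: mod_mod_cancel)

lemma res_compat: "res x (Suc n) mod 2^n = res x n"
  using res[of x] by auto

instantiation padic2 :: comm_ring_1
begin

lift_definition zero_padic2 :: padic2 is "\<lambda>_. 0" by simp
lift_definition one_padic2 :: padic2 is "\<lambda>n. 1 mod 2^n"
  by (simp add: mod_pow_Suc_compat)
lift_definition plus_padic2 :: "padic2 \<Rightarrow> padic2 \<Rightarrow> padic2"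
  is "\<lambda>f g n. (f n + g n) mod 2^n"
  apply (auto simp: mod_pow_Suc_compat)
  by (metis mod_add_eq)
lift_definition times_padic2 :: "padic2 \<Rightarrow> padic2 \<Rightarrow> padic2"
  is "\<lambda>f g n. (f n * g n) mod 2^n"
  apply (auto simp: mod_pow_Suc_compat)
  by (metis mod_mult_eq)
lift_definition uminus_padic2 :: "padic2 \<Rightarrow> padic2" is "\<lambda>f n. (- f n) mod 2^n"
  apply (auto simp: mod_pow_Suc_compat)
  by (metis mod_minus_eq)
definition minus_padic2 :: "padic2 \<Rightarrow> padic2 \<Rightarrow> padic2" where
  "minus_padic2 a b = a + (- b)"

instance
proof
  fix a b c :: padic2
  show "a * b * c = a * (b * c)"
    by transfer (simp add: mod_mult_left_eq mod_mult_right_eq mult.assoc)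
  show "a * b = b * a" by transfer (simp add: mult.commute)
  show "1 * a = a"
  proof transfer
    fix a :: "nat \<Rightarrow> int"
    assume a: "\<forall>n. 0 \<le> a n \<and> a n < 2^n \<and> a (Suc n) mod 2^n = a n"
    show "(\<lambda>n. 1 mod 2^n * a n mod 2^n) = a"
    proof
      fix n
      show "1 mod 2^n * a n mod 2^n = a n"
        using a[rule_format, of n] by (cases n) (simp_all add: mod_mult_left_eq)
    qed
  qed
  show "a + b + c = a + (b + c)"
    by transfer (simp add: mod_add_left_eq mod_add_right_eq add.assoc)
  show "a + b = b + a" by transfer (simp add: add.commute)
  show "0 + a = a" by transfer simp
  show "- a + a = 0" by transfer (simp add: mod_add_left_eq)
  show "a - b = a + - b" by (simp add: minus_padic2_def)
  show "(a + b) * c = a * c + b * c"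
    by transfer (simp add: mod_mult_left_eq mod_add_eq distrib_right)
  show "(0::padic2) \<noteq> 1"
  proof
    assume "(0::padic2) = 1"
    then have "res (0::padic2) 1 = res 1 1" by simp
    then show False by (simp add: zero_padic2.rep_eq one_padic2.rep_eq)
  qed
qed

end

text \<open>A Z_2-lattice of rank m is given (up to isometry) by its Gram matrix with respect
to a Z_2-basis: a symmetric m x m matrix over Z_2 (integrality is automatic) whose
bilinear form is nondegenerate (trivial radical). Matrices are functions
nat => nat => padic2 with indices restricted to 0..<m.\<close>

definition z2_lattice :: "nat \<Rightarrow> (nat \<Rightarrow> nat \<Rightarrow> padic2) \<Rightarrow> bool" where
  "z2_lattice m G \<longleftrightarrow>
     (\<forall>i<m. \<forall>j<m. G i j = G j i) \<and>
     (\<forall>x :: nat \<Rightarrow> padic2. (\<forall>i<m. (\<Sum>j<m. G i j * x j) = 0) \<longrightarrow> (\<forall>j<m. x j = 0))"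

definition z2vecs :: "nat \<Rightarrow> (nat \<Rightarrow> padic2) set" where
  "z2vecs m = {v. \<forall>i\<ge>m. v i = 0}"

definition lin_map :: "nat \<Rightarrow> nat \<Rightarrow> (nat \<Rightarrow> nat \<Rightarrow> padic2) \<Rightarrow> (nat \<Rightarrow> padic2) \<Rightarrow> (nat \<Rightarrow> padic2)" where
  "lin_map m n X c = (\<lambda>i. if i < m then (\<Sum>j<n. X i j * c j) else 0)"

definition is_representation ::
  "nat \<Rightarrow> (nat \<Rightarrow> nat \<Rightarrow> padic2) \<Rightarrow> nat \<Rightarrow> (nat \<Rightarrow> nat \<Rightarrow> padic2) \<Rightarrow> (nat \<Rightarrow> nat \<Rightarrow> padic2) \<Rightarrow> bool" where
  "is_representation n GL m GM X \<longleftrightarrow>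
     (\<forall>a<n. \<forall>b<n. (\<Sum>i<m. \<Sum>k<m. X i a * GM i k * X k b) = GL a b)"

definition z2_submodule :: "nat \<Rightarrow> (nat \<Rightarrow> padic2) set \<Rightarrow> bool" where
  "z2_submodule m N \<longleftrightarrow> N \<subseteq> z2vecs m \<and> (\<lambda>_. 0) \<in> N \<and>
     (\<forall>u\<in>N. \<forall>v\<in>N. (\<lambda>i. u i + v i) \<in> N) \<and>
     (\<forall>c. \<forall>u\<in>N. (\<lambda>i. c * u i) \<in> N)"

definition is_primitive :: "nat \<Rightarrow> nat \<Rightarrow> (nat \<Rightarrow> nat \<Rightarrow> padic2) \<Rightarrow> bool" where
  "is_primitive n m X \<longleftrightarrow>
     (\<exists>N. z2_submodule m N \<and>
        (\<forall>v\<in>z2vecs m. \<exists>c u. u \<in> N \<and> v = (\<lambda>i. lin_map m n X c i + u i)) \<and>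
        lin_map m n X ` UNIV \<inter> N = {\<lambda>_. 0})"

definition prim_represents ::
  "nat \<Rightarrow> (nat \<Rightarrow> nat \<Rightarrow> padic2) \<Rightarrow> nat \<Rightarrow> (nat \<Rightarrow> nat \<Rightarrow> padic2) \<Rightarrow> bool" where
  "prim_represents m GM n GL \<longleftrightarrow>
     (\<exists>X. is_representation n GL m GM X \<and> is_primitive n m X)"

definition prim_universal :: "nat \<Rightarrow> nat \<Rightarrow> (nat \<Rightarrow> nat \<Rightarrow> padic2) \<Rightarrow> bool" where
  "prim_universal n m GM \<longleftrightarrow> (\<forall>GL. z2_lattice n GL \<longrightarrow> prim_represents m GM n GL)"

definition u_star_Z2 :: "nat \<Rightarrow> nat" where
  "u_star_Z2 n = (LEAST m. \<exists>GM. z2_lattice m GM \<and> prim_universal n m GM)"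

end

theory Submission
  imports Defs "Jordan_Normal_Form.Determinant" "Jordan_Normal_Form.Column_Operations" "HOL-Library.Z2"
begin

text \<open>Let \<open>M\<close> have rank 8 (smaller ranks are padded by \<open>\<langle>1\<rangle>\<close>) and be primitively 4-universal. A maximal
  integral overlattice \<open>M'\<close> contains a rank 4 primitive sublattice that is totally isotropic modulo 8, the
  saturation of a primitive copy of \<open>2^k I\<close> with \<open>k\<close> large. Maximality then forces \<open>M'\<close> to be unimodular; it
  is odd, and modulo 8 it is \<open>H \<bottom> H \<bottom> H \<bottom> [0 1; 1 1]\<close>, with a characteristic vector \<open>w\<close> such that all of
  \<open>w + 2M'\<close> has norms divisible by 8. Let \<open>2^t\<close> be the exponent of \<open>M'/M\<close> and \<open>X = {x \<in> M'. 2^(t-1) x \<in> M}\<close>.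

  The obstruction comes from the anisotropic lattice \<open>O = A \<bottom> 2A\<close>, in which only vectors of \<open>2O\<close> have norm
  divisible by 8. The saturation in \<open>M'\<close> of a primitive copy of \<open>2^(2t) O\<close> in \<open>M\<close> meets \<open>w + 2M'\<close>, and the
  norm condition gives \<open>w \<in> X\<close>. Next, representing \<open>H \<bottom> A\<close> and \<open>H \<bottom> H\<close> forces \<open>X\<close> to be the hyperplane
  orthogonal modulo 2 to a vector of norm 2 modulo 4, and then a primitive copy of \<open>2^(2t-1) O\<close> is
  impossible. Each of these steps is an instance of the fact that an 8-dimensional quadratic space
  of minus type over the field with two elements has no 4-dimensional totally singular subspace.

  In rank 9, \<open>H \<bottom> H \<bottom> H \<bottom> H \<bottom> \<langle>1\<rangle>\<close> is primitively 4-universal: a Gram matrix \<open>G\<close> is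
  represented by \<open>(I; C; z)\<close>, where \<open>z i\<close> is the parity of \<open>G i i\<close> and \<open>C + C^T = G - z z^T\<close>.\<close>

section \<open>Arithmetic of 2-adic integers\<close>

text \<open>The vectors of even norm in \<open>M'\<close>, taken modulo \<open>w\<close> and
  \<open>2M'\<close>, carry half the norm modulo 2 as a quadratic form of plus type in dimension
  six, so \<open>M'\<close> alone does contain totally singular 3-spaces. The missing anisotropic
  plane is supplied from outside: modulo 2, half the norm of \<open>O\<close> or \<open>A\<close> is
  x^2 + xy + y^2 in two coordinates, and these are adjoined to the six of \<open>M'\<close>. The
  graph of an isometry is totally singular in the sum, so four vectors of it are dependent, and the
  relation yields a vector that is 0 or \<open>w\<close> modulo \<open>2M'\<close> and whose two
  outer coordinates are even.

  The scales of \<open>O\<close> come from the exponent of \<open>M'/M\<close>: multiplication by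
  \<open>2^t\<close> carries the saturation into \<open>M\<close> and multiplies norms by
  \<open>4^t\<close>. At scale 2^(2t) the norms on the saturation are those of \<open>O\<close>
  itself; at scale 2^(2t-1) they are half of those, so odd norms become possible and need a separate
  argument.\<close>

lemma padic2_eqI: "(\<And>n. res x n = res y n) \<Longrightarrow> x = y"
  by (metis ext res_inject)

lemma res_zero [simp]: "res 0 n = 0"
  by (simp add: zero_padic2.rep_eq)

lemma res_plus: "res (x + y) n = (res x n + res y n) mod 2 ^ n"
  by (simp add: plus_padic2.rep_eq)

lemma res_times: "res (x * y) n = (res x n * res y n) mod 2 ^ n"
  by (simp add: times_padic2.rep_eq)

lemma res_one: "res 1 n = 1 mod 2 ^ n"
  by (simp add: one_padic2.rep_eq)

lemma res_of_nat: "res (of_nat m) n = int m mod 2 ^ n"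
  by (induction m) (simp_all add: res_plus res_one mod_simps algebra_simps)

lemma res_numeral: "res (numeral m) n = numeral m mod 2 ^ n"
  using res_of_nat[of "numeral m" n] by simp

lemma res_one_cases: "res x (Suc 0) = 0 \<or> res x (Suc 0) = 1"
  using res_bounds[of x "Suc 0"] by auto

lemma res_mod_two: "res x (Suc n) mod 2 = res x (Suc 0)"
proof (induction n)
  case 0
  then show ?case using res_one_cases[of x] by auto
next
  case (Suc n)
  have "res x (Suc (Suc n)) mod 2 = res x (Suc (Suc n)) mod 2 ^ Suc n mod 2"
    by (simp add: mod_mod_cancel)
  then show ?case using Suc by (simp only: res_compat)
qed

lemma even_iff_res: "2 dvd x \<longleftrightarrow> res x (Suc 0) = 0"
proof
  assume "2 dvd x"
  then obtain y where "x = 2 * y" by auto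
  then show "res x (Suc 0) = 0" by (simp add: res_times res_numeral)
next
  assume x: "res x (Suc 0) = 0"
  \<comment> \<open>Halving loses one binary digit, so the residue of the quotient modulo 2^n is
    read off from the residue of \<open>x\<close> modulo 2^(n+1).\<close>
  define f where "f n = res x (Suc n) div 2" for n
  have ev: "even (res x (Suc n))" for n
    using res_mod_two[of x n] x by (simp add: even_iff_mod_2_eq_zero)
  have f: "2 * f n = res x (Suc n)" for n
    using ev[of n] by (simp add: f_def)
  have "0 \<le> f n \<and> f n < 2 ^ n \<and> f (Suc n) mod 2 ^ n = f n" for n
  proof -
    have "2 * (f (Suc n) mod 2 ^ n) = (2 * f (Suc n)) mod (2 * 2 ^ n)"
      by (rule mult_mod_right)
    also have "\<dots> = 2 * f n"
      using res_compat[of x "Suc n"] by (simp only: f power_Suc)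
    finally have "f (Suc n) mod 2 ^ n = f n" by simp
    then show ?thesis
      using f[of n] res_bounds[of x "Suc n"] by auto
  qed
  then have R: "res (Abs_padic2 f) = f"
    by (intro Abs_padic2_inverse) auto
  have "x = 2 * Abs_padic2 f"
  proof (rule padic2_eqI)
    fix n
    show "res x n = res (2 * Abs_padic2 f) n"
      using f[of n] res_compat[of x n]
      by (simp add: res_times res_numeral R mod_simps)
  qed
  then show "2 dvd x" by simp
qed

lemma two_mult_eq_0: "2 * (x::padic2) = 0 \<Longrightarrow> x = 0"
proof (rule padic2_eqI)
  fix n
  assume "2 * x = 0"
  then have "res (2 * x) (Suc n) = 0" by simp
  then have "(2 * res x (Suc n)) mod 2 ^ Suc n = 0"
    by (simp only: res_times res_numeral mod_mult_left_eq)
  then have "2 * (res x (Suc n) mod 2 ^ n) = 0"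
    by (simp only: mult_mod_right power_Suc)
  then have "2 * res x n = 0" by (simp only: res_compat)
  then show "res x n = res 0 n" by simp
qed

lemma pow2_mult_eq_0: "2 ^ k * (x::padic2) = 0 \<Longrightarrow> x = 0"
  by (induction k arbitrary: x) (auto simp: mult.assoc dest: two_mult_eq_0)

lemma pow2_mult_cancel: "2 ^ k * (x::padic2) = 2 ^ k * y \<Longrightarrow> x = y"
  using pow2_mult_eq_0[of k "x - y"] by (simp add: right_diff_distrib)

lemma pow2_dvd_res: "2 ^ k dvd x \<Longrightarrow> res x k = 0"
proof -
  assume "2 ^ k dvd x"
  then obtain y where "x = 2 ^ k * y" by auto
  moreover have "res (2 ^ k) k = 0"
    using res_of_nat[of "2 ^ k" k] by simp
  ultimately show ?thesis by (simp add: res_times)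
qed

text \<open>Inverses of the residues are unique modulo 2^n, so any choice of them in the range below
  2^n is compatible and defines a 2-adic integer.\<close>

lemma odd_dvd_1: "\<not> 2 dvd (x::padic2) \<Longrightarrow> x dvd 1"
proof -
  assume "\<not> 2 dvd x"
  then have x1: "res x (Suc 0) = 1" using even_iff_res res_one_cases by blast
  have cop: "coprime (res x n) (2 ^ n)" for n
  proof (cases n)
    case (Suc m)
    have "odd (res x n)" using res_mod_two[of x m] x1 Suc by (simp add: odd_iff_mod_2_eq_one)
    then show ?thesis by simp
  qed simp
  define f where "f n = (SOME y. 0 \<le> y \<and> y < 2 ^ n \<and> (res x n * y) mod 2 ^ n = 1 mod 2 ^ n)" for n
  have f: "0 \<le> f n \<and> f n < 2 ^ n \<and> (res x n * f n) mod 2 ^ n = 1 mod 2 ^ n" for n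
  proof -
    obtain a b where "a * res x n + b * 2 ^ n = 1"
      using cop[of n] bezout_int[of "res x n" "2 ^ n"] by auto
    then have "res x n * a = 1 + (- b) * 2 ^ n" by (simp add: algebra_simps)
    then have "(res x n * a) mod 2 ^ n = 1 mod 2 ^ n" by (simp only: mod_mult_self1)
    then have "0 \<le> a mod 2 ^ n \<and> a mod 2 ^ n < 2 ^ n \<and> (res x n * (a mod 2 ^ n)) mod 2 ^ n = 1 mod 2 ^ n"
      by (simp add: mod_simps)
    then show ?thesis unfolding f_def by (rule someI)
  qed
  have "f (Suc n) mod 2 ^ n = f n" for n
  proof -
    have "(res x n * f (Suc n)) mod 2 ^ n = ((res x (Suc n) mod 2 ^ n) * f (Suc n)) mod 2 ^ n"
      by (simp only: res_compat)
    also have "\<dots> = (res x (Suc n) * f (Suc n)) mod 2 ^ Suc n mod 2 ^ n"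
      by (simp add: mod_simps mod_mod_cancel)
    also have "\<dots> = (1 mod 2 ^ Suc n) mod 2 ^ n" using f[of "Suc n"] by simp
    also have "\<dots> = (res x n * f n) mod 2 ^ n" using f[of n] by (simp add: mod_mod_cancel)
    finally have "2 ^ n dvd res x n * (f (Suc n) - f n)"
      by (simp add: mod_eq_dvd_iff right_diff_distrib)
    then have "2 ^ n dvd f (Suc n) - f n"
      using cop[of n] by (simp add: coprime_dvd_mult_right_iff coprime_commute)
    then have "f (Suc n) mod 2 ^ n = f n mod 2 ^ n" by (simp add: mod_eq_dvd_iff)
    then show ?thesis using f[of n] by simp
  qed
  then have R: "res (Abs_padic2 f) = f"
    using f by (intro Abs_padic2_inverse) auto
  have "x * Abs_padic2 f = 1"
    by (rule padic2_eqI) (simp add: res_times res_one R f)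
  then show "x dvd 1" by (metis dvdI)
qed

lemma odd_inverse:
  assumes "\<not> 2 dvd (x::padic2)"
  obtains y where "x * y = 1"
  using odd_dvd_1[OF assms] by (metis dvdE)

lemma dvd_1_odd: "(x::padic2) dvd 1 \<Longrightarrow> \<not> 2 dvd x"
  using even_iff_res[of 1] by (auto simp: res_one dest: dvd_trans)

text \<open>A nonzero residue modulo 2^n bounds by n the exponents of 2 that divide
  \<open>x\<close>; the largest one leaves an odd cofactor.\<close>

lemma padic2_decomp:
  assumes "(x::padic2) \<noteq> 0"
  obtains k u where "x = 2 ^ k * u" "\<not> 2 dvd u"
proof -
  obtain n where n: "res x n \<noteq> 0" using assms padic2_eqI[of x 0] by auto
  define P where "P k \<longleftrightarrow> 2 ^ k dvd x" for k
  have b: "\<forall>k. P k \<longrightarrow> k \<le> n"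
  proof (intro allI impI, rule ccontr)
    fix k assume "P k" "\<not> k \<le> n"
    then have "2 ^ n dvd x" unfolding P_def by (meson le_imp_power_dvd dvd_trans nat_le_linear)
    then show False using pow2_dvd_res n by blast
  qed
  have "P 0" by (simp add: P_def)
  then obtain k where k: "P k" "\<forall>j. P j \<longrightarrow> j \<le> k"
    using GreatestI_nat[of P 0 n] Greatest_le_nat[of P _ n] b by blast
  then obtain u where u: "x = 2 ^ k * u" by (auto simp: P_def)
  have "\<not> 2 dvd u"
  proof
    assume "2 dvd u"
    then have "P (Suc k)" using u mult_dvd_mono[of "2 ^ k" "2 ^ k" 2 u] by (simp add: P_def mult.commute)
    then show False using k(2) by fastforce
  qed
  with u that show ?thesis by blast
qed

instance padic2 :: idom
proof
  fix a b :: padic2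
  assume "a \<noteq> 0" "b \<noteq> 0"
  then obtain k u l v where *: "a = 2 ^ k * u" "\<not> 2 dvd u" "b = 2 ^ l * v" "\<not> 2 dvd v"
    by (metis padic2_decomp)
  then obtain u' v' where inv: "u * u' = 1" "v * v' = 1" by (metis odd_inverse)
  show "a * b \<noteq> 0"
  proof
    assume "a * b = 0"
    then have "2 ^ k * (2 ^ l * (u * v)) = 0" using * by (simp add: ac_simps)
    then have "u * v = 0" by (blast dest: pow2_mult_eq_0)
    then have "u * v * (u' * v') = 0" by simp
    moreover have "u * v * (u' * v') = (u * u') * (v * v')" by (simp only: ac_simps)
    ultimately show False using inv by simp
  qed
qed

lemma two_neq_0 [simp]: "(2::padic2) \<noteq> 0"
  using two_mult_eq_0[of 1] by auto

section \<open>Reduction modulo 2 to the field with two elements\<close>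

definition par :: "padic2 \<Rightarrow> bit" where
  "par x = of_int (res x (Suc 0))"

lemma par_eq_0_iff: "par x = 0 \<longleftrightarrow> 2 dvd x"
  using res_one_cases[of x] by (auto simp: par_def even_iff_res)

lemma of_int_mod_2_bit: "(of_int (k mod 2) :: bit) = of_int k"
proof -
  have "(of_int k :: bit) = of_int (2 * (k div 2) + k mod 2)" by simp
  also have "\<dots> = of_int (k mod 2)" by (simp only: of_int_add of_int_mult) simp
  finally show ?thesis by simp
qed

lemma par_add [simp]: "par (x + y) = par x + par y"
  by (simp add: par_def res_plus of_int_mod_2_bit)

lemma par_mult [simp]: "par (x * y) = par x * par y"
  by (simp add: par_def res_times of_int_mod_2_bit)

lemma par_0 [simp]: "par 0 = 0"
  by (simp add: par_def)

lemma par_1 [simp]: "par 1 = 1"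
  by (simp add: par_def res_one)

lemma par_minus [simp]: "par (- x) = par x"
  using par_add[of x "- x"] by (cases "par x"; cases "par (- x)") auto

lemma par_diff [simp]: "par (x - y) = par x + par y"
  using par_add[of x "- y"] by simp

lemma par_sum: "par (sum f A) = (\<Sum>x\<in>A. par (f x))"
  by (induction A rule: infinite_finite_induct) auto

lemma even_add_iff: "2 dvd (x + y :: padic2) \<longleftrightarrow> (2 dvd x \<longleftrightarrow> 2 dvd y)"
  by (simp only: par_eq_0_iff[symmetric] par_add) (cases "par x"; cases "par y"; simp)

lemma even_diff_iff: "2 dvd (x - y :: padic2) \<longleftrightarrow> (2 dvd x \<longleftrightarrow> 2 dvd y)"
  by (simp only: par_eq_0_iff[symmetric] par_diff) (cases "par x"; cases "par y"; simp)

lemma even_mult_iff': "2 dvd (x * y :: padic2) \<longleftrightarrow> 2 dvd x \<or> 2 dvd y"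
  by (simp only: par_eq_0_iff[symmetric] par_mult) (cases "par x"; cases "par y"; simp)

lemma odd_1 [simp]: "\<not> 2 dvd (1 :: padic2)"
  by (simp add: dvd_1_odd)

section \<open>Totally singular subspaces over the field with two elements\<close>

declare add_bit_eq_xor [simp del] mult_bit_eq_and [simp del]

lemma bit_self_add [simp]: "(x::bit) + x = 0" "x + (x + y) = y"
  by (cases x; cases y; simp add: add_bit_eq_xor)+

text \<open>Three hyperbolic planes and the anisotropic plane x^2 + xy + y^2, hence of minus type;
  \<open>bform\<close> is the polar form.\<close>

definition qform :: "(nat \<Rightarrow> bit) \<Rightarrow> bit" where
  "qform u = u 0 * u 1 + u 2 * u 3 + u 4 * u 5 + (u 6 * u 6 + u 6 * u 7 + u 7 * u 7)"

definition bform :: "(nat \<Rightarrow> bit) \<Rightarrow> (nat \<Rightarrow> bit) \<Rightarrow> bit" where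
  "bform u v = u 0 * v 1 + u 1 * v 0 + u 2 * v 3 + u 3 * v 2 + u 4 * v 5 + u 5 * v 4 + (u 6 * v 7 + u 7 * v 6)"

definition indep4 :: "(nat \<Rightarrow> bit) \<Rightarrow> (nat \<Rightarrow> bit) \<Rightarrow> (nat \<Rightarrow> bit) \<Rightarrow> (nat \<Rightarrow> bit) \<Rightarrow> bool" where
  "indep4 a b c d \<longleftrightarrow>
     (\<forall>e f g h. (\<forall>k<8. e * a k + f * b k + g * c k + h * d k = 0) \<longrightarrow> e = 0 \<and> f = 0 \<and> g = 0 \<and> h = 0)"

definition sing4 :: "(nat \<Rightarrow> bit) \<Rightarrow> (nat \<Rightarrow> bit) \<Rightarrow> (nat \<Rightarrow> bit) \<Rightarrow> (nat \<Rightarrow> bit) \<Rightarrow> bool" where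
  "sing4 a b c d \<longleftrightarrow> qform a = 0 \<and> qform b = 0 \<and> qform c = 0 \<and> qform d = 0 \<and>
     bform a b = 0 \<and> bform a c = 0 \<and> bform a d = 0 \<and> bform b c = 0 \<and> bform b d = 0 \<and> bform c d = 0 \<and> indep4 a b c d"

lemma indep4D:
  assumes "indep4 a b c d" "\<And>k. k < 8 \<Longrightarrow> e * a k + f * b k + g * c k + h * d k = 0"
  shows "e = 0" "f = 0" "g = 0" "h = 0"
  using assms unfolding indep4_def by blast+

lemma bform_commute: "bform u v = bform v u"
  unfolding bform_def by (simp only: ac_simps)

lemma sing4_swap_ad: assumes "sing4 a b c d" shows "sing4 d b c a"
proof -
  have "indep4 d b c a"
    unfolding indep4_def
  proof (intro allI impI)
    fix e f g h assume *: "\<forall>k<8. e * d k + f * b k + g * c k + h * a k = 0"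
    have **: "h * a k + f * b k + g * c k + e * d k = 0" if "k < 8" for k
      using *[rule_format, OF that] by (simp only: ac_simps)
    have "e = 0 \<and> f = 0 \<and> g = 0 \<and> h = 0"
      using indep4D[of a b c d h f g e, OF _ **] assms by (simp add: sing4_def)
    then show "e = 0 \<and> f = 0 \<and> g = 0 \<and> h = 0" by simp
  qed
  then show ?thesis
    using assms by (simp add: sing4_def bform_commute[of d a] bform_commute[of d b] bform_commute[of d c] bform_commute[of b a] bform_commute[of c a])
qed

lemma sing4_swap_ab: assumes "sing4 a b c d" shows "sing4 b a c d"
proof -
  have "indep4 b a c d"
    unfolding indep4_def
  proof (intro allI impI)
    fix e f g h assume *: "\<forall>k<8. e * b k + f * a k + g * c k + h * d k = 0"
    have **: "f * a k + e * b k + g * c k + h * d k = 0" if "k < 8" for k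
      using *[rule_format, OF that] by (simp only: ac_simps)
    have "e = 0 \<and> f = 0 \<and> g = 0 \<and> h = 0"
      using indep4D[of a b c d f e g h, OF _ **] assms by (simp add: sing4_def)
    then show "e = 0 \<and> f = 0 \<and> g = 0 \<and> h = 0" by simp
  qed
  then show ?thesis
    using assms by (simp add: sing4_def bform_commute[of b a])
qed

lemma sing4_swap_ac: assumes "sing4 a b c d" shows "sing4 c b a d"
proof -
  have "indep4 c b a d"
    unfolding indep4_def
  proof (intro allI impI)
    fix e f g h assume *: "\<forall>k<8. e * c k + f * b k + g * a k + h * d k = 0"
    have **: "g * a k + f * b k + e * c k + h * d k = 0" if "k < 8" for k
      using *[rule_format, OF that] by (simp only: ac_simps)
    have "e = 0 \<and> f = 0 \<and> g = 0 \<and> h = 0"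
      using indep4D[of a b c d g f e h, OF _ **] assms by (simp add: sing4_def)
    then show "e = 0 \<and> f = 0 \<and> g = 0 \<and> h = 0" by simp
  qed
  then show ?thesis
    using assms by (simp add: sing4_def bform_commute[of c a] bform_commute[of c b] bform_commute[of b a])
qed

lemma bform_self: "bform u u = 0"
  unfolding bform_def by (simp only: ac_simps bit_self_add add_0_right)

lemma qform_comb:
  "qform (\<lambda>k. a k + f * b k + g * c k + h * d k) = qform a + f * qform b + g * qform c + h * qform d
     + f * bform a b + g * bform a c + h * bform a d + f * g * bform b c + f * h * bform b d + g * h * bform c d"
  unfolding qform_def bform_def
  by (cases f; cases g; cases h; simp only: mult_zero_left add_0_right add_0_left mult_1 algebra_simps bit_self_add)

lemma bform_comb:
  "bform u (\<lambda>k. a k + f * b k + g * c k + h * d k) = bform u a + f * bform u b + g * bform u c + h * bform u d"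
  unfolding bform_def by (simp only: algebra_simps)

lemma sing4_comb:
  assumes "sing4 a b c d" shows "sing4 (\<lambda>k. a k + f * b k + g * c k + h * d k) b c d"
proof -
  let ?u = "\<lambda>k. a k + f * b k + g * c k + h * d k"
  have "indep4 ?u b c d"
    unfolding indep4_def
  proof (intro allI impI)
    fix e' f' g' h' assume *: "\<forall>k<8. e' * ?u k + f' * b k + g' * c k + h' * d k = 0"
    have **: "e' * a k + (f' + e' * f) * b k + (g' + e' * g) * c k + (h' + e' * h) * d k = 0" if "k < 8" for k
      using *[rule_format, OF that] by (simp only: algebra_simps)
    have "e' = 0" "f' + e' * f = 0" "g' + e' * g = 0" "h' + e' * h = 0"
      using assms indep4D[of a b c d, OF _ **] by (simp_all add: sing4_def)
    then show "e' = 0 \<and> f' = 0 \<and> g' = 0 \<and> h' = 0" by simp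
  qed
  moreover have "bform ?u b = 0" "bform ?u c = 0" "bform ?u d = 0"
    using assms bform_commute[of b a] bform_commute[of c a] bform_commute[of d a] bform_commute[of c b] bform_commute[of d b] bform_commute[of d c]
    by (simp_all add: bform_commute[of ?u] bform_comb sing4_def bform_self)
  ultimately show ?thesis
    using assms by (simp add: sing4_def qform_comb)
qed

lemma kernel_vector:
  assumes "A \<in> carrier_mat n n" "det (A :: bit mat) = 0"
  obtains v where "v \<in> carrier_vec n" "v \<noteq> 0\<^sub>v n" "A *\<^sub>v v = 0\<^sub>v n"
  using assms det_0_iff_vec_prod_zero_field by blast

lemma vec_nonzero: "v \<in> carrier_vec n \<Longrightarrow> v \<noteq> 0\<^sub>v n \<Longrightarrow> \<exists>i<n. v $ i \<noteq> 0"
  by (metis carrier_vecD eq_vecI index_zero_vec)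

lemma sum_0_4: "(\<Sum>i = 0..<4. f i) = f 0 + f 1 + f 2 + f (3::nat)"
  by (simp add: eval_nat_numeral)

lemma sum_0_3: "(\<Sum>i = 0..<3. f i) = f 0 + f 1 + f (2::nat)"
  by (simp add: eval_nat_numeral)

lemma all_less_3: "(\<forall>i<3. P i) \<longleftrightarrow> P 0 \<and> P 1 \<and> P (2::nat)"
  by (auto simp: less_Suc_eq eval_nat_numeral)

lemma all_less_4: "(\<forall>i<4. P i) \<longleftrightarrow> P 0 \<and> P 1 \<and> P 2 \<and> P (3::nat)"
  by (auto simp: less_Suc_eq eval_nat_numeral)

lemma bit_dependent_4_3:
  fixes a b c d :: "nat \<Rightarrow> bit"
  obtains e f g h where "e \<noteq> 0 \<or> f \<noteq> 0 \<or> g \<noteq> 0 \<or> h \<noteq> 0"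
    "\<And>k. k \<in> {i, j, l} \<Longrightarrow> e * a k + f * b k + g * c k + h * d k = 0"
proof -
  let ?r = "\<lambda>k. [a k, b k, c k, d k]"
  \<comment> \<open>The zero row makes the matrix square, so that the relation comes from a
    vanishing determinant.\<close>
  let ?A = "mat 4 4 (\<lambda>(x, y). [?r i, ?r j, ?r l, [0, 0, 0, 0]] ! x ! y)"
  have "det ?A = (\<Sum>y<4. ?A $$ (3, y) * cofactor ?A 3 y)"
    by (rule laplace_expansion_row) auto
  also have "\<dots> = 0"
    by (rule sum.neutral) (auto simp: less_Suc_eq numeral_eq_Suc)
  finally have "det ?A = 0" .
  then obtain v where v: "v \<in> carrier_vec 4" "v \<noteq> 0\<^sub>v 4" "?A *\<^sub>v v = 0\<^sub>v 4"
    by (rule kernel_vector[rotated]) auto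
  have "\<forall>x<4. (?A *\<^sub>v v) $ x = 0"
    using v(3) by simp
  then have "v $ 0 * a i + v $ 1 * b i + v $ 2 * c i + v $ 3 * d i = 0"
    "v $ 0 * a j + v $ 1 * b j + v $ 2 * c j + v $ 3 * d j = 0"
    "v $ 0 * a l + v $ 1 * b l + v $ 2 * c l + v $ 3 * d l = 0"
    using v(1) by (simp_all add: all_less_4 scalar_prod_def sum_0_4 mult.commute)
  then have "v $ 0 * a k + v $ 1 * b k + v $ 2 * c k + v $ 3 * d k = 0" if "k \<in> {i, j, l}" for k
    using that by (elim insertE emptyE) (simp_all only:)
  moreover have "v $ 0 \<noteq> 0 \<or> v $ 1 \<noteq> 0 \<or> v $ 2 \<noteq> 0 \<or> v $ 3 \<noteq> 0"
    using vec_nonzero[OF v(1,2)] all_less_4[of "\<lambda>i. v $ i = 0"] by blast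
  ultimately show thesis using that by blast
qed

text \<open>The nonzero vector d lies in the kernel of the matrix with rows a, b, c, so its
  determinant vanishes; a kernel vector of the transpose is the relation between the rows.\<close>

lemma bit_orth_1:
  fixes a1 a2 a3 b1 b2 b3 c1 c2 c3 d1 d2 d3 :: bit
  assumes "d1 \<noteq> 0 \<or> d2 \<noteq> 0 \<or> d3 \<noteq> 0"
    "a1 * d1 + a2 * d2 + a3 * d3 = 0" "b1 * d1 + b2 * d2 + b3 * d3 = 0" "c1 * d1 + c2 * d2 + c3 * d3 = 0"
  shows "\<exists>f g h. (f \<noteq> 0 \<or> g \<noteq> 0 \<or> h \<noteq> 0) \<and> f * a1 + g * b1 + h * c1 = 0 \<and>
    f * a2 + g * b2 + h * c2 = 0 \<and> f * a3 + g * b3 + h * c3 = 0"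
proof -
  let ?A = "mat 3 3 (\<lambda>(x, y). [[a1, a2, a3], [b1, b2, b3], [c1, c2, c3]] ! x ! y)"
  let ?d = "vec 3 (\<lambda>x. [d1, d2, d3] ! x)"
  have "?A *\<^sub>v ?d = 0\<^sub>v 3"
  proof (rule eq_vecI)
    have "\<forall>x<3. (?A *\<^sub>v ?d) $ x = 0"
      using assms(2-) by (simp add: all_less_3 scalar_prod_def sum_0_3)
    then show "(?A *\<^sub>v ?d) $ x = 0\<^sub>v 3 $ x" if "x < dim_vec (0\<^sub>v 3 :: bit vec)" for x
      using that by simp
  qed simp
  moreover have "?d \<noteq> 0\<^sub>v 3"
  proof
    assume "?d = 0\<^sub>v 3"
    then have "\<forall>x<3. ?d $ x = 0" by simp
    then show False using assms(1) by (simp add: all_less_3)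
  qed
  moreover have "?d \<in> carrier_vec 3" by simp
  ultimately have "det ?A = 0"
    unfolding det_0_iff_vec_prod_zero_field[OF mat_carrier] by blast
  then have "det (transpose_mat ?A) = 0"
    using det_transpose[of ?A 3] by simp
  then obtain v where v: "v \<in> carrier_vec 3" "v \<noteq> 0\<^sub>v 3" "transpose_mat ?A *\<^sub>v v = 0\<^sub>v 3"
    by (rule kernel_vector[rotated]) auto
  have "\<forall>x<3. (transpose_mat ?A *\<^sub>v v) $ x = 0"
    using v(3) by simp
  then have "v $ 0 * a1 + v $ 1 * b1 + v $ 2 * c1 = 0" "v $ 0 * a2 + v $ 1 * b2 + v $ 2 * c2 = 0"
    "v $ 0 * a3 + v $ 1 * b3 + v $ 2 * c3 = 0"
    using v(1) by (simp_all add: all_less_3 scalar_prod_def sum_0_3 mult.commute)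
  moreover have "v $ 0 \<noteq> 0 \<or> v $ 1 \<noteq> 0 \<or> v $ 2 \<noteq> 0"
    using vec_nonzero[OF v(1,2)] all_less_3[of "\<lambda>i. v $ i = 0"] by blast
  ultimately show ?thesis by blast
qed

text \<open>The orthogonal complement of two independent vectors in dimension three is a line, and
  over two elements a line has only one nonzero vector. Over this field independence just means
  nonzero and distinct.\<close>

lemma bit_orth_2:
  fixes a1 a2 a3 b1 b2 b3 c1 c2 c3 d1 d2 d3 :: bit
  assumes "(c1, c2, c3) \<noteq> (0, 0, 0)" "(d1, d2, d3) \<noteq> (0, 0, 0)" "(c1, c2, c3) \<noteq> (d1, d2, d3)"
    "a1 * d1 + a2 * d2 + a3 * d3 = 0" "b1 * d1 + b2 * d2 + b3 * d3 = 0"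
    "a1 * c1 + a2 * c2 + a3 * c3 = 0" "b1 * c1 + b2 * c2 + b3 * c3 = 0"
  shows "(a1, a2, a3) = (0, 0, 0) \<or> (b1, b2, b3) = (0, 0, 0) \<or> (a1, a2, a3) = (b1, b2, b3)"
proof -
  have all_bit: "(\<forall>x::bit. P x) \<longleftrightarrow> P 0 \<and> P 1" for P
    by (metis bit.exhaust)
  have "\<forall>c1 c2 c3 d1 d2 d3 :: bit. (c1, c2, c3) \<noteq> (0, 0, 0) \<and> (d1, d2, d3) \<noteq> (0, 0, 0) \<and> (c1, c2, c3) \<noteq> (d1, d2, d3) \<longrightarrow>
    (\<forall>a1 a2 a3. a1 * d1 + a2 * d2 + a3 * d3 = 0 \<and> a1 * c1 + a2 * c2 + a3 * c3 = 0 \<longrightarrow>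
    (\<forall>b1 b2 b3. b1 * d1 + b2 * d2 + b3 * d3 = 0 \<and> b1 * c1 + b2 * c2 + b3 * c3 = 0 \<longrightarrow>
      (a1, a2, a3) = (0, 0, 0) \<or> (b1, b2, b3) = (0, 0, 0) \<or> (a1, a2, a3) = (b1, b2, b3)))"
    by (simp add: all_bit)
  from this[rule_format, of c1 c2 c3 d1 d2 d3 a1 a2 a3 b1 b2 b3] show ?thesis
    using assms by argo
qed

lemma sing4_swap_bc: "sing4 a b c d \<Longrightarrow> sing4 a c b d"
  by (metis sing4_swap_ab sing4_swap_ac)

lemma sing4_swap_cd: "sing4 a b c d \<Longrightarrow> sing4 a b d c"
  by (metis sing4_swap_ac sing4_swap_ad)

text \<open>Basis exchange: a nonzero combination of the later vectors takes the place of one of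
  them, while the vectors already placed stay fixed.\<close>

lemma sing4_pick_c:
  assumes "sing4 a b c d" "g \<noteq> 0 \<or> h \<noteq> 0"
  shows "\<exists>d'. sing4 a b (\<lambda>k. g * c k + h * d k) d'"
proof (cases "g = 0")
  case False
  then show ?thesis
    using sing4_swap_ac[OF sing4_comb[OF sing4_swap_ac[OF assms(1)], of 0 0 h]] by (auto simp: add.assoc)
next
  case True
  then show ?thesis using assms(2) sing4_swap_cd[OF assms(1)] by auto
qed

lemma sing4_pick_b:
  assumes "sing4 a b c d" "f \<noteq> 0 \<or> g \<noteq> 0 \<or> h \<noteq> 0"
  shows "\<exists>c' d'. sing4 a (\<lambda>k. f * b k + g * c k + h * d k) c' d'"
proof (cases "f = 0")
  case False
  then show ?thesis
    using sing4_swap_ab[OF sing4_comb[OF sing4_swap_ab[OF assms(1)], of 0 g h]] by auto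
next
  case True
  then have "g \<noteq> 0 \<or> h \<noteq> 0" using assms(2) by simp
  from sing4_pick_c[OF assms(1) this] show ?thesis
    using True by (auto dest: sing4_swap_bc)
qed

lemma sing4_pick_a:
  assumes "sing4 a b c d" "e \<noteq> 0 \<or> f \<noteq> 0 \<or> g \<noteq> 0 \<or> h \<noteq> 0"
  shows "\<exists>b' c' d'. sing4 (\<lambda>k. e * a k + f * b k + g * c k + h * d k) b' c' d'"
proof (cases "e = 0")
  case False
  then show ?thesis
    using sing4_comb[OF assms(1), of f g h] by auto
next
  case True
  then have "f \<noteq> 0 \<or> g \<noteq> 0 \<or> h \<noteq> 0" using assms(2) by simp
  from sing4_pick_b[OF assms(1) this] show ?thesis
    using True by (auto dest: sing4_swap_ab)
qed

lemma less_8_cases: "k < 8 \<Longrightarrow> k = 0 \<or> k = 1 \<or> k = 2 \<or> k = 3 \<or> k = 4 \<or> k = 5 \<or> k = 6 \<or> k = (7::nat)"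
  by linarith

text \<open>On the subspace F where the coordinates 0, 2, 4 vanish, only the anisotropic plane
  contributes to \<open>qform\<close>. Singular vectors of F therefore lie in the 3-space of the
  coordinates 1, 3, 5.\<close>

lemma qform_zero_on_F:
  assumes "qform u = 0" "u 0 = 0" "u 2 = 0" "u 4 = 0"
  shows "u 6 = 0" "u 7 = 0"
  using assms unfolding qform_def by (cases "u 6"; cases "u 7"; simp)+

lemma F_nonzero:
  assumes "indep4 a b c d" "u 0 = 0" "u 2 = 0" "u 4 = 0" "u 6 = 0" "u 7 = 0"
    "\<And>k. k \<in> {1, 3, 5} \<Longrightarrow> e * a k + f * b k + g * c k + h * d k = u k"
    "\<And>k. k \<in> {0, 2, 4, 6, 7} \<Longrightarrow> e * a k + f * b k + g * c k + h * d k = 0"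
    "e \<noteq> 0 \<or> f \<noteq> 0 \<or> g \<noteq> 0 \<or> h \<noteq> 0"
  shows "u 1 \<noteq> 0 \<or> u 3 \<noteq> 0 \<or> u 5 \<noteq> 0"
proof (rule ccontr)
  assume "\<not> ?thesis"
  then have "e * a k + f * b k + g * c k + h * d k = 0" if "k < 8" for k
    using less_8_cases[OF that] assms(7,8)[of k] by auto
  then show False using indep4D[OF assms(1)] assms(9) by blast
qed

text \<open>A maximal totally singular subspace of an eight-dimensional quadratic space of minus type
  has dimension three.\<close>

lemma not_sing4: "\<not> sing4 a b c d"
proof
  assume "sing4 a b c d"
  \<comment> \<open>Four vectors have dependent images in the coordinates 0, 2, 4, so the space
    meets F. The basis is now moved into F one vector at a time, until four independent vectors lie
    in a 3-space.\<close>
  obtain e f g h where nz1: "e \<noteq> 0 \<or> f \<noteq> 0 \<or> g \<noteq> 0 \<or> h \<noteq> 0" and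
    k1: "\<And>k. k \<in> {0, 2, 4} \<Longrightarrow> e * a k + f * b k + g * c k + h * d k = 0"
    by (rule bit_dependent_4_3[where i = 0 and j = 2 and l = 4 and a = a and b = b and c = c and d = d]) blast
  from sing4_pick_a[OF \<open>sing4 a b c d\<close> nz1] obtain a1 b1 c1 d1 where
    s1: "sing4 a1 b1 c1 d1" and a1_def: "a1 = (\<lambda>k. e * a k + f * b k + g * c k + h * d k)"
    by blast
  have a1: "a1 0 = 0" "a1 2 = 0" "a1 4 = 0"
    by (simp_all only: a1_def) (rule k1; simp)+
  have a1': "a1 6 = 0" "a1 7 = 0"
    using qform_zero_on_F a1 s1 by (auto simp: sing4_def)
  have na: "a1 1 \<noteq> 0 \<or> a1 3 \<noteq> 0 \<or> a1 5 \<noteq> 0"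
    by (rule F_nonzero[of a1 b1 c1 d1 a1 1 0 0 0]) (use s1 a1 a1' in \<open>auto simp: sing4_def\<close>)
  have o1: "v 0 * a1 1 + v 2 * a1 3 + v 4 * a1 5 = 0" if "bform a1 v = 0" for v
    using that a1 a1' by (simp add: bform_def mult.commute)
  \<comment> \<open>Orthogonality to \<open>a1\<close> confines the coordinates 0, 2, 4 of the other
    three vectors to a plane, where they are dependent.\<close>
  from bit_orth_1[OF na o1[of b1] o1[of c1] o1[of d1]] s1
  obtain f g h where nz2: "f \<noteq> 0 \<or> g \<noteq> 0 \<or> h \<noteq> 0" and
    k2: "f * b1 0 + g * c1 0 + h * d1 0 = 0" "f * b1 2 + g * c1 2 + h * d1 2 = 0" "f * b1 4 + g * c1 4 + h * d1 4 = 0"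
    by (auto simp: sing4_def)
  from sing4_pick_b[OF s1 nz2] obtain b2 c2 d2 where
    s2: "sing4 a1 b2 c2 d2" and b2_def: "b2 = (\<lambda>k. f * b1 k + g * c1 k + h * d1 k)"
    by blast
  have b2: "b2 0 = 0" "b2 2 = 0" "b2 4 = 0"
    by (simp_all only: b2_def k2)
  have b2': "b2 6 = 0" "b2 7 = 0"
    using qform_zero_on_F b2 s2 by (auto simp: sing4_def)
  have nb: "b2 1 \<noteq> 0 \<or> b2 3 \<noteq> 0 \<or> b2 5 \<noteq> 0"
    by (rule F_nonzero[of a1 b2 c2 d2 b2 0 1 0 0]) (use s2 a1 a1' b2 b2' in \<open>auto simp: sing4_def\<close>)
  have nab: "a1 1 + b2 1 \<noteq> 0 \<or> a1 3 + b2 3 \<noteq> 0 \<or> a1 5 + b2 5 \<noteq> 0"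
    by (rule F_nonzero[of a1 b2 c2 d2 "\<lambda>k. a1 k + b2 k" 1 1 0 0]) (use s2 a1 a1' b2 b2' in \<open>auto simp: sing4_def\<close>)
  have o2: "v 0 * b2 1 + v 2 * b2 3 + v 4 * b2 5 = 0" if "bform b2 v = 0" for v
    using that b2 b2' by (simp add: bform_def mult.commute)
  have "(c2 0, c2 2, c2 4) = (0, 0, 0) \<or> (d2 0, d2 2, d2 4) = (0, 0, 0) \<or> (c2 0, c2 2, c2 4) = (d2 0, d2 2, d2 4)"
    by (rule bit_orth_2[of "b2 1" "b2 3" "b2 5" "a1 1" "a1 3" "a1 5"])
       (use na nb nab o1 o2 s2 in \<open>auto simp: sing4_def\<close>)
  then obtain g h where nz3: "g \<noteq> 0 \<or> h \<noteq> 0" and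
    k3: "g * c2 0 + h * d2 0 = 0" "g * c2 2 + h * d2 2 = 0" "g * c2 4 + h * d2 4 = 0"
    by (elim disjE) (rule that[of 1 0] that[of 0 1] that[of 1 1]; simp)+
  from sing4_pick_c[OF s2 nz3] obtain c3 d3 where
    s3: "sing4 a1 b2 c3 d3" and c3_def: "c3 = (\<lambda>k. g * c2 k + h * d2 k)"
    by blast
  have c3: "c3 0 = 0" "c3 2 = 0" "c3 4 = 0"
    by (simp_all only: c3_def k3)
  have c3': "c3 6 = 0" "c3 7 = 0"
    using qform_zero_on_F c3 s3 by (auto simp: sing4_def)
  have o3: "v 0 * c3 1 + v 2 * c3 3 + v 4 * c3 5 = 0" if "bform c3 v = 0" for v
    using that c3 c3' by (simp add: bform_def mult.commute)
  \<comment> \<open>The vectors \<open>a1\<close>, \<open>b2\<close>, \<open>c3\<close> span the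
    whole 3-space of the coordinates 1, 3, 5, so orthogonality to them leaves only 0 for these
    coordinates of \<open>d3\<close>.\<close>
  have d3: "d3 0 = 0 \<and> d3 2 = 0 \<and> d3 4 = 0"
  proof (rule ccontr)
    assume "\<not> ?thesis"
    then have "d3 0 \<noteq> 0 \<or> d3 2 \<noteq> 0 \<or> d3 4 \<noteq> 0" by simp
    from bit_orth_1[OF this, of "a1 1" "a1 3" "a1 5" "b2 1" "b2 3" "b2 5" "c3 1" "c3 3" "c3 5"]
      o1[of d3] o2[of d3] o3[of d3] s3
    obtain f g h where n: "f \<noteq> 0 \<or> g \<noteq> 0 \<or> h \<noteq> 0" and
      *: "f * a1 1 + g * b2 1 + h * c3 1 = 0" "f * a1 3 + g * b2 3 + h * c3 3 = 0" "f * a1 5 + g * b2 5 + h * c3 5 = 0"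
      by (auto simp: sing4_def mult.commute)
    have "f * a1 k + g * b2 k + h * c3 k + 0 * d3 k = 0" if "k < 8" for k
      using less_8_cases[OF that] a1 a1' b2 b2' c3 c3' * by auto
    then show False using indep4D[of a1 b2 c3 d3 f g h 0] s3 n by (simp add: sing4_def)
  qed
  then have d3': "d3 6 = 0" "d3 7 = 0"
    using qform_zero_on_F s3 by (auto simp: sing4_def)
  obtain e f g h where n: "e \<noteq> 0 \<or> f \<noteq> 0 \<or> g \<noteq> 0 \<or> h \<noteq> 0" and
    *: "\<And>k. k \<in> {1, 3, 5} \<Longrightarrow> e * a1 k + f * b2 k + g * c3 k + h * d3 k = 0"
    by (rule bit_dependent_4_3[where i = 1 and j = 3 and l = 5 and a = a1 and b = b2 and c = c3 and d = d3]) blast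
  have "e * a1 k + f * b2 k + g * c3 k + h * d3 k = 0" if "k < 8" for k
    using less_8_cases[OF that] a1 a1' b2 b2' c3 c3' d3 d3' *[of k] by auto
  then show False using indep4D[of a1 b2 c3 d3 e f g h] s3 n by (simp add: sing4_def)
qed

section \<open>Lattices with a characteristic vector\<close>

text \<open>\<open>b0\<close> is \<open>H \<bottom> H \<bottom> H \<bottom> [0 1; 1 1]\<close>; the unit vector with index 6 is isotropic and characteristic,
  since \<open>b0 v v\<close> and \<open>v 7\<close> have the same parity.\<close>

definition b0 :: "(nat \<Rightarrow> padic2) \<Rightarrow> (nat \<Rightarrow> padic2) \<Rightarrow> padic2" where
  "b0 u v = u 0 * v 1 + u 1 * v 0 + u 2 * v 3 + u 3 * v 2 + u 4 * v 5 + u 5 * v 4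
     + (u 6 * v 7 + u 7 * v 6 + u 7 * v 7)"

definition lin4 :: "(nat \<Rightarrow> padic2) \<Rightarrow> (nat \<Rightarrow> nat \<Rightarrow> padic2) \<Rightarrow> nat \<Rightarrow> padic2" where
  "lin4 c e k = c 0 * e 0 k + c 1 * e 1 k + c 2 * e 2 k + c 3 * e 3 k"

definition even_vec :: "nat \<Rightarrow> (nat \<Rightarrow> padic2) \<Rightarrow> bool" where
  "even_vec n v \<longleftrightarrow> (\<forall>k<n. 2 dvd v k)"

definition dot :: "(nat \<Rightarrow> padic2) \<Rightarrow> (nat \<Rightarrow> padic2) \<Rightarrow> padic2" where
  "dot l v = (\<Sum>j<8. l j * v j)"

text \<open>Half the norm of \<open>gram_O\<close>, that is, a quaternion norm;
  \<open>polar_O\<close> is its polar form.\<close>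

definition norm_O :: "(nat \<Rightarrow> padic2) \<Rightarrow> padic2" where
  "norm_O a = a 0 * a 0 + a 0 * a 1 + a 1 * a 1 + 2 * (a 2 * a 2 + a 2 * a 3 + a 3 * a 3)"

definition polar_O :: "(nat \<Rightarrow> padic2) \<Rightarrow> (nat \<Rightarrow> padic2) \<Rightarrow> padic2" where
  "polar_O a b = 2 * (a 0 * b 0) + a 0 * b 1 + a 1 * b 0 + 2 * (a 1 * b 1)
     + 2 * (2 * (a 2 * b 2) + a 2 * b 3 + a 3 * b 2 + 2 * (a 3 * b 3))"

definition form4 :: "(nat \<Rightarrow> nat \<Rightarrow> padic2) \<Rightarrow> (nat \<Rightarrow> padic2) \<Rightarrow> (nat \<Rightarrow> padic2) \<Rightarrow> padic2" where
  "form4 GL a b = (\<Sum>k<4. \<Sum>l<4. a k * GL k l * b l)"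

text \<open>Gram matrices of binary planes \<open>H = [0 1; 1 0]\<close> and \<open>A = [2 1; 1 2]\<close>; \<open>gram_O\<close> is
  \<open>A \<bottom> 2A\<close>, the norm form of the maximal order of the quaternion division algebra.\<close>

definition gram_blocks :: "padic2 \<Rightarrow> padic2 \<Rightarrow> padic2 \<Rightarrow> nat \<Rightarrow> nat \<Rightarrow> padic2" where
  "gram_blocks d s d' i j =
     (if i = j then (if i < 2 then d else d')
      else if i < 2 \<and> j < 2 then 1 else if i \<ge> 2 \<and> j \<ge> 2 then s else 0)"

definition gram_O :: "nat \<Rightarrow> nat \<Rightarrow> padic2" where
  "gram_O = gram_blocks 2 2 4"

definition bit_lift :: "bit \<Rightarrow> padic2" where
  "bit_lift b = (if b = 0 then 0 else 1)"

lemma par_bit_lift [simp]: "par (bit_lift b) = b"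
  by (cases b) (simp_all add: bit_lift_def)

lemma par_two_powers [simp]: "par 2 = 0" "par 4 = 0" "par 8 = 0"
proof -
  show "par 2 = 0" by (simp add: par_eq_0_iff)
  have "(4::padic2) = 2 * 2" "(8::padic2) = 2 * 4" by simp_all
  then show "par 4 = 0" "par 8 = 0" by (simp_all only: par_eq_0_iff dvd_triv_left)
qed

lemma sum_less_8: "(\<Sum>i<8. f i) = f 0 + f 1 + f 2 + f 3 + f 4 + f 5 + f 6 + f (7::nat)"
  by (simp add: eval_nat_numeral)

lemma sum_less_4: "(\<Sum>i<4. f i) = f 0 + f 1 + f 2 + f (3::nat)"
  by (simp add: eval_nat_numeral)

lemma all_less_8: "(\<forall>k<8. P k) \<longleftrightarrow> P 0 \<and> P 1 \<and> P 2 \<and> P 3 \<and> P 4 \<and> P 5 \<and> P 6 \<and> P (7::nat)"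
  by (simp add: eval_nat_numeral All_less_Suc conj_ac)

lemma all_less_6: "(\<forall>k<6. P k) \<longleftrightarrow> P 0 \<and> P 1 \<and> P 2 \<and> P 3 \<and> P 4 \<and> P (5::nat)"
  by (simp add: eval_nat_numeral All_less_Suc conj_ac)

lemma less_4_cases: "i < 4 \<Longrightarrow> i = 0 \<or> i = 1 \<or> i = 2 \<or> i = (3::nat)"
  by linarith

lemma less_pair_4_cases:
  "i < j \<Longrightarrow> j < 4 \<Longrightarrow> i = 0 \<and> j = 1 \<or> i = 0 \<and> j = 2 \<or> i = 0 \<and> j = 3 \<or>
    i = 1 \<and> j = 2 \<or> i = 1 \<and> j = 3 \<or> i = 2 \<and> j = (3::nat)"
  by linarith

lemma lin4_sum: "lin4 c e k = (\<Sum>i<4. c i * e i k)"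
  by (simp add: lin4_def sum_less_4)

lemma dot_even: "even_vec 8 l \<Longrightarrow> 2 dvd dot l v"
  unfolding dot_def by (rule dvd_sum) (simp add: even_vec_def)

lemma dot_lin4: "dot l (lin4 c e) = c 0 * dot l (e 0) + c 1 * dot l (e 1) + c 2 * dot l (e 2) + c 3 * dot l (e 3)"
  unfolding lin4_def dot_def sum_less_8 by (simp add: algebra_simps)

lemma form4_O: "form4 (\<lambda>i j. x * gram_O i j) a b = x * polar_O a b"
  by (simp add: form4_def sum_less_4 gram_O_def gram_blocks_def polar_O_def algebra_simps)

lemma polar_O_self: "polar_O a a = 2 * norm_O a"
  by (simp add: polar_O_def norm_O_def algebra_simps)

lemma polar_O_commute: "polar_O a b = polar_O b a"
  by (simp add: polar_O_def algebra_simps)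

lemma par_polar_O: "par (polar_O a b) = par (a 0) * par (b 1) + par (a 1) * par (b 0)"
  by (simp add: polar_O_def)

lemma par_norm_O: "par (norm_O a) = par (a 0) * par (a 0) + par (a 0) * par (a 1) + par (a 1) * par (a 1)"
  by (simp add: norm_O_def)

lemma bit_norm_eq_0: "(x::bit) * x + x * y + y * y = 0 \<longleftrightarrow> x = 0 \<and> y = 0"
  by (cases x; cases y; simp)

lemma norm_O_even: "2 dvd norm_O a \<Longrightarrow> 2 dvd a 0 \<and> 2 dvd a 1"
  by (simp add: par_eq_0_iff[symmetric] par_norm_O bit_norm_eq_0)

text \<open>Since x^2 + xy + y^2 is anisotropic modulo 2, an even value forces \<open>a 0\<close>
  and \<open>a 1\<close> to be even. Their contribution is then divisible by 4, and the same
  argument applies to the second plane after division by 2.\<close>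

lemma norm_O_dvd_4: 
  assumes "4 dvd norm_O a"
  shows "even_vec 4 a"
proof -
  have "(2::padic2) dvd 4" by (rule dvdI[of _ _ 2]) simp
  then have "2 dvd norm_O a" using assms by (rule dvd_trans)
  then obtain x y where xy: "a 0 = 2 * x" "a 1 = 2 * y" using norm_O_even by (meson dvdE)
  obtain z where "norm_O a = 4 * z" using assms by blast
  then have "2 * (a 2 * a 2 + a 2 * a 3 + a 3 * a 3) = 2 * (2 * (z - (x * x + x * y + y * y)))"
    unfolding norm_O_def xy by (simp add: algebra_simps)
  then have "a 2 * a 2 + a 2 * a 3 + a 3 * a 3 = 2 * (z - (x * x + x * y + y * y))"
    by (subst (asm) mult_cancel_left) simp
  then have "par (a 2 * a 2 + a 2 * a 3 + a 3 * a 3) = 0" by simp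
  then have "2 dvd a 2" "2 dvd a 3"
    by (simp_all add: bit_norm_eq_0 par_eq_0_iff)
  then show ?thesis using xy by (simp add: even_vec_def all_less_4)
qed

text \<open>With \<open>v 7 = 2 * z\<close> the last block contributes 4z(v 6 + z), and one of z and
  v 6 + z is even because \<open>v 6\<close> is odd.\<close>

lemma b0_char_norm:
  assumes "\<forall>k<6. 2 dvd v k" "2 dvd v 7" "\<not> 2 dvd v 6"
  shows "8 dvd b0 v v"
proof -
  obtain x where x: "v k = 2 * x k" if "k < 6" for k
    using assms(1) unfolding dvd_def by metis
  obtain z where z: "v 7 = 2 * z" using assms(2) by blast
  have "2 dvd z * (v 6 + z)"
    using assms(3) by (simp add: even_add_iff even_mult_iff')
  then obtain y where y: "z * (v 6 + z) = 2 * y" by blast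
  have "b0 v v = 8 * (x 0 * x 1 + x 2 * x 3 + x 4 * x 5) + 4 * (z * (v 6 + z))"
    unfolding b0_def by (simp add: x z algebra_simps)
  also have "\<dots> = 8 * (x 0 * x 1 + x 2 * x 3 + x 4 * x 5 + y)"
    unfolding y by (simp add: algebra_simps)
  finally show ?thesis by simp
qed

text \<open>The inequalities state that the two 2 by 2 determinants are nonzero; multiplying by the
  adjugates isolates each coordinate.\<close>

lemma z2_lattice_blocks:
  assumes "x \<noteq> 0" "d * d \<noteq> 1" "d' * d' \<noteq> s * s"
  shows "z2_lattice 4 (\<lambda>i j. x * gram_blocks d s d' i j)"
proof -
  have "v 0 = 0 \<and> v 1 = 0 \<and> v 2 = 0 \<and> v 3 = 0"
    if *: "\<forall>i<4. (\<Sum>j<4. x * gram_blocks d s d' i j * v j) = 0" for v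
  proof -
    have **: "(\<Sum>j<4. x * gram_blocks d s d' i j * v j) = x * (\<Sum>j<4. gram_blocks d s d' i j * v j)" for i
      by (simp add: sum_distrib_left mult.assoc)
    have e: "d * v 0 + v 1 = 0" "v 0 + d * v 1 = 0" "d' * v 2 + s * v 3 = 0" "s * v 2 + d' * v 3 = 0"
      using * assms(1) unfolding ** all_less_4 by (simp_all add: sum_less_4 gram_blocks_def)
    have "(d * d - 1) * v 0 = d * (d * v 0 + v 1) - (v 0 + d * v 1)"
      "(d * d - 1) * v 1 = d * (v 0 + d * v 1) - (d * v 0 + v 1)"
      "(d' * d' - s * s) * v 2 = d' * (d' * v 2 + s * v 3) - s * (s * v 2 + d' * v 3)"
      "(d' * d' - s * s) * v 3 = d' * (s * v 2 + d' * v 3) - s * (d' * v 2 + s * v 3)"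
      by (simp_all add: algebra_simps)
    then show ?thesis using assms(2,3) unfolding e by simp
  qed
  then show ?thesis
    unfolding z2_lattice_def all_less_4 by (auto simp: gram_blocks_def)
qed

lemma padic2_numeral_neq: "(4::padic2) \<noteq> 1" "(16::padic2) \<noteq> 4"
proof -
  show 4: "(4::padic2) \<noteq> 1" by (metis par_two_powers(2) par_1 zero_neq_one)
  show "(16::padic2) \<noteq> 4"
  proof
    assume "(16::padic2) = 4"
    then have "4 * (4::padic2) = 4 * 1" by simp
    moreover have "(4::padic2) = 2 * 2" by simp
    ultimately show False using 4 two_neq_0 by (metis mult_cancel_left mult_eq_0_iff)
  qed
qed

lemma four_neq_0 [simp]: "(4::padic2) \<noteq> 0"
proof -
  have "(4::padic2) = 2 * 2" by simp
  then show ?thesis by (simp only: mult_eq_0_iff two_neq_0) simp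
qed

lemma z2_lattice_O: "x \<noteq> 0 \<Longrightarrow> z2_lattice 4 (\<lambda>i j. x * gram_O i j)"
  unfolding gram_O_def
  by (rule z2_lattice_blocks) (use padic2_numeral_neq in \<open>simp_all add: algebra_simps\<close>)

lemma z2_lattice_H_A: "z2_lattice 4 (gram_blocks 0 1 2)" and z2_lattice_H_H: "z2_lattice 4 (gram_blocks 0 1 0)"
  using z2_lattice_blocks[of 1 0 2 1] z2_lattice_blocks[of 1 0 0 1] padic2_numeral_neq by simp_all

lemma z2_lattice_scaled_one: "x \<noteq> 0 \<Longrightarrow> z2_lattice 4 (\<lambda>i j. if i = j then x else 0)"
  by (auto simp: z2_lattice_def if_distrib[of "\<lambda>x. x * _"] cong: if_cong)

section \<open>Integral forms congruent to \<open>b0\<close> modulo 8\<close>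

locale char_lattice =
  fixes B :: "(nat \<Rightarrow> padic2) \<Rightarrow> (nat \<Rightarrow> padic2) \<Rightarrow> padic2"
  assumes B_add_scale: "B u (\<lambda>k. c * v k + d * w k) = c * B u v + d * B u w"
    and B_sym: "B u v = B v u"
    and B_mod8: "8 dvd B u v - b0 u v"
begin

lemma B_lin4: "B u (lin4 c e) = c 0 * B u (e 0) + c 1 * B u (e 1) + c 2 * B u (e 2) + c 3 * B u (e 3)"
proof -
  have "lin4 c e = (\<lambda>k. 1 * (\<lambda>k. c 0 * e 0 k + c 1 * e 1 k) k + 1 * (\<lambda>k. c 2 * e 2 k + c 3 * e 3 k) k)"
    by (simp add: lin4_def fun_eq_iff)
  then show ?thesis by (simp only: B_add_scale) simp
qed

lemma B_add: "B u (\<lambda>k. v k + w k) = B u v + B u w"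
  using B_add_scale[of u 1 v 1 w] by simp

lemma par_B: "par (B u v) = par (b0 u v)"
proof -
  obtain y where "B u v - b0 u v = 8 * y" using B_mod8 by blast
  then have "par (B u v - b0 u v) = 0" by simp
  then show ?thesis by (cases "par (B u v)"; cases "par (b0 u v)"; simp)
qed

lemma B_self_even_iff: "2 dvd B v v \<longleftrightarrow> 2 dvd v 7"
  unfolding par_eq_0_iff[symmetric] par_B b0_def by (simp add: mult.commute)

lemma par_B_proj:
  assumes "2 dvd u 7" "2 dvd v 7"
  shows "par (B u v) = par (u 0) * par (v 1) + par (u 1) * par (v 0) + par (u 2) * par (v 3)
    + par (u 3) * par (v 2) + par (u 4) * par (v 5) + par (u 5) * par (v 4)"
  using assms by (simp add: par_B b0_def par_eq_0_iff[symmetric])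

text \<open>An even norm makes \<open>v 7\<close> even, so the last block contributes a multiple of
  4 to the norm. Half the norm is then, modulo 2, the form of three hyperbolic planes.\<close>

lemma par_half_norm:
  assumes "B v v = 2 * r"
  shows "par r = par (v 0) * par (v 1) + par (v 2) * par (v 3) + par (v 4) * par (v 5)"
proof -
  have "2 dvd B v v" unfolding assms by simp
  then have "2 dvd v 7" by (simp only: B_self_even_iff)
  then obtain z where z: "v 7 = 2 * z" by blast
  obtain y where y: "B v v - b0 v v = 8 * y" using B_mod8 by blast
  have "2 * r = 2 * (v 0 * v 1 + v 2 * v 3 + v 4 * v 5 + 2 * (v 6 * z + z * z + 2 * y))"
    using y unfolding assms b0_def z by (simp add: algebra_simps)
  then have "r = v 0 * v 1 + v 2 * v 3 + v 4 * v 5 + 2 * (v 6 * z + z * z + 2 * y)"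
    by (subst (asm) mult_cancel_left) simp
  then show ?thesis by simp
qed

text \<open>The vectors \<open>u i\<close> of the proof join the first six coordinates of
  \<open>v i\<close> to the pair (\<open>x i\<close>, \<open>y i\<close>). The hypotheses match
  half-norms and products of the \<open>v i\<close> with those of the pairs, and equal terms cancel
  in characteristic 2, so the \<open>u i\<close> are singular and mutually orthogonal and
  \<open>not_sing4\<close> gives a relation. Coordinate 6 of the \<open>v i\<close> is not
  controlled: the combination is 0 or the characteristic vector modulo 2.\<close>

lemma witt:
  fixes v :: "nat \<Rightarrow> nat \<Rightarrow> padic2" and r :: "nat \<Rightarrow> padic2" and x y :: "nat \<Rightarrow> bit"
  assumes norm: "\<And>i. i < 4 \<Longrightarrow> B (v i) (v i) = 2 * r i"
    and r: "\<And>i. i < 4 \<Longrightarrow> par (r i) = x i * x i + x i * y i + y i * y i"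
    and orth: "\<And>i j. i < j \<Longrightarrow> j < 4 \<Longrightarrow> par (B (v i) (v j)) = x i * y j + y i * x j"
  obtains c where "\<not> even_vec 4 c" "\<forall>k<6. 2 dvd lin4 c v k" "2 dvd lin4 c v 7"
    "par (c 0) * x 0 + par (c 1) * x 1 + par (c 2) * x 2 + par (c 3) * x 3 = 0"
    "par (c 0) * y 0 + par (c 1) * y 1 + par (c 2) * y 2 + par (c 3) * y 3 = 0"
proof -
  define u where "u i k = (if k < 6 then par (v i k) else if k = 6 then x i else y i)" for i k
  have v7: "2 dvd v i 7" if "i < 4" for i
    using B_self_even_iff[of "v i"] unfolding norm[OF that] by simp
  have q: "qform (u i) = 0" if "i < 4" for i
    using r[OF that] par_half_norm[OF norm[OF that]]
    by (simp add: qform_def u_def)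
  have b: "bform (u i) (u j) = 0" if "i < j" "j < 4" for i j
    using orth[OF that] par_B_proj[of "v i" "v j"] v7[of i] v7[of j] that
    by (simp add: bform_def u_def)
  have "\<not> indep4 (u 0) (u 1) (u 2) (u 3)"
    using not_sing4[of "u 0" "u 1" "u 2" "u 3"] q b by (simp add: sing4_def)
  then obtain e f g h where n: "\<not> (e = 0 \<and> f = 0 \<and> g = 0 \<and> h = 0)"
    and z: "\<forall>k<8. e * u 0 k + f * u 1 k + g * u 2 k + h * u 3 k = 0"
    unfolding indep4_def by blast
  define c where "c i = bit_lift ([e, f, g, h] ! i)" for i
  have pc: "par (c 0) = e" "par (c 1) = f" "par (c 2) = g" "par (c 3) = h"
    by (simp_all add: c_def)
  show thesis
  proof (rule that[of c])
    show "\<not> even_vec 4 c"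
      using n by (simp add: even_vec_def all_less_4 par_eq_0_iff[symmetric] pc pc(2)[simplified])
    show "\<forall>k<6. 2 dvd lin4 c v k"
    proof (intro allI impI)
      fix k :: nat assume "k < 6"
      then have "e * par (v 0 k) + f * par (v 1 k) + g * par (v 2 k) + h * par (v 3 k) = 0"
        using z[rule_format, of k] by (simp add: u_def)
      then show "2 dvd lin4 c v k"
        by (simp add: par_eq_0_iff[symmetric] lin4_def pc pc(2)[simplified])
    qed
    show "2 dvd lin4 c v 7"
      using v7 by (simp add: lin4_def)
    show "par (c 0) * x 0 + par (c 1) * x 1 + par (c 2) * x 2 + par (c 3) * x 3 = 0"
      using z[rule_format, of 6] by (simp add: pc pc(2)[simplified] u_def)
    show "par (c 0) * y 0 + par (c 1) * y 1 + par (c 2) * y 2 + par (c 3) * y 3 = 0"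
      using z[rule_format, of 7] by (simp add: pc pc(2)[simplified] u_def)
  qed
qed

end

section \<open>The contradiction in the unimodular overlattice\<close>

text \<open>\<open>S\<close> is the matrix of \<open>2^t T^-1\<close>, where \<open>T\<close> embeds the given lattice \<open>M\<close> into its unimodular
  overlattice, so \<open>S v\<close> is even iff \<open>2^(t-1) v\<close> lies in \<open>M\<close> (for \<open>t > 0\<close>). In \<open>sat\<close>, the \<open>e i\<close> are a basis of the
  saturation in the overlattice of a primitively represented lattice, and \<open>a i\<close> are the
  coordinates of \<open>2^t e i\<close> in that lattice.\<close>

locale universal_char_lattice = char_lattice B
  for B :: "(nat \<Rightarrow> padic2) \<Rightarrow> (nat \<Rightarrow> padic2) \<Rightarrow> padic2" +
  fixes S :: "nat \<Rightarrow> nat \<Rightarrow> padic2" and t :: nat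
  assumes t_0: "t = 0 \<Longrightarrow> \<exists>k<8. \<not> 2 dvd S k 6"
    and S_odd: "\<exists>k<8. \<exists>j<8. \<not> 2 dvd S k j"
    and rep: "z2_lattice 4 GL \<Longrightarrow> \<exists>n. (\<forall>i<4. \<forall>k<8. 2 ^ t dvd dot (S k) (n i)) \<and>
      (\<forall>i<4. \<forall>j<4. B (n i) (n j) = GL i j)"
    and sat: "z2_lattice 4 GL \<Longrightarrow> \<exists>e a. (\<forall>c. even_vec 8 (lin4 c e) \<longrightarrow> even_vec 4 c) \<and>
      (\<forall>i<4. \<forall>j<4. 4 ^ t * B (e i) (e j) = form4 GL (a i) (a j)) \<and>
      (\<forall>c. even_vec 4 (lin4 c a) \<longleftrightarrow> (\<forall>k<8. 2 dvd dot (S k) (lin4 c e)))"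
begin

lemma B_comb: 
  assumes "\<And>i j. i < 4 \<Longrightarrow> j < 4 \<Longrightarrow> x * B (e i) (e j) = y * polar_O (a i) (a j)"
  shows "x * B (lin4 c e) (lin4 d e) = y * polar_O (lin4 c a) (lin4 d a)"
proof -
  have polar_O_lin: "polar_O u (lin4 c a) = c 0 * polar_O u (a 0) + c 1 * polar_O u (a 1) + c 2 * polar_O u (a 2) + c 3 * polar_O u (a 3)" for u c
    unfolding polar_O_def lin4_def by (simp add: algebra_simps)
  have 1: "x * B (e i) (lin4 c e) = y * polar_O (a i) (lin4 c a)" if "i < 4" for i c
  proof -
    have "x * B (e i) (lin4 c e) = c 0 * (x * B (e i) (e 0)) + c 1 * (x * B (e i) (e 1)) + c 2 * (x * B (e i) (e 2)) + c 3 * (x * B (e i) (e 3))"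
      unfolding B_lin4 by (simp add: algebra_simps)
    then show ?thesis using assms[OF that] unfolding polar_O_lin by (simp add: algebra_simps)
  qed
  have 2: "x * B (lin4 c e) (e i) = y * polar_O (a i) (lin4 c a)" if "i < 4" for i c
    using 1[OF that] B_sym by metis
  have "x * B (lin4 c e) (lin4 d e) = d 0 * (x * B (lin4 c e) (e 0)) + d 1 * (x * B (lin4 c e) (e 1)) + d 2 * (x * B (lin4 c e) (e 2)) + d 3 * (x * B (lin4 c e) (e 3))"
    unfolding B_lin4[of "lin4 c e" d] by (simp add: algebra_simps)
  also have "\<dots> = y * polar_O (lin4 c a) (lin4 d a)"
    unfolding polar_O_lin[of "lin4 c a" d]
    by (simp add: 2 polar_O_commute[of "lin4 c a" "a _"] algebra_simps)
  finally show ?thesis .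
qed

lemma sat_O:
  assumes "x \<noteq> 0"
  obtains e a where "\<And>c. even_vec 8 (lin4 c e) \<Longrightarrow> even_vec 4 c"
    "\<And>i j. i < 4 \<Longrightarrow> j < 4 \<Longrightarrow> 4 ^ t * B (e i) (e j) = x * polar_O (a i) (a j)"
    "\<And>c. even_vec 4 (lin4 c a) \<longleftrightarrow> (\<forall>k<8. 2 dvd dot (S k) (lin4 c e))"
proof -
  from sat[OF z2_lattice_O[OF assms]] obtain e a where
    "\<forall>c. even_vec 8 (lin4 c e) \<longrightarrow> even_vec 4 c"
    "\<forall>i<4. \<forall>j<4. 4 ^ t * B (e i) (e j) = x * polar_O (a i) (a j)"
    "\<forall>c. even_vec 4 (lin4 c a) \<longleftrightarrow> (\<forall>k<8. 2 dvd dot (S k) (lin4 c e))"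
    unfolding form4_O by auto
  with that show thesis by blast
qed

text \<open>This says that \<open>w\<close> lies in \<open>X\<close>, as column 6 is the image of
  \<open>w\<close> under \<open>S\<close>. At scale \<open>4 ^ t\<close> the factors cancel, and the
  parities of \<open>a i 0\<close> and \<open>a i 1\<close> are the pairs required by
  \<open>witt\<close>.\<close>

lemma dot_6_even: 
  assumes "k < 8"
  shows "2 dvd S k 6"
proof -
  obtain e a where inj: "\<And>c. even_vec 8 (lin4 c e) \<Longrightarrow> even_vec 4 c"
    and gram: "\<And>i j. i < 4 \<Longrightarrow> j < 4 \<Longrightarrow> 4 ^ t * B (e i) (e j) = 4 ^ t * polar_O (a i) (a j)"
    and S_even: "\<And>c. even_vec 4 (lin4 c a) \<longleftrightarrow> (\<forall>k<8. 2 dvd dot (S k) (lin4 c e))"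
    using sat_O[of "4 ^ t"] by auto
  have g: "1 * B (e i) (e j) = 1 * polar_O (a i) (a j)" if "i < 4" "j < 4" for i j
    using gram[OF that] by simp
  have gc: "B (lin4 c e) (lin4 d e) = polar_O (lin4 c a) (lin4 d a)" for c d
    using B_comb[of 1 e 1 a c d, OF g] by simp
  obtain c where c: "\<not> even_vec 4 c" "\<forall>k<6. 2 dvd lin4 c e k" "2 dvd lin4 c e 7"
    by (rule witt[of e "\<lambda>i. norm_O (a i)" "\<lambda>i. par (a i 0)" "\<lambda>i. par (a i 1)"])
       (use g in \<open>simp_all add: polar_O_self par_norm_O par_polar_O ac_simps\<close>)
  \<comment> \<open>Otherwise the combination would be even although \<open>c\<close> is not,
    against saturation.\<close>
  have six: "\<not> 2 dvd lin4 c e 6"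
    using inj[of c] c by (auto simp: even_vec_def all_less_8 all_less_6)
  have "8 dvd b0 (lin4 c e) (lin4 c e)"
    using b0_char_norm c six by blast
  then have "8 dvd B (lin4 c e) (lin4 c e)"
    using B_mod8 by (metis dvd_add diff_add_cancel)
  then have "2 * 4 dvd 2 * norm_O (lin4 c a)" unfolding gc polar_O_self by simp
  then have "4 dvd norm_O (lin4 c a)" by (subst (asm) dvd_mult_cancel_left) simp
  then have "2 dvd dot (S k) (lin4 c e)"
    using norm_O_dvd_4 S_even assms by blast
  then show ?thesis
    using c six unfolding dot_def sum_less_8 by (simp add: all_less_6 par_eq_0_iff[symmetric])
qed

lemma t_pos: "t > 0"
  using t_0 dot_6_even by blast

text \<open>The vector representing the functional \<open>l\<close> with respect to
  \<open>b0\<close>. The inverse of the block [0 1; 1 1] is [-1 1; 1 0], which is the source of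
  \<open>l 7 - l 6\<close>.\<close>

definition riesz :: "(nat \<Rightarrow> padic2) \<Rightarrow> nat \<Rightarrow> padic2" where
  "riesz l k = (if k = 0 then l 1 else if k = 1 then l 0 else if k = 2 then l 3 else if k = 3 then l 2
     else if k = 4 then l 5 else if k = 5 then l 4 else if k = 6 then l 7 - l 6 else if k = 7 then l 6 else 0)"

lemma par_B_riesz: "par (B (riesz l) v) = par (dot l v)"
  by (simp add: par_B b0_def riesz_def dot_def sum_less_8 algebra_simps)

lemma rep_even:
  assumes "z2_lattice 4 GL"
  obtains n where "\<And>i k. i < 4 \<Longrightarrow> k < 8 \<Longrightarrow> 2 dvd dot (S k) (n i)"
    "\<And>i j. i < 4 \<Longrightarrow> j < 4 \<Longrightarrow> B (n i) (n j) = GL i j"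
proof -
  obtain n where n: "\<forall>i<4. \<forall>k<8. 2 ^ t dvd dot (S k) (n i)" "\<forall>i<4. \<forall>j<4. B (n i) (n j) = GL i j"
    using rep[OF assms] by blast
  have "(2::padic2) dvd 2 ^ t" using t_pos by (simp add: dvd_power)
  with n(1) have "2 dvd dot (S k) (n i)" if "i < 4" "k < 8" for i k
    using that dvd_trans by blast
  with n(2) that show thesis by blast
qed

text \<open>The functionals that are nonzero modulo 2 but vanish there on \<open>X\<close> and on
  \<open>w\<close>; every row of \<open>S\<close> with an odd entry is one of them by
  \<open>dot_6_even\<close>.\<close>

definition vanishing :: "(nat \<Rightarrow> padic2) \<Rightarrow> bool" where
  "vanishing l \<longleftrightarrow> 2 dvd l 6 \<and> \<not> even_vec 8 l \<and> (\<forall>v. (\<forall>k<8. 2 dvd dot (S k) v) \<longrightarrow> 2 dvd dot l v)"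

lemma dot_xi:
  assumes "2 dvd l 6" "\<forall>k<6. 2 dvd riesz l k"
  shows "2 dvd dot l v \<longleftrightarrow> 2 dvd l 7 \<or> 2 dvd v 7"
  using assms by (simp add: all_less_6 riesz_def dot_def sum_less_8 par_eq_0_iff[symmetric])

text \<open>\<open>H \<bottom> A\<close> is represented by the vectors orthogonal to \<open>riesz l\<close> modulo 2; if \<open>riesz l\<close> had norm
  divisible by 4, it would span with a singular vector of \<open>H\<close> a totally singular plane
  orthogonal to \<open>A\<close>, which \<open>witt\<close> excludes.\<close>

lemma vanishing_norm:
  assumes "vanishing l" "B (riesz l) (riesz l) = 2 * r"
  shows "par r = 1"
proof (rule ccontr)
  assume "par r \<noteq> 1"
  then have r: "par r = 0" by simp
  obtain n where nS: "\<And>i k. i < 4 \<Longrightarrow> k < 8 \<Longrightarrow> 2 dvd dot (S k) (n i)"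
    and nB: "\<And>i j. i < 4 \<Longrightarrow> j < 4 \<Longrightarrow> B (n i) (n j) = gram_blocks 0 1 2 i j"
    by (rule rep_even[OF z2_lattice_H_A]) blast
  have l_n: "2 dvd dot l (n i)" if "i < 4" for i
    using assms(1) nS[OF that] by (simp add: vanishing_def)
  have riesz_n: "par (B (riesz l) (n i)) = 0" if "i < 4" for i
    using l_n[OF that] by (simp add: par_B_riesz par_eq_0_iff)
  \<comment> \<open>The vectors \<open>n 2\<close> and \<open>n 3\<close> span \<open>A\<close> and
    receive the pairs (1, 0) and (0, 1); the two singular vectors receive (0, 0).\<close>
  define v where "v i = [n 0, riesz l, n 2, n 3] ! i" for i
  obtain c where c: "\<not> even_vec 4 c" "\<forall>k<6. 2 dvd lin4 c v k" "2 dvd lin4 c v 7"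
    and c2: "par (c 2) = 0" and c3: "par (c 3) = 0"
  proof (rule witt[of v "\<lambda>i. [0, r, 1, 1] ! i" "\<lambda>i. [0, 0, 1, 0] ! i" "\<lambda>i. [0, 0, 0, 1] ! i"])
    show "B (v i) (v i) = 2 * [0, r, 1, 1] ! i" if "i < 4" for i
      using less_4_cases[OF that] nB assms(2) unfolding v_def
      by (elim disjE; simp add: gram_blocks_def)
    show "par ([0, r, 1, 1] ! i) = [0, 0, 1, 0] ! i * [0, 0, 1, 0] ! i + [0, 0, 1, 0] ! i * [0, 0, 0, 1] ! i
      + [0, 0, 0, 1] ! i * [0, 0, 0, 1] ! i" if "i < 4" for i
      using less_4_cases[OF that] r by (elim disjE; simp)
    show "par (B (v i) (v j)) = [0, 0, 1, 0] ! i * [0, 0, 0, 1] ! j + [0, 0, 0, 1] ! i * [0, 0, 1, 0] ! j"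
      if "i < j" "j < 4" for i j
      using less_pair_4_cases[OF that] nB riesz_n unfolding v_def
      by (elim disjE; simp add: gram_blocks_def B_sym[of _ "riesz l"])
  qed auto
  \<comment> \<open>The hyperbolic partner \<open>n 1\<close> of \<open>n 0\<close> reads off the
    coefficient \<open>c 0\<close>.\<close>
  have "par (B (n 1) (lin4 c v)) = par (c 0)"
    using nB riesz_n[of 1] c2 c3 by (simp add: B_lin4 v_def gram_blocks_def B_sym[of _ "riesz l"])
  moreover have "2 dvd n 1 7"
    using nB[of 1 1] B_self_even_iff[of "n 1"] by (simp add: gram_blocks_def)
  then have "par (B (n 1) (lin4 c v)) = 0"
    using par_B_proj[of "n 1" "lin4 c v"] c by (simp add: all_less_6 par_eq_0_iff[symmetric])
  ultimately have c0: "par (c 0) = 0" by simp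
  then have c1: "par (c 1) = 1"
    using c(1) c2 c3 by (auto simp: even_vec_def all_less_4 par_eq_0_iff[symmetric])
  have riesz_even: "\<forall>k<6. 2 dvd riesz l k"
    using c(2) c0 c1 c2 c3 by (simp add: lin4_def v_def par_eq_0_iff[symmetric])
  have l: "2 dvd l 6" using assms(1) by (simp add: vanishing_def)
  have l7: "\<not> 2 dvd l 7"
    using assms(1) riesz_even by (auto simp: vanishing_def even_vec_def all_less_8 all_less_6 riesz_def)
  \<comment> \<open>Now \<open>riesz l\<close> is the characteristic vector modulo 2, so vectors
    killed by \<open>l\<close> have even norm. But \<open>l\<close> kills all of \<open>M\<close>,
    which represents 1.\<close>
  obtain m :: "nat \<Rightarrow> nat \<Rightarrow> padic2" where mS: "\<And>i k. i < 4 \<Longrightarrow> k < 8 \<Longrightarrow> 2 dvd dot (S k) (m i)"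
    and mB: "\<And>i j. i < 4 \<Longrightarrow> j < 4 \<Longrightarrow> B (m i) (m j) = (if i = j then 1 else 0)"
    by (rule rep_even[OF z2_lattice_scaled_one[OF one_neq_zero]]) blast
  have "2 dvd dot l (m 0)"
    using assms(1) mS by (simp add: vanishing_def)
  then have "2 dvd m 0 7" using dot_xi[OF l riesz_even] l7 by simp
  then show False using mB[of 0 0] B_self_even_iff[of "m 0"] by simp
qed

text \<open>Since \<open>H \<bottom> H\<close> is represented as well, the reduction of \<open>S\<close> modulo 2 has rank one.\<close>

lemma vanishing_unique:
  assumes l: "vanishing l" and l': "vanishing l'"
  shows "even_vec 8 (\<lambda>k. l k + l' k)"
proof (rule ccontr)
  assume "\<not> ?thesis"
  moreover have dot_sum: "dot (\<lambda>k. l k + l' k) v = dot l v + dot l' v" for v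
    by (simp add: dot_def sum.distrib algebra_simps)
  ultimately have l'': "vanishing (\<lambda>k. l k + l' k)"
    using l l' by (simp add: vanishing_def)
  have riesz_sum: "B u (riesz (\<lambda>k. l k + l' k)) = B u (riesz l) + B u (riesz l')" for u
    unfolding B_add[symmetric] by (rule arg_cong[where f = "B u"]) (auto simp: riesz_def fun_eq_iff)
  have half: "\<exists>r. B (riesz m) (riesz m) = 2 * r" if "vanishing m" for m
    using B_self_even_iff[of "riesz m"] that by (auto simp: vanishing_def riesz_def elim: dvdE)
  obtain r r' r'' where r: "B (riesz l) (riesz l) = 2 * r" and r': "B (riesz l') (riesz l') = 2 * r'"
    and r'': "B (riesz (\<lambda>k. l k + l' k)) (riesz (\<lambda>k. l k + l' k)) = 2 * r''"
    using half l l' l'' by metis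
  \<comment> \<open>The half-norms of \<open>riesz l\<close>, \<open>riesz l'\<close> and their sum
    are all odd, so the product of the first two is odd as well: they span an anisotropic plane
    modulo 2, to be paired with the singular vectors \<open>n 0\<close> and \<open>n 2\<close> of
    \<open>H \<bottom> H\<close>.\<close>
  have "2 * r'' = 2 * (r + r' + B (riesz l) (riesz l'))"
    using r r' unfolding r''[symmetric] riesz_sum B_sym[of "riesz (\<lambda>k. l k + l' k)"]
    by (simp add: B_sym[of "riesz l'" "riesz l"] algebra_simps)
  then have "r'' = r + r' + B (riesz l) (riesz l')"
    by (subst (asm) mult_cancel_left) simp
  then have B1: "par (B (riesz l) (riesz l')) = 1"
    using vanishing_norm[OF l r] vanishing_norm[OF l' r'] vanishing_norm[OF l'' r''] by simp
  obtain n where nS: "\<And>i k. i < 4 \<Longrightarrow> k < 8 \<Longrightarrow> 2 dvd dot (S k) (n i)"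
    and nB: "\<And>i j. i < 4 \<Longrightarrow> j < 4 \<Longrightarrow> B (n i) (n j) = gram_blocks 0 1 0 i j"
    by (rule rep_even[OF z2_lattice_H_H]) blast
  have riesz_n: "par (B (riesz l) (n i)) = 0" "par (B (riesz l') (n i)) = 0" if "i < 4" for i
    using l l' nS[OF that] by (simp_all add: par_B_riesz par_eq_0_iff vanishing_def)
  then have n_xi: "par (B (n i) (riesz l)) = 0" "par (B (n i) (riesz l')) = 0" if "i < 4" for i
    using that by (simp_all add: B_sym[of "n i"])
  define v where "v i = [n 0, n 2, riesz l, riesz l'] ! i" for i
  obtain c where c: "\<not> even_vec 4 c" "\<forall>k<6. 2 dvd lin4 c v k" "2 dvd lin4 c v 7"
    and c2: "par (c 2) = 0" and c3: "par (c 3) = 0"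
  proof (rule witt[of v "\<lambda>i. [0, 0, r, r'] ! i" "\<lambda>i. [0, 0, 1, 0] ! i" "\<lambda>i. [0, 0, 0, 1] ! i"])
    show "B (v i) (v i) = 2 * [0, 0, r, r'] ! i" if "i < 4" for i
      using less_4_cases[OF that] nB r r' unfolding v_def
      by (elim disjE; simp add: gram_blocks_def)
    show "par ([0, 0, r, r'] ! i) = [0, 0, 1, 0] ! i * [0, 0, 1, 0] ! i + [0, 0, 1, 0] ! i * [0, 0, 0, 1] ! i
      + [0, 0, 0, 1] ! i * [0, 0, 0, 1] ! i" if "i < 4" for i
      using less_4_cases[OF that] vanishing_norm[OF l r] vanishing_norm[OF l' r'] by (elim disjE; simp)
    show "par (B (v i) (v j)) = [0, 0, 1, 0] ! i * [0, 0, 0, 1] ! j + [0, 0, 0, 1] ! i * [0, 0, 1, 0] ! j"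
      if "i < j" "j < 4" for i j
      using less_pair_4_cases[OF that] nB n_xi B1 unfolding v_def
      by (elim disjE; simp add: gram_blocks_def)
  qed auto
  have ev: "par (B (n i) (lin4 c v)) = 0" if "i < 4" for i
  proof -
    have "2 dvd n i 7"
      using nB[OF that that] B_self_even_iff[of "n i"] by (simp add: gram_blocks_def split: if_splits)
    then show ?thesis
      using par_B_proj[of "n i" "lin4 c v"] c by (simp add: all_less_6 par_eq_0_iff[symmetric])
  qed
  \<comment> \<open>The hyperbolic partners \<open>n 1\<close> and \<open>n 3\<close> read off the
    two remaining coefficients.\<close>
  have "par (c 0) = 0" "par (c 1) = 0"
    using ev[of 1] ev[of 3] nB n_xi[of 1] n_xi[of 3] c2 c3
    by (simp_all add: B_lin4 v_def gram_blocks_def)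
  then show False
    using c(1) c2 c3 by (simp add: even_vec_def all_less_4 par_eq_0_iff[symmetric])
qed

end

context universal_char_lattice
begin

lemma riesz_half_norm:
  assumes "vanishing l"
  obtains r where "B (riesz l) (riesz l) = 2 * r" "par r = 1"
proof -
  have "2 dvd B (riesz l) (riesz l)"
    unfolding B_self_even_iff using assms by (simp add: vanishing_def riesz_def)
  then obtain r where "B (riesz l) (riesz l) = 2 * r" by blast
  with vanishing_norm[OF assms this] that show thesis by blast
qed

text \<open>Orthogonality to the nonsingular vector \<open>riesz l\<close> lowers the Witt index
  from three to two. In terms of \<open>witt\<close>, \<open>riesz l\<close> is the fourth vector
  with the pair (1, 0), and the condition on the pairs makes its coefficient even.\<close>

lemma witt3:
  fixes u :: "nat \<Rightarrow> nat \<Rightarrow> padic2"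
  assumes l: "vanishing l"
    and norm: "\<And>i. i < 3 \<Longrightarrow> B (u i) (u i) = 2 * r i" "\<And>i. i < 3 \<Longrightarrow> par (r i) = 0"
    and orth: "\<And>i j. i < j \<Longrightarrow> j < 3 \<Longrightarrow> par (B (u i) (u j)) = 0"
    and dot_u: "\<And>i. i < 3 \<Longrightarrow> par (dot l (u i)) = 0"
  obtains c where "\<not> even_vec 3 c" "\<forall>k<6. 2 dvd c 0 * u 0 k + c 1 * u 1 k + c 2 * u 2 k"
    "2 dvd c 0 * u 0 7 + c 1 * u 1 7 + c 2 * u 2 7"
proof -
  obtain s where s: "B (riesz l) (riesz l) = 2 * s" "par s = 1"
    using riesz_half_norm[OF l] .
  have u_xi: "par (B (u i) (riesz l)) = 0" if "i < 3" for i
    using dot_u[OF that] by (simp add: B_sym[of _ "riesz l"] par_B_riesz)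
  define v where "v i = [u 0, u 1, u 2, riesz l] ! i" for i
  obtain c where c: "\<not> even_vec 4 c" "\<forall>k<6. 2 dvd lin4 c v k" "2 dvd lin4 c v 7" and c3: "par (c 3) = 0"
  proof (rule witt[of v "\<lambda>i. [r 0, r 1, r 2, s] ! i" "\<lambda>i. [0, 0, 0, 1] ! i" "\<lambda>i. 0"])
    show "B (v i) (v i) = 2 * [r 0, r 1, r 2, s] ! i" if "i < 4" for i
      using less_4_cases[OF that] norm s unfolding v_def by (elim disjE; simp)
    show "par ([r 0, r 1, r 2, s] ! i) = [0, 0, 0, 1] ! i * [0, 0, 0, 1] ! i + [0, 0, 0, 1] ! i * 0 + 0 * 0" if "i < 4" for i
      using less_4_cases[OF that] norm s by (elim disjE; simp)
    show "par (B (v i) (v j)) = [0, 0, 0, 1] ! i * 0 + 0 * [0, 0, 0, 1] ! j"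
      if "i < j" "j < 4" for i j
      using less_pair_4_cases[OF that] orth u_xi unfolding v_def by (elim disjE; simp)
  qed auto
  show thesis
  proof (rule that[of c])
    show "\<not> even_vec 3 c"
      using c(1) c3 by (auto simp: even_vec_def all_less_4 all_less_3 par_eq_0_iff[symmetric])
    show "\<forall>k<6. 2 dvd c 0 * u 0 k + c 1 * u 1 k + c 2 * u 2 k"
      "2 dvd c 0 * u 0 7 + c 1 * u 1 7 + c 2 * u 2 7"
      using c(2,3) c3 by (simp_all add: lin4_def v_def par_eq_0_iff[symmetric])
  qed
qed

lemma lin4_add: "lin4 (\<lambda>i. c i + d i) e k = lin4 c e k + lin4 d e k"
  by (simp add: lin4_def algebra_simps)

text \<open>Both combinations are the characteristic vector modulo 2, so their sum is even and
  saturation applies to it.\<close>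

lemma coset_of_char:
  assumes inj: "\<And>c. even_vec 8 (lin4 c e) \<Longrightarrow> even_vec 4 c"
    and c: "\<forall>k<6. 2 dvd lin4 c e k" "2 dvd lin4 c e 7"
    and d: "\<forall>k<6. 2 dvd lin4 d e k" "2 dvd lin4 d e 7"
    and c_odd: "\<not> even_vec 4 c" and d_odd: "\<not> even_vec 4 d"
  shows "even_vec 4 (\<lambda>i. c i + d i)"
proof (rule inj)
  have "\<not> 2 dvd lin4 c e 6" "\<not> 2 dvd lin4 d e 6"
    using inj[of c] inj[of d] c d c_odd d_odd by (auto simp: even_vec_def all_less_8 all_less_6)
  then show "even_vec 8 (lin4 (\<lambda>i. c i + d i) e)"
    using c d by (simp add: even_vec_def all_less_8 all_less_6 lin4_add even_add_iff)
qed

text \<open>All four \<open>e i\<close> are singular modulo 2, mutually orthogonal and killed by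
  \<open>l\<close>. Two uses of \<open>witt3\<close>, the second avoiding an index r at which the
  first has an odd coefficient, write the same vector \<open>w\<close> modulo 2 in two different
  ways.\<close>

lemma no_even_frame:
  assumes l: "vanishing l"
    and inj: "\<And>c. even_vec 8 (lin4 c e) \<Longrightarrow> even_vec 4 c"
    and gram: "\<And>i j. i < 4 \<Longrightarrow> j < 4 \<Longrightarrow> B (e i) (e j) = 2 * polar_O (b i) (b j)"
    and dot_e: "\<And>i. i < 4 \<Longrightarrow> par (dot l (e i)) = 0"
  shows False
proof -
  have norm: "B (e i) (e i) = 2 * (2 * norm_O (b i))" if "i < 4" for i
    using gram[OF that that] by (simp add: polar_O_self)
  have orth: "par (B (e i) (e j)) = 0" if "i < 4" "j < 4" for i j
    using gram[OF that] by simp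
  obtain c where c: "\<not> even_vec 3 c" "\<forall>k<6. 2 dvd c 0 * e 0 k + c 1 * e 1 k + c 2 * e 2 k"
    "2 dvd c 0 * e 0 7 + c 1 * e 1 7 + c 2 * e 2 7"
    by (rule witt3[OF l, of e "\<lambda>i. 2 * norm_O (b i)"]) (use norm orth dot_e in auto)
  obtain r where r: "r < 3" "\<not> 2 dvd c r" using c(1) by (auto simp: even_vec_def)
  define u where "u = e(r := e 3)"
  obtain d where d: "\<not> even_vec 3 d" "\<forall>k<6. 2 dvd d 0 * u 0 k + d 1 * u 1 k + d 2 * u 2 k"
    "2 dvd d 0 * u 0 7 + d 1 * u 1 7 + d 2 * u 2 7"
    by (rule witt3[OF l, of u "\<lambda>i. if i = r then 2 * norm_O (b 3) else 2 * norm_O (b i)"])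
       (use norm orth dot_e in \<open>auto simp: u_def\<close>)
  define c' where "c' = c(3 := 0)"
  define d' where "d' = d(r := 0, 3 := d r)"
  have r_cases: "r = 0 \<or> r = 1 \<or> r = 2" using r(1) by linarith
  have "lin4 c' e k = c 0 * e 0 k + c 1 * e 1 k + c 2 * e 2 k" for k
    by (simp add: c'_def lin4_def)
  moreover have "lin4 d' e k = d 0 * u 0 k + d 1 * u 1 k + d 2 * u 2 k" for k
    using r_cases by (auto simp: d'_def u_def lin4_def)
  moreover have "\<not> even_vec 4 c'"
    using c(1) by (simp add: even_vec_def all_less_4 all_less_3 c'_def)
  moreover have "\<not> even_vec 4 d'"
    using d(1) r_cases by (auto simp: even_vec_def all_less_4 all_less_3 d'_def)
  ultimately have "even_vec 4 (\<lambda>i. c' i + d' i)"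
    using coset_of_char[of e c' d', OF inj] c d by simp
  then have "2 dvd c' r + d' r" using r by (simp add: even_vec_def)
  then show False using r by (simp add: c'_def d'_def)
qed

text \<open>Here \<open>l\<close> kills only a hyperplane of the frame, and only there are the
  coordinates \<open>a\<close> even. Three vectors of the hyperplane give a first combination
  congruent to \<open>w\<close>. Its norm and its product with \<open>e 3\<close> force
  \<open>e 3\<close> and \<open>riesz l\<close> to span an anisotropic plane modulo 2, and
  \<open>witt\<close> with this plane gives a second combination avoiding an index of the
  first.\<close>

lemma no_odd_frame:
  assumes l: "vanishing l"
    and inj: "\<And>c. even_vec 8 (lin4 c e) \<Longrightarrow> even_vec 4 c"
    and gram: "\<And>i j. i < 4 \<Longrightarrow> j < 4 \<Longrightarrow> 2 * B (e i) (e j) = 1 * polar_O (a i) (a j)"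
    and dot_iff: "\<And>c. even_vec 4 (lin4 c a) \<longleftrightarrow> 2 dvd dot l (lin4 c e)"
    and odd: "\<not> 2 dvd dot l (e 3)"
  shows False
proof -
  have G: "2 * B (lin4 c e) (lin4 d e) = polar_O (lin4 c a) (lin4 d a)" for c d
    using B_comb[of 2 e 1 a c d, OF gram] by simp
  \<comment> \<open>For j < 3 the vector \<open>u j\<close> is \<open>dot l (e 3)\<close> times
    \<open>e j\<close> minus \<open>dot l (e j)\<close> times \<open>e 3\<close>, hence killed by
    \<open>l\<close>; the leading coefficient is odd, so no independence modulo 2 is lost.\<close>
  define U where "U j = (\<lambda>i. if i = j then dot l (e 3) else if i = 3 then - dot l (e j) else 0)" for j :: nat
  define u where "u j = lin4 (U j) e" for j
  have u_lam: "dot l (u j) = 0" if "j < 3" for j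
  proof -
    have "j = 0 \<or> j = 1 \<or> j = 2" using that by linarith
    then show ?thesis by (auto simp: u_def U_def dot_lin4)
  qed
  then have "even_vec 4 (lin4 (U j) a)" if "j < 3" for j
    using dot_iff[of "U j"] that by (simp add: u_def)
  then have "\<exists>b. \<forall>k<4. lin4 (U j) a k = 2 * b k" if "j < 3" for j
    using that unfolding even_vec_def dvd_def by metis
  then obtain b where b: "\<And>j k. j < 3 \<Longrightarrow> k < 4 \<Longrightarrow> lin4 (U j) a k = 2 * b j k" by metis
  have polar_O_b: "polar_O (lin4 (U j) a) x = 2 * polar_O (b j) x" if "j < 3" for j x
    using b[OF that] by (simp add: polar_O_def algebra_simps)
  have polar_O_bb: "B (u i) (u j) = 2 * polar_O (b i) (b j)" if "i < 3" "j < 3" for i j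
  proof -
    have "2 * B (u i) (u j) = 2 * (2 * polar_O (b i) (b j))"
      using G[of "U i" "U j"] polar_O_b that unfolding u_def by (simp add: polar_O_commute[of "b i" "lin4 _ _"] polar_O_commute[of "b j" "b i"])
    then show ?thesis by (subst (asm) mult_cancel_left) simp
  qed
  have norm: "B (u i) (u i) = 2 * (2 * norm_O (b i))" if "i < 3" for i
    using polar_O_bb[OF that that] by (simp add: polar_O_self)
  have orth: "par (B (u i) (u j)) = 0" if "i < 3" "j < 3" for i j
    using polar_O_bb[OF that] by simp
  obtain c where c: "\<not> even_vec 3 c" "\<forall>k<6. 2 dvd c 0 * u 0 k + c 1 * u 1 k + c 2 * u 2 k"
    "2 dvd c 0 * u 0 7 + c 1 * u 1 7 + c 2 * u 2 7"
    by (rule witt3[OF l, of u "\<lambda>i. 2 * norm_O (b i)"]) (use norm orth u_lam in auto)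
  define C where "C i = c 0 * U 0 i + c 1 * U 1 i + c 2 * U 2 i" for i
  define \<beta> where "\<beta> k = c 0 * b 0 k + c 1 * b 1 k + c 2 * b 2 k" for k
  have C_e: "lin4 C e k = c 0 * u 0 k + c 1 * u 1 k + c 2 * u 2 k" for k
    by (simp add: lin4_def C_def u_def algebra_simps)
  have C_a: "lin4 C a k = 2 * \<beta> k" if "k < 4" for k
  proof -
    have "lin4 C a k = c 0 * lin4 (U 0) a k + c 1 * lin4 (U 1) a k + c 2 * lin4 (U 2) a k"
      by (simp add: lin4_def C_def algebra_simps)
    then show ?thesis using b that by (simp add: \<beta>_def algebra_simps)
  qed
  have C_val: "C i = c i * dot l (e 3)" if "i < 3" for i
  proof -
    have "i = 0 \<or> i = 1 \<or> i = 2" using that by linarith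
    then show ?thesis by (auto simp: C_def U_def)
  qed
  have C_odd: "\<not> even_vec 4 C"
    using c(1) odd C_val by (auto simp: even_vec_def all_less_4 all_less_3 even_mult_iff')
  have C_even: "\<forall>k<6. 2 dvd lin4 C e k" "2 dvd lin4 C e 7"
    using c C_e by simp_all
  have six: "\<not> 2 dvd lin4 C e 6"
    using inj[of C] C_odd C_even by (auto simp: even_vec_def all_less_8 all_less_6)
  have polar_O_C: "polar_O (lin4 C a) x = 2 * polar_O \<beta> x" for x
    using C_a by (simp add: polar_O_def algebra_simps)
  have "8 dvd b0 (lin4 C e) (lin4 C e)"
    using b0_char_norm C_even six by blast
  then have "8 dvd B (lin4 C e) (lin4 C e)"
    using B_mod8 by (metis dvd_add diff_add_cancel)
  moreover have "2 * B (lin4 C e) (lin4 C e) = 2 * (4 * norm_O \<beta>)"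
  proof -
    have "polar_O (lin4 C a) (lin4 C a) = 2 * (2 * polar_O \<beta> \<beta>)"
      by (subst polar_O_C, subst polar_O_commute, subst polar_O_C) (rule refl)
    then show ?thesis by (simp add: G polar_O_self[of \<beta>])
  qed
  then have "B (lin4 C e) (lin4 C e) = 4 * norm_O \<beta>" by (subst (asm) mult_cancel_left) simp
  ultimately have "4 * 2 dvd 4 * norm_O \<beta>" by simp
  then have "2 dvd norm_O \<beta>" by (subst (asm) dvd_mult_cancel_left) simp
  then have \<beta>: "par (\<beta> 0) = 0" "par (\<beta> 1) = 0"
    using norm_O_even by (simp_all add: par_eq_0_iff)
  define \<delta> :: "nat \<Rightarrow> nat \<Rightarrow> padic2" where "\<delta> j i = (if i = j then 1 else 0)" for i j
  have \<delta>: "lin4 (\<delta> 3) f = f 3" for f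
    by (simp add: lin4_def \<delta>_def fun_eq_iff)
  have B3: "2 * B (lin4 D e) (e 3) = polar_O (lin4 D a) (a 3)" for D
    using G[of D "\<delta> 3"] unfolding \<delta> .
  have "2 * B (lin4 C e) (e 3) = 2 * polar_O \<beta> (a 3)"
    unfolding B3 polar_O_C ..
  then have "B (lin4 C e) (e 3) = polar_O \<beta> (a 3)" by (subst (asm) mult_cancel_left) simp
  \<comment> \<open>Modulo 2, \<open>lin4 C e\<close> is the characteristic vector, so this product
    is the parity of \<open>e 3 7\<close>, which is also that of the norm of
    \<open>e 3\<close>.\<close>
  then have "par (b0 (lin4 C e) (e 3)) = 0"
    using \<beta> by (simp add: par_B[symmetric] par_polar_O)
  then have "par (e 3 7) = 0"
    using C_even six by (simp add: b0_def all_less_6 par_eq_0_iff[symmetric])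
  then have "2 dvd B (e 3) (e 3)" by (simp add: B_self_even_iff par_eq_0_iff)
  moreover have "2 * B (e 3) (e 3) = 2 * norm_O (a 3)"
    using B3[of "\<delta> 3"] unfolding \<delta> polar_O_self .
  then have NO3: "B (e 3) (e 3) = norm_O (a 3)" by (subst (asm) mult_cancel_left) simp
  ultimately have a3: "par (a 3 0) = 0" "par (a 3 1) = 0" and "2 dvd norm_O (a 3)"
    using norm_O_even by (simp_all add: par_eq_0_iff)
  then obtain \<rho> where \<rho>: "norm_O (a 3) = 2 * \<rho>" by blast
  have "par \<rho> = 1"
  proof (rule ccontr)
    assume "par \<rho> \<noteq> 1"
    then obtain y where "\<rho> = 2 * y" by (auto simp: par_eq_0_iff)
    then have "4 dvd norm_O (a 3)" using \<rho> by simp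
    then have "even_vec 4 (a 3)" by (rule norm_O_dvd_4)
    then show False using dot_iff[of "\<delta> 3"] odd unfolding \<delta> by simp
  qed
  \<comment> \<open>The second combination will use only \<open>u p\<close> and \<open>u q\<close>,
    so that its coefficient at \<open>e r\<close> is 0 while that of the first is odd.\<close>
  obtain r where r: "r < 3" "\<not> 2 dvd c r" using c(1) by (auto simp: even_vec_def)
  then have "r = 0 \<or> r = 1 \<or> r = 2" by linarith
  then obtain p q where pq: "p < 3" "q < 3" "p \<noteq> r" "q \<noteq> r" "p \<noteq> q"
    by (elim disjE) (rule that[of 1 2] that[of 0 2] that[of 0 1]; simp)+
  obtain s where s: "B (riesz l) (riesz l) = 2 * s" "par s = 1"
    using riesz_half_norm[OF l] .
  have u3: "par (B (u i) (e 3)) = 0" if "i < 3" for i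
  proof -
    have "2 * B (u i) (e 3) = 2 * polar_O (b i) (a 3)"
      unfolding u_def B3 polar_O_b[OF that] ..
    then have "B (u i) (e 3) = polar_O (b i) (a 3)" by (subst (asm) mult_cancel_left) simp
    then show ?thesis using a3 by (simp add: par_polar_O)
  qed
  have u_xi: "par (B (u i) (riesz l)) = 0" if "i < 3" for i
    using u_lam[OF that] by (simp add: B_sym[of _ "riesz l"] par_B_riesz)
  have e_xi: "par (B (e 3) (riesz l)) = 1"
    using odd by (simp add: B_sym[of _ "riesz l"] par_B_riesz par_eq_0_iff[symmetric])
  define v where "v i = [u p, u q, e 3, riesz l] ! i" for i
  obtain d where d: "\<not> even_vec 4 d" "\<forall>k<6. 2 dvd lin4 d v k" "2 dvd lin4 d v 7"
    and d2: "par (d 2) = 0" and d3: "par (d 3) = 0"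
  proof (rule witt[of v "\<lambda>i. [2 * norm_O (b p), 2 * norm_O (b q), \<rho>, s] ! i" "\<lambda>i. [0, 0, 1, 0] ! i" "\<lambda>i. [0, 0, 0, 1] ! i"])
    show "B (v i) (v i) = 2 * [2 * norm_O (b p), 2 * norm_O (b q), \<rho>, s] ! i" if "i < 4" for i
      using less_4_cases[OF that] pq norm s \<rho> NO3 unfolding v_def by (elim disjE; simp)
    show "par ([2 * norm_O (b p), 2 * norm_O (b q), \<rho>, s] ! i) = [0, 0, 1, 0] ! i * [0, 0, 1, 0] ! i + [0, 0, 1, 0] ! i * [0, 0, 0, 1] ! i
      + [0, 0, 0, 1] ! i * [0, 0, 0, 1] ! i" if "i < 4" for i
      using less_4_cases[OF that] \<open>par \<rho> = 1\<close> s by (elim disjE; simp)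
    show "par (B (v i) (v j)) = [0, 0, 1, 0] ! i * [0, 0, 0, 1] ! j + [0, 0, 0, 1] ! i * [0, 0, 1, 0] ! j"
      if "i < j" "j < 4" for i j
      using less_pair_4_cases[OF that] pq orth u3 u_xi e_xi unfolding v_def by (elim disjE; simp)
  qed auto
  define D where "D i = d 0 * U p i + d 1 * U q i" for i
  have D_e: "lin4 D e k = d 0 * u p k + d 1 * u q k" for k
    by (simp add: lin4_def D_def u_def algebra_simps)
  have D_even: "\<forall>k<6. 2 dvd lin4 D e k" "2 dvd lin4 D e 7"
    using d d2 d3 unfolding D_e by (simp_all add: lin4_def v_def par_eq_0_iff[symmetric])
  have "D p = d 0 * dot l (e 3)" "D q = d 1 * dot l (e 3)" "D r = 0"
    using pq r by (auto simp: D_def U_def)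
  moreover have "\<not> (2 dvd d 0 \<and> 2 dvd d 1)"
    using d(1) d2 d3 by (auto simp: even_vec_def all_less_4 par_eq_0_iff[symmetric])
  ultimately have "\<not> (2 dvd D p \<and> 2 dvd D q)" using odd by (simp add: even_mult_iff')
  moreover have "p < 4" "q < 4" using pq by simp_all
  ultimately have D_odd: "\<not> even_vec 4 D" unfolding even_vec_def by blast
  have "even_vec 4 (\<lambda>i. C i + D i)"
    by (rule coset_of_char[OF inj C_even D_even C_odd D_odd])
  then have "2 dvd C r + D r" using r by (simp add: even_vec_def)
  then show False using \<open>D r = 0\<close> C_val r odd by (simp add: even_mult_iff')
qed

lemma contradiction: False
proof -
  obtain k0 where k0: "k0 < 8" "\<not> even_vec 8 (S k0)"
    using S_odd by (auto simp: even_vec_def)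
  define l where "l = S k0"
  have l: "vanishing l"
    using k0 dot_6_even by (simp add: vanishing_def l_def)
  \<comment> \<open>By \<open>vanishing_unique\<close> every row of \<open>S\<close> is 0 or
    \<open>l\<close> modulo 2, so \<open>l\<close> alone decides membership in
    \<open>X\<close>.\<close>
  have S_l: "2 dvd dot (S k) v" if "2 dvd dot l v" "k < 8" for k v
  proof (cases "even_vec 8 (S k)")
    case True
    then show ?thesis by (rule dot_even)
  next
    case False
    then have "vanishing (S k)" using that dot_6_even by (simp add: vanishing_def)
    from dot_even[OF vanishing_unique[OF l this]]
    have "2 dvd dot l v + dot (S k) v" by (simp add: dot_def sum.distrib distrib_right)
    then show ?thesis using that(1) by (simp add: even_add_iff)
  qed
  obtain t' where t': "t = Suc t'" using t_pos by (cases t) auto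
  \<comment> \<open>One factor 2 less than \<open>4 ^ t\<close> makes \<open>2 * B\<close> equal to
    \<open>polar_O\<close> on the saturation; the exponent is genuine because t > 0.\<close>
  have four: "(4::padic2) ^ t = 2 ^ (2 * t - 1) * 2"
    by (simp add: t' power_mult flip: power_Suc2)
  obtain e a where inj: "\<And>c. even_vec 8 (lin4 c e) \<Longrightarrow> even_vec 4 c"
    and gram: "\<And>i j. i < 4 \<Longrightarrow> j < 4 \<Longrightarrow> 4 ^ t * B (e i) (e j) = 2 ^ (2 * t - 1) * polar_O (a i) (a j)"
    and S_even: "\<And>c. even_vec 4 (lin4 c a) \<longleftrightarrow> (\<forall>k<8. 2 dvd dot (S k) (lin4 c e))"
    using sat_O[of "2 ^ (2 * t - 1)"] by auto
  have g: "2 * B (e i) (e j) = 1 * polar_O (a i) (a j)" if "i < 4" "j < 4" for i j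
    using gram[OF that] unfolding four mult.assoc by simp
  have dot_iff: "even_vec 4 (lin4 c a) \<longleftrightarrow> 2 dvd dot l (lin4 c e)" for c
    using S_even S_l k0 l_def by blast
  show False
  proof (cases "\<forall>i<4. 2 dvd dot l (e i)")
    case True
    define \<delta> :: "nat \<Rightarrow> nat \<Rightarrow> padic2" where "\<delta> j i = (if i = j then 1 else 0)" for i j
    have \<delta>: "lin4 (\<delta> i) f = f i" if "i < 4" for f i
    proof -
      have "i = 0 \<or> i = 1 \<or> i = 2 \<or> i = 3" using that by linarith
      then show ?thesis by (auto simp: lin4_def \<delta>_def fun_eq_iff)
    qed
    have "even_vec 4 (a i)" if "i < 4" for i
      using dot_iff[of "\<delta> i"] True that unfolding \<delta>[OF that] by simp
    then have "\<exists>b. \<forall>k<4. a i k = 2 * b k" if "i < 4" for i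
      using that unfolding even_vec_def dvd_def by metis
    then obtain b where b: "\<And>i k. i < 4 \<Longrightarrow> k < 4 \<Longrightarrow> a i k = 2 * b i k" by metis
    have gram_b: "B (e i) (e j) = 2 * polar_O (b i) (b j)" if "i < 4" "j < 4" for i j
    proof -
      have "2 * B (e i) (e j) = 2 * (2 * polar_O (b i) (b j))"
        using g[OF that] b that by (simp add: polar_O_def algebra_simps)
      then show ?thesis by (subst (asm) mult_cancel_left) simp
    qed
    show False
      using no_even_frame[of l e b, OF l inj gram_b] True by (simp add: par_eq_0_iff)
  next
    case False
    then obtain p where p: "p < 4" "\<not> 2 dvd dot l (e p)" by blast
    then have p_cases: "p = 0 \<or> p = 1 \<or> p = 2 \<or> p = 3" by linarith
    \<comment> \<open>The exchange of p and 3 puts a vector not killed by \<open>l\<close> in the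
      last place.\<close>
    define \<tau> where "\<tau> i = (if i = 3 then p else if i = p then 3 else i)" for i
    have \<tau>: "\<tau> i < 4" if "i < 4" for i using that p by (simp add: \<tau>_def)
    have lin_\<tau>: "lin4 c (\<lambda>i. f (\<tau> i)) = lin4 (\<lambda>i. c (\<tau> i)) f" for c f
      using p_cases by (auto simp: lin4_def \<tau>_def fun_eq_iff)
    have ev_\<tau>: "even_vec 4 c" if "even_vec 4 (\<lambda>i. c (\<tau> i))" for c
      using that p_cases by (auto simp: even_vec_def all_less_4 \<tau>_def)
    show False
    proof (rule no_odd_frame[OF l, of "\<lambda>i. e (\<tau> i)" "\<lambda>i. a (\<tau> i)"])
      show "even_vec 4 c" if "even_vec 8 (lin4 c (\<lambda>i. e (\<tau> i)))" for c
        using that inj ev_\<tau> unfolding lin_\<tau> by blast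
      show "2 * B (e (\<tau> i)) (e (\<tau> j)) = 1 * polar_O (a (\<tau> i)) (a (\<tau> j))" if "i < 4" "j < 4" for i j
        using g \<tau> that by blast
      show "even_vec 4 (lin4 c (\<lambda>i. a (\<tau> i))) \<longleftrightarrow> 2 dvd dot l (lin4 c (\<lambda>i. e (\<tau> i)))" for c
        unfolding lin_\<tau> by (rule dot_iff)
      show "\<not> 2 dvd dot l (e (\<tau> 3))" using p by (simp add: \<tau>_def)
    qed
  qed
qed

end

section \<open>Maximal integral overlattices\<close>

text \<open>The conditions on \<open>y\<close> say that y/2 pairs integrally with the lattice and
  has integral norm, so adjoining it keeps the lattice integral. Maximality leaves no such y/2
  outside the lattice.\<close>

definition maximal_form :: "nat \<Rightarrow> padic2 mat \<Rightarrow> bool" where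
  "maximal_form n G \<longleftrightarrow> (\<forall>y\<in>carrier_vec n. (\<forall>r<n. 2 dvd (G *\<^sub>v y) $ r) \<longrightarrow> 4 dvd y \<bullet> (G *\<^sub>v y)
     \<longrightarrow> (\<forall>r<n. 2 dvd y $ r))"

lemma odd_det_inverse:
  assumes A: "A \<in> carrier_mat n n" and odd: "\<not> 2 dvd (det A :: padic2)"
  obtains A' where "A' \<in> carrier_mat n n" "A * A' = 1\<^sub>m n" "A' * A = 1\<^sub>m n"
proof -
  obtain y where y: "det A * y = 1" using odd_inverse[OF odd] .
  note adj = adj_mat[OF A]
  show thesis
  proof (rule that[of "y \<cdot>\<^sub>m adj_mat A"])
    show "y \<cdot>\<^sub>m adj_mat A \<in> carrier_mat n n" using adj by simp
    have "A * (y \<cdot>\<^sub>m adj_mat A) = y \<cdot>\<^sub>m (A * adj_mat A)"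
      using A adj(1) by (rule mult_smult_distrib)
    also have "\<dots> = 1\<^sub>m n" unfolding adj(2) using y by (intro eq_matI) (auto simp: mult.commute)
    finally show "A * (y \<cdot>\<^sub>m adj_mat A) = 1\<^sub>m n" .
    have "(y \<cdot>\<^sub>m adj_mat A) * A = y \<cdot>\<^sub>m (adj_mat A * A)"
      using adj(1) A by (rule mult_smult_assoc_mat)
    also have "\<dots> = 1\<^sub>m n" unfolding adj(3) using y by (intro eq_matI) (auto simp: mult.commute)
    finally show "(y \<cdot>\<^sub>m adj_mat A) * A = 1\<^sub>m n" .
  qed
qed

lemma congruence_trans:
  fixes G' :: "padic2 mat"
  assumes "G' \<in> carrier_mat n n" "T \<in> carrier_mat n n" "T' \<in> carrier_mat n n"
  shows "transpose_mat T' * (transpose_mat T * G' * T) * T' = transpose_mat (T * T') * G' * (T * T')"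
proof -
  have "transpose_mat T' * (transpose_mat T * G' * T) * T' = transpose_mat T' * (transpose_mat T * (G' * (T * T')))"
    using assms by (simp add: assoc_mult_mat[of _ n n _ n _ n])
  also have "\<dots> = transpose_mat (T * T') * G' * (T * T')"
    unfolding transpose_mult[OF assms(2,3)] using assms by (simp add: assoc_mult_mat[of _ n n _ n _ n])
  finally show ?thesis .
qed

text \<open>Replacing the \<open>i\<close>-th basis vector by \<open>y/2\<close>.\<close>

lemma overlattice_step:
  assumes G: "G \<in> carrier_mat n n" and sym: "transpose_mat G = G"
    and y: "y \<in> carrier_vec n" and i: "i < n" "\<not> 2 dvd y $ i"
    and even: "\<forall>r<n. 2 dvd (G *\<^sub>v y) $ r" and four: "4 dvd y \<bullet> (G *\<^sub>v y)"
  obtains G' T where "G' \<in> carrier_mat n n" "T \<in> carrier_mat n n" "transpose_mat G' = G'"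
    "G = transpose_mat T * G' * T" "det G * (y $ i * y $ i) = 4 * det (G' :: padic2 mat)"
proof -
  obtain h where h: "\<And>r. r < n \<Longrightarrow> (G *\<^sub>v y) $ r = 2 * h r"
    using even unfolding dvd_def by metis
  obtain q where q: "y \<bullet> (G *\<^sub>v y) = 4 * q" using four by blast
  \<comment> \<open>\<open>P\<close> puts \<open>y\<close> in place of the i-th unit vector. As
    \<open>y\<close> is twice the new basis vector, the Gram matrix for \<open>P\<close> is that of
    the overlattice scaled on both sides by \<open>D\<close>.\<close>
  define P where "P = replace_col (1\<^sub>m n) y i"
  define D where "D = multrow_mat n i (2::padic2)"
  define G' where "G' = mat n n (\<lambda>(r, s). if s = i then (if r = i then q else h r) else if r = i then h s else G $$ (r, s))"
  have P: "P \<in> carrier_mat n n" by (simp add: P_def replace_col_def)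
  have D: "D \<in> carrier_mat n n" by (simp add: D_def)
  have G': "G' \<in> carrier_mat n n" by (simp add: G'_def)
  have Gsym: "G $$ (r, s) = G $$ (s, r)" if "r < n" "s < n" for r s
    using sym G that by (metis carrier_matD index_transpose_mat(1))
  have det_P: "det P = y $ i"
    using cramer_lemma_mat[OF one_carrier_mat y i(1)] y by (simp add: P_def)
  obtain P' where P': "P' \<in> carrier_mat n n" "P * P' = 1\<^sub>m n" "P' * P = 1\<^sub>m n"
    using odd_det_inverse[OF P] i(2) unfolding det_P by blast
  have col_P: "col P s = (if s = i then y else unit_vec n s)" if "s < n" for s
    using that y by (auto intro!: eq_vecI simp: P_def replace_col_def)
  have unit_G: "(G *\<^sub>v unit_vec n s) $ r = G $$ (r, s)" if "r < n" "s < n" for r s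
    using that G by simp
  have y_G: "y \<bullet> (G *\<^sub>v unit_vec n s) = 2 * h s" if s: "s < n" for s
  proof -
    have "y \<bullet> (G *\<^sub>v unit_vec n s) = y \<bullet> col G s"
      using G s by (intro arg_cong[where f = "\<lambda>v. y \<bullet> v"] eq_vecI) auto
    also have "\<dots> = col G s \<bullet> y" using y G s by (intro comm_scalar_prod[of _ n]) auto
    also have "col G s = row G s" using G s Gsym by (intro eq_vecI) auto
    also have "row G s \<bullet> y = (G *\<^sub>v y) $ s" using G s by simp
    finally show ?thesis using h s by simp
  qed
  have eq: "transpose_mat P * G * P = D * G' * D"
  proof (rule eq_matI)
    fix r s assume "r < dim_row (D * G' * D)" "s < dim_col (D * G' * D)"
    then have rs: "r < n" "s < n" using D by auto
    have GP: "G * P \<in> carrier_mat n n" using G P by simp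
    have "(transpose_mat P * G * P) $$ (r, s) = (transpose_mat P * (G * P)) $$ (r, s)"
      using G P by (simp add: assoc_mult_mat[of _ n n _ n _ n])
    also have "\<dots> = col P r \<bullet> (G *\<^sub>v col P s)"
      using rs P G GP by (simp add: col_mult2[OF G P])
    also have "\<dots> = (if s = i then (if r = i then 4 * q else 2 * h r) else if r = i then 2 * h s else G $$ (r, s))"
      using rs G y h q y_G by (auto simp: col_P scalar_prod_left_unit[of _ n] unit_G simp del: index_mult_mat_vec)
    also have "\<dots> = (D * G' * D) $$ (r, s)"
      using rs unfolding D_def multrow_mat[OF G', symmetric]
      by (subst multcol_mat[of _ n n, symmetric]) (auto simp: G'_def)
    finally show "(transpose_mat P * G * P) $$ (r, s) = (D * G' * D) $$ (r, s)" .
  qed (use P D G G' in auto)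
  have DT: "transpose_mat D = D"
    by (rule eq_matI) (auto simp: D_def)
  define T where "T = D * P'"
  have T: "T \<in> carrier_mat n n" using D P' by (simp add: T_def)
  have "G = transpose_mat (P * P') * G * (P * P')"
    using G P' by simp
  also have "\<dots> = transpose_mat P' * (transpose_mat P * G * P) * P'"
    using congruence_trans[OF G P P'(1)] by simp
  also have "\<dots> = transpose_mat P' * (transpose_mat D * G' * D) * P'"
    unfolding eq DT ..
  also have "\<dots> = transpose_mat T * G' * T"
    unfolding T_def by (rule congruence_trans[OF G' D P'(1)])
  finally have GT: "G = transpose_mat T * G' * T" .
  have det_D: "det D = 2" unfolding D_def by (rule det_multrow_mat[OF i(1)])
  have "det (transpose_mat P * G * P) = det G * (y $ i * y $ i)"
    using P G by (simp add: det_mult[of _ n] det_transpose det_P ac_simps)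
  moreover have "det (D * G' * D) = 4 * det G'"
    using D G' by (simp add: det_mult[of _ n] det_D)
  ultimately have "det G * (y $ i * y $ i) = 4 * det G'" unfolding eq by simp
  moreover have "transpose_mat G' = G'"
    using Gsym by (intro eq_matI) (auto simp: G'_def)
  ultimately show thesis using that G' T GT by blast
qed

text \<open>Each step divides the determinant by 4 up to a unit, so its valuation drops and the
  process ends.\<close>

lemma maximal_overlattice:
  assumes "G \<in> carrier_mat n n" "transpose_mat G = G" "det (G :: padic2 mat) \<noteq> 0"
  shows "\<exists>G' T. G' \<in> carrier_mat n n \<and> T \<in> carrier_mat n n \<and> transpose_mat G' = G' \<and>
    G = transpose_mat T * G' * T \<and> maximal_form n G'"
proof -
  obtain k u where "det G = 2 ^ k * u" "\<not> 2 dvd u"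
    using padic2_decomp[OF assms(3)] .
  with assms(1,2) show ?thesis
  proof (induction k arbitrary: G u rule: less_induct)
    case (less k G u)
    show ?case
    proof (cases "maximal_form n G")
      case True
      then show ?thesis
        using less.prems by (intro exI[of _ G] exI[of _ "1\<^sub>m n"]) auto
    next
      case False
      then obtain y i where y: "y \<in> carrier_vec n" "i < n" "\<not> 2 dvd y $ i"
        "\<forall>r<n. 2 dvd (G *\<^sub>v y) $ r" "4 dvd y \<bullet> (G *\<^sub>v y)"
        unfolding maximal_form_def by blast
      obtain G1 T1 where G1: "G1 \<in> carrier_mat n n" "T1 \<in> carrier_mat n n" "transpose_mat G1 = G1"
        "G = transpose_mat T1 * G1 * T1" and det: "det G * (y $ i * y $ i) = 4 * det G1"
        using overlattice_step[OF less.prems(1,2) y] by blast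
      have odd: "\<not> 2 dvd u * (y $ i * y $ i)"
        using less.prems(4) y(3) by (simp add: even_mult_iff')
      have "det G1 \<noteq> 0"
      proof
        assume "det G1 = 0"
        then have "2 ^ k * (u * (y $ i * y $ i)) = 0" using det less.prems(3) by (simp add: ac_simps)
        then have "u * (y $ i * y $ i) = 0" by (rule pow2_mult_eq_0)
        then show False using odd by auto
      qed
      then obtain k' u' where k': "det G1 = 2 ^ k' * u'" "\<not> 2 dvd u'"
        using padic2_decomp by blast
      have "k' < k"
      proof (rule ccontr)
        assume "\<not> k' < k"
        then obtain j where j: "k' = k + j" using le_Suc_ex not_less by blast
        have "2 ^ k * (u * (y $ i * y $ i)) = 2 ^ k * (2 * (2 * (2 ^ j * u')))"
          using det less.prems(3) k'(1) unfolding j power_add by (simp add: ac_simps)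
        then have "u * (y $ i * y $ i) = 2 * (2 * (2 ^ j * u'))" by (rule pow2_mult_cancel)
        then have "2 dvd u * (y $ i * y $ i)" by (rule dvdI)
        then show False using odd by simp
      qed
      from less.IH[OF this G1(1,3) k'] obtain G' T where
        G': "G' \<in> carrier_mat n n" "T \<in> carrier_mat n n" "transpose_mat G' = G'"
        "G1 = transpose_mat T * G' * T" "maximal_form n G'" by blast
      have "G = transpose_mat (T * T1) * G' * (T * T1)"
        using G1(4) unfolding G'(4) congruence_trans[OF G'(1,2) G1(2)] .
      then show ?thesis using G' G1(2)
        by (intro exI[of _ G'] exI[of _ "T * T1"]) auto
    qed
  qed
qed

section \<open>Saturated sublattices and dual families\<close>

definition mat_app :: "(nat \<Rightarrow> nat \<Rightarrow> padic2) \<Rightarrow> (nat \<Rightarrow> padic2) \<Rightarrow> nat \<Rightarrow> padic2" where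
  "mat_app A v i = dot (A i) v"

definition gram_form :: "(nat \<Rightarrow> nat \<Rightarrow> padic2) \<Rightarrow> (nat \<Rightarrow> padic2) \<Rightarrow> (nat \<Rightarrow> padic2) \<Rightarrow> padic2" where
  "gram_form A u v = dot u (mat_app A v)"

lemma dot_cong: "(\<And>k. k < 8 \<Longrightarrow> l k = l' k) \<Longrightarrow> (\<And>k. k < 8 \<Longrightarrow> v k = v' k) \<Longrightarrow> dot l v = dot l' v'"
  unfolding dot_def by (intro sum.cong) auto

lemma dot_commute: "dot u v = dot v u"
  by (simp add: dot_def mult.commute)

lemma dot_scale: "dot l (\<lambda>k. c * v k) = c * dot l v"
  by (simp add: dot_def sum_distrib_left ac_simps)

lemma dot_sum: "dot l (\<lambda>k. \<Sum>i\<in>I. c i * v i k) = (\<Sum>i\<in>I. c i * dot l (v i))"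
proof -
  have "dot l (\<lambda>k. \<Sum>i\<in>I. c i * v i k) = (\<Sum>k<8. \<Sum>i\<in>I. c i * (l k * v i k))"
    by (simp add: dot_def sum_distrib_left ac_simps)
  also have "\<dots> = (\<Sum>i\<in>I. \<Sum>k<8. c i * (l k * v i k))" by (rule sum.swap)
  finally show ?thesis by (simp add: dot_def sum_distrib_left)
qed

lemma dot_sum_left: "dot (\<lambda>k. \<Sum>i\<in>I. c i * l i k) v = (\<Sum>i\<in>I. c i * dot (l i) v)"
  by (simp only: dot_commute[of _ v] dot_sum)

lemma dot_diff: "dot l (\<lambda>k. v k - w k) = dot l v - dot l w"
  by (simp add: dot_def sum_subtractf right_diff_distrib)

lemma dot_unit: "p < 8 \<Longrightarrow> dot (\<lambda>k. if k = p then 1 else 0) v = v p"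
  by (simp add: dot_def if_distrib[of "\<lambda>x. x * _"] cong: if_cong)

lemma mat_app_sum: "mat_app A (\<lambda>k. \<Sum>i\<in>I. c i * v i k) j = (\<Sum>i\<in>I. c i * mat_app A (v i) j)"
  by (simp add: mat_app_def dot_sum)

lemma mat_app_scale: "mat_app A (\<lambda>k. c * v k) j = c * mat_app A v j"
  by (simp add: mat_app_def dot_scale)

lemma mat_app_cong: "(\<And>k. k < 8 \<Longrightarrow> v k = w k) \<Longrightarrow> mat_app A v j = mat_app A w j"
  unfolding mat_app_def by (rule dot_cong) auto

lemma gram_form_sum_right: "gram_form A u (\<lambda>k. \<Sum>i\<in>I. c i * v i k) = (\<Sum>i\<in>I. c i * gram_form A u (v i))"
proof -
  have "mat_app A (\<lambda>k. \<Sum>i\<in>I. c i * v i k) = (\<lambda>j. \<Sum>i\<in>I. c i * mat_app A (v i) j)"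
    by (simp add: fun_eq_iff mat_app_sum)
  then show ?thesis by (simp add: gram_form_def dot_sum)
qed

lemma gram_form_sum_left: "gram_form A (\<lambda>k. \<Sum>i\<in>I. c i * v i k) u = (\<Sum>i\<in>I. c i * gram_form A (v i) u)"
  by (simp add: gram_form_def dot_sum_left)

lemma gram_form_cong: "(\<And>k. k < 8 \<Longrightarrow> u k = u' k) \<Longrightarrow> (\<And>k. k < 8 \<Longrightarrow> v k = v' k) \<Longrightarrow> gram_form A u v = gram_form A u' v'"
  unfolding gram_form_def by (intro dot_cong mat_app_cong) auto

lemma gram_form_expand: "gram_form A u v = (\<Sum>i<8. \<Sum>j<8. u i * A i j * v j)"
  by (simp add: gram_form_def mat_app_def dot_def sum_distrib_left mult.assoc)

lemma gram_form_commute: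
  assumes "\<And>i j. i < 8 \<Longrightarrow> j < 8 \<Longrightarrow> A i j = A j i"
  shows "gram_form A u v = gram_form A v u"
proof -
  have "gram_form A u v = (\<Sum>j<8. \<Sum>i<8. u i * A i j * v j)"
    unfolding gram_form_expand by (rule sum.swap)
  also have "\<dots> = gram_form A v u"
    unfolding gram_form_expand using assms by (intro sum.cong refl) (auto simp: ac_simps)
  finally show ?thesis .
qed

text \<open>A vector with even coordinates is halved, and the valuation of one nonzero coordinate
  bounds the number of halvings.\<close>

lemma vec_decomp:
  fixes v :: "nat \<Rightarrow> padic2"
  assumes "\<exists>k<8. v k \<noteq> 0"
  obtains m p and w :: "nat \<Rightarrow> padic2" where "\<And>k. k < 8 \<Longrightarrow> v k = 2 ^ m * w k" "p < 8" "\<not> 2 dvd w p"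
proof -
  obtain p where p: "p < 8" "v p \<noteq> 0" using assms by blast
  obtain a u where "v p = 2 ^ a * u" "\<not> 2 dvd u" using padic2_decomp[OF p(2)] .
  then have "\<exists>m (w :: nat \<Rightarrow> padic2) p. (\<forall>k<8. v k = 2 ^ m * w k) \<and> p < (8::nat) \<and> \<not> 2 dvd w p"
  proof (induction a arbitrary: v)
    case 0
    then show ?case using p by (intro exI[of _ 0] exI[of _ v] exI[of _ p]) simp
  next
    case (Suc a)
    show ?case
    proof (cases "even_vec 8 v")
      case True
      then have "\<forall>k. \<exists>w. k < 8 \<longrightarrow> v k = 2 * w" unfolding even_vec_def by blast
      then obtain w where w: "\<And>k. k < 8 \<Longrightarrow> v k = 2 * w k" by metis
      have "2 * w p = 2 * (2 ^ a * u)" using w[OF p(1)] Suc.prems(1) by simp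
      then have "w p = 2 ^ a * u" by (subst (asm) mult_cancel_left) simp
      from Suc.IH[of w, OF this Suc.prems(2)] obtain m w' q where
        q: "\<forall>k<8. w k = 2 ^ m * w' k" "q < 8" "\<not> 2 dvd w' q" by blast
      then have "\<forall>k<8. v k = 2 ^ Suc m * w' k" using w by simp
      then show ?thesis using q by blast
    next
      case False
      then obtain q where "q < 8" "\<not> 2 dvd v q" by (auto simp: even_vec_def)
      then show ?thesis by (intro exI[of _ 0] exI[of _ v] exI[of _ q]) simp
    qed
  qed
  then show thesis using that by blast
qed

text \<open>A triangular (Hermite) basis of the saturation of the span of the \<open>n i\<close>.\<close>

lemma saturated_basis:
  fixes r :: nat
  assumes "\<And>i j. i < r \<Longrightarrow> j < r \<Longrightarrow> dot (\<psi> i) (n j) = (if i = j then 2 ^ s else 0)"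
  shows "\<exists>e \<epsilon> K b. (\<forall>i<r. \<forall>j<r. dot (\<epsilon> i) (e j) = (if i = j then 1 else 0)) \<and>
    (\<forall>j<r. \<forall>k<8. 2 ^ K * e j k = (\<Sum>i<r. b j i * n i k))"
  using assms
proof (induction r)
  case 0
  then show ?case by simp
next
  case (Suc r)
  have "\<exists>e \<epsilon> K b. (\<forall>i<r. \<forall>j<r. dot (\<epsilon> i) (e j) = (if i = j then 1 else 0)) \<and>
    (\<forall>j<r. \<forall>k<8. 2 ^ K * e j k = (\<Sum>i<r. b j i * n i k))"
    by (rule Suc.IH) (use Suc.prems in auto)
  then obtain e \<epsilon> K b where
    "\<forall>i<r. \<forall>j<r. dot (\<epsilon> i) (e j) = (if i = j then 1 else 0)"
    "\<forall>j<r. \<forall>k<8. 2 ^ K * e j k = (\<Sum>i<r. b j i * n i k)"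
    by blast
  then have dual: "\<And>i j. i < r \<Longrightarrow> j < r \<Longrightarrow> dot (\<epsilon> i) (e j) = (if i = j then 1 else 0)"
    and span: "\<And>j k. j < r \<Longrightarrow> k < 8 \<Longrightarrow> 2 ^ K * e j k = (\<Sum>i<r. b j i * n i k)"
    by simp_all
  \<comment> \<open>The components along the earlier \<open>e i\<close> are removed. The rest is
    nonzero because \<open>\<psi> r\<close> takes the value 2^s on it, so its content can be divided
    out.\<close>
  define n' where "n' k = n r k - (\<Sum>i<r. dot (\<epsilon> i) (n r) * e i k)" for k
  have dot_n': "dot l n' = dot l (n r) - (\<Sum>i<r. dot (\<epsilon> i) (n r) * dot l (e i))" for l
    by (simp add: n'_def[abs_def] dot_diff dot_sum)
  have "dot (\<psi> r) (e j) = 0" if "j < r" for j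
  proof -
    have "2 ^ K * dot (\<psi> r) (e j) = dot (\<psi> r) (\<lambda>k. \<Sum>i<r. b j i * n i k)"
      unfolding dot_scale[symmetric] by (rule dot_cong) (use span that in auto)
    also have "\<dots> = 0" unfolding dot_sum using Suc.prems by (intro sum.neutral) auto
    finally show ?thesis by (rule pow2_mult_eq_0)
  qed
  then have "dot (\<psi> r) n' = 2 ^ s"
    unfolding dot_n' using Suc.prems[of r r] by simp
  moreover have "dot (\<psi> r) n' = 0" if "\<forall>k<8. n' k = 0"
    using that by (simp add: dot_def)
  ultimately have "\<exists>k<8. n' k \<noteq> 0" by fastforce
  then obtain m e' p where e': "\<And>k. k < 8 \<Longrightarrow> n' k = 2 ^ m * e' k" and p: "p < 8" "\<not> 2 dvd e' p"
    by (rule vec_decomp) blast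
  obtain y where y: "e' p * y = 1" using odd_inverse[OF p(2)] .
  have dual': "dot (\<epsilon> i) e' = 0" if "i < r" for i
  proof -
    have "2 ^ m * dot (\<epsilon> i) e' = dot (\<epsilon> i) n'"
      unfolding dot_scale[symmetric] by (rule dot_cong) (use e' in auto)
    also have "\<dots> = dot (\<epsilon> i) (n r) - (\<Sum>j<r. dot (\<epsilon> j) (n r) * (if i = j then 1 else 0))"
      unfolding dot_n' using dual that by simp
    also have "\<dots> = 0" using that by (simp add: if_distrib[of "\<lambda>x. _ * x"] cong: if_cong)
    finally show ?thesis by (rule pow2_mult_eq_0)
  qed
  \<comment> \<open>Coordinate p of \<open>e'\<close> is a unit and is normalized by
    \<open>y\<close>; the sum makes the functional vanish on the earlier \<open>e i\<close>.\<close>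
  define \<epsilon>' where "\<epsilon>' k = y * ((if k = p then 1 else 0) - (\<Sum>i<r. e i p * \<epsilon> i k))" for k
  have dot_\<epsilon>': "dot \<epsilon>' v = y * (v p - (\<Sum>i<r. e i p * dot (\<epsilon> i) v))" for v
    using p(1) unfolding \<epsilon>'_def[abs_def] dot_commute[of _ v] dot_scale dot_diff dot_sum
    by (simp add: dot_commute[of v] dot_unit)
  have \<epsilon>'_e: "dot \<epsilon>' (e j) = 0" if "j < r" for j
    unfolding dot_\<epsilon>' using dual that by (simp add: if_distrib[of "\<lambda>x. _ * x"] cong: if_cong)
  have \<epsilon>'_e': "dot \<epsilon>' e' = 1"
    unfolding dot_\<epsilon>' using dual' y by (simp add: mult.commute)
  define b' where "b' = (\<lambda>j i. if j < r then (if i < r then 2 ^ m * b j i else 0)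
     else (if i < r then - (\<Sum>l<r. dot (\<epsilon> l) (n r) * b l i) else 2 ^ K))"
  have S: "2 ^ (K + m) * (e(r := e')) j k = (\<Sum>i<Suc r. b' j i * n i k)" if "j < Suc r" "k < 8" for j k
  proof (cases "j < r")
    case True
    have "2 ^ (K + m) * e j k = 2 ^ m * (2 ^ K * e j k)" by (simp add: power_add ac_simps)
    also have "\<dots> = (\<Sum>i<Suc r. b' j i * n i k)"
      unfolding span[OF True that(2)] using True by (simp add: b'_def sum_distrib_left mult.assoc)
    finally show ?thesis using True by simp
  next
    case False
    then have j: "j = r" using that by simp
    have "2 ^ (K + m) * e' k = 2 ^ K * n' k" by (simp add: e'[OF that(2)] power_add mult.assoc)
    also have "\<dots> = 2 ^ K * n r k - (\<Sum>l<r. dot (\<epsilon> l) (n r) * (2 ^ K * e l k))"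
      by (simp add: n'_def right_diff_distrib sum_distrib_left ac_simps)
    also have "(\<Sum>l<r. dot (\<epsilon> l) (n r) * (2 ^ K * e l k)) = (\<Sum>l<r. \<Sum>i<r. dot (\<epsilon> l) (n r) * b l i * n i k)"
      using span that(2) by (simp add: sum_distrib_left mult.assoc)
    also have "\<dots> = (\<Sum>i<r. \<Sum>l<r. dot (\<epsilon> l) (n r) * b l i * n i k)" by (rule sum.swap)
    also have "2 ^ K * n r k - \<dots> = (\<Sum>i<Suc r. b' r i * n i k)"
      by (simp add: b'_def sum_distrib_right sum_negf)
    finally show ?thesis using j by simp
  qed
  have D: "dot ((\<epsilon>(r := \<epsilon>')) i) ((e(r := e')) j) = (if i = j then 1 else 0)" if "i < Suc r" "j < Suc r" for i j
    using that dual dual' \<epsilon>'_e \<epsilon>'_e' by (auto simp: less_Suc_eq)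
  have "(\<forall>i<Suc r. \<forall>j<Suc r. dot ((\<epsilon>(r := \<epsilon>')) i) ((e(r := e')) j) = (if i = j then 1 else 0)) \<and>
    (\<forall>j<Suc r. \<forall>k<8. 2 ^ (K + m) * (e(r := e')) j k = (\<Sum>i<Suc r. b' j i * n i k))"
    by (intro conjI allI impI; (rule D | rule S); assumption)
  then show ?case
    by (rule exI[of _ "e(r := e')", OF exI[of _ "\<epsilon>(r := \<epsilon>')", OF exI[of _ "K + m", OF exI[of _ b']]]])
qed

text \<open>Elimination over a local ring: by independence modulo 2, the reduced vector
  \<open>h'\<close> has a unit coordinate, which defines the new functional. The earlier functionals
  are then corrected to vanish on \<open>h r\<close>.\<close>

lemma dual_family:
  fixes r :: nat
  assumes "\<And>c. even_vec 8 (\<lambda>k. \<Sum>i<r. c i * h i k) \<Longrightarrow> even_vec r c"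
  shows "\<exists>f. \<forall>i<r. \<forall>j<r. dot (f i) (h j) = (if i = j then 1 else 0)"
  using assms
proof (induction r)
  case 0
  then show ?case by simp
next
  case (Suc r)
  have "even_vec r c" if "even_vec 8 (\<lambda>k. \<Sum>i<r. c i * h i k)" for c
  proof -
    have "(\<lambda>k. \<Sum>i<Suc r. (c(r := 0)) i * h i k) = (\<lambda>k. \<Sum>i<r. c i * h i k)"
      by (simp add: fun_eq_iff)
    then have "even_vec (Suc r) (c(r := 0))" using Suc.prems[of "c(r := 0)"] that by metis
    then show ?thesis by (auto simp: even_vec_def less_Suc_eq)
  qed
  from Suc.IH[OF this] obtain f where
    "\<forall>i<r. \<forall>j<r. dot (f i) (h j) = (if i = j then 1 else 0)" ..
  then have dual: "\<And>i j. i < r \<Longrightarrow> j < r \<Longrightarrow> dot (f i) (h j) = (if i = j then 1 else 0)"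
    by blast
  define h' where "h' k = h r k - (\<Sum>i<r. dot (f i) (h r) * h i k)" for k
  have "\<not> even_vec 8 h'"
  proof
    assume "even_vec 8 h'"
    moreover have "(\<lambda>k. \<Sum>i<Suc r. (if i < r then - dot (f i) (h r) else 1) * h i k) = h'"
      by (simp add: h'_def fun_eq_iff sum_negf)
    ultimately have "even_vec (Suc r) (\<lambda>i. if i < r then - dot (f i) (h r) else 1)"
      by (intro Suc.prems) (simp only:)
    then show False by (auto simp: even_vec_def)
  qed
  then obtain p where p: "p < 8" "\<not> 2 dvd h' p" by (auto simp: even_vec_def)
  obtain y where y: "h' p * y = 1" using odd_inverse[OF p(2)] .
  define f' where "f' k = y * ((if k = p then 1 else 0) - (\<Sum>i<r. h i p * f i k))" for k
  have dot_f': "dot f' v = y * (v p - (\<Sum>i<r. h i p * dot (f i) v))" for v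
    using p(1) unfolding f'_def[abs_def] dot_commute[of _ v] dot_scale dot_diff dot_sum
    by (simp add: dot_commute[of v] dot_unit)
  have f'_h: "dot f' (h j) = 0" if "j < r" for j
    unfolding dot_f' using dual that by (simp add: if_distrib[of "\<lambda>x. _ * x"] cong: if_cong)
  have f'_h': "dot f' (h r) = 1"
    unfolding dot_f' using y by (simp add: h'_def ac_simps)
  define g where "g i = (if i < r then (\<lambda>k. f i k - dot (f i) (h r) * f' k) else f')" for i
  have "dot (g i) (h j) = (if i = j then 1 else 0)" if "i < Suc r" "j < Suc r" for i j
    using that dual f'_h f'_h'
    by (auto simp: less_Suc_eq g_def dot_commute[of _ "h _"] dot_diff dot_scale)
  then show ?case by blast
qed

section \<open>The odd unimodular overlattice\<close>

text \<open>\<open>T\<close> embeds one lattice isometrically into the other, and integrality of 2^t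
  T^-1 = \<open>S\<close> says that 2^t annihilates the quotient.\<close>

definition frame ::
  "(nat \<Rightarrow> nat \<Rightarrow> padic2) \<Rightarrow> (nat \<Rightarrow> nat \<Rightarrow> padic2) \<Rightarrow> (nat \<Rightarrow> nat \<Rightarrow> padic2) \<Rightarrow> (nat \<Rightarrow> nat \<Rightarrow> padic2) \<Rightarrow> nat \<Rightarrow> bool" where
  "frame G G' T S t \<longleftrightarrow> (\<forall>v. \<forall>i<8. mat_app T (mat_app S v) i = 2 ^ t * v i) \<and>
     (\<forall>v. \<forall>i<8. mat_app S (mat_app T v) i = 2 ^ t * v i) \<and>
     (\<forall>u v. gram_form G' (mat_app T u) (mat_app T v) = gram_form G u v) \<and> (\<forall>i<8. \<forall>j<8. G' i j = G' j i)"

text \<open>Primitivity is certified by a left inverse \<open>Y\<close> instead of a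
  complement.\<close>

definition prim_rep8 ::
  "(nat \<Rightarrow> nat \<Rightarrow> padic2) \<Rightarrow> (nat \<Rightarrow> nat \<Rightarrow> padic2) \<Rightarrow> (nat \<Rightarrow> nat \<Rightarrow> padic2) \<Rightarrow> (nat \<Rightarrow> nat \<Rightarrow> padic2) \<Rightarrow> bool" where
  "prim_rep8 G GL x Y \<longleftrightarrow> (\<forall>a<4. \<forall>b<4. gram_form G (x a) (x b) = GL a b) \<and>
     (\<forall>a<4. \<forall>b<4. dot (Y a) (x b) = (if a = b then 1 else 0))"

lemma gram_form_scale: "gram_form A (\<lambda>k. c * u k) (\<lambda>k. d * v k) = c * d * gram_form A u v"
  unfolding gram_form_expand by (simp add: sum_distrib_left ac_simps)

lemma lin4_eq_sum: "lin4 c e = (\<lambda>k. \<Sum>i<4. c i * e i k)"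
  by (simp add: fun_eq_iff lin4_sum)

lemma dual_even:
  fixes r :: nat
  assumes "\<And>i j. i < r \<Longrightarrow> j < r \<Longrightarrow> dot (\<epsilon> i) (e j) = (if i = j then 1 else 0)"
    and "even_vec 8 (\<lambda>k. \<Sum>i<r. c i * e i k)"
  shows "even_vec r c"
  unfolding even_vec_def
proof (intro allI impI)
  fix i assume i: "i < r"
  have "2 dvd dot (\<lambda>k. \<Sum>i<r. c i * e i k) (\<epsilon> i)"
    by (rule dot_even) fact
  also have "dot (\<lambda>k. \<Sum>i<r. c i * e i k) (\<epsilon> i) = (\<Sum>j<r. c j * (if i = j then 1 else 0))"
    unfolding dot_sum_left using assms(1) i by (simp add: dot_commute[of "e _"])
  also have "\<dots> = c i" using i by (simp add: if_distrib[of "\<lambda>x. _ * x"] cong: if_cong)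
  finally show "2 dvd c i" .
qed

text \<open>Composed with \<open>S\<close>, the left inverse \<open>Y\<close> gives integral
  functionals \<open>\<psi>\<close> that are dual to the images \<open>n i\<close> up to the factor
  2^t. They feed \<open>saturated_basis\<close> and also read off the coordinates \<open>a\<close>.
  Then \<open>S\<close> sends \<open>e j\<close> to the combination of the \<open>x i\<close> with
  coefficients \<open>a j\<close>, and \<open>Y\<close> recovers these coefficients, whence the
  parity criterion.\<close>

lemma saturation:
  assumes fr: "frame G G' T S t" and pr: "prim_rep8 G GL x Y"
  obtains e a \<epsilon> :: "nat \<Rightarrow> nat \<Rightarrow> padic2" where "\<And>i j. i < 4 \<Longrightarrow> j < 4 \<Longrightarrow> dot (\<epsilon> i) (e j) = (if i = j then 1 else 0)"
    "\<And>i j. i < 4 \<Longrightarrow> j < 4 \<Longrightarrow> 4 ^ t * gram_form G' (e i) (e j) = form4 GL (a i) (a j)"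
    "\<And>c. even_vec 4 (lin4 c a) \<longleftrightarrow> even_vec 8 (mat_app S (lin4 c e))"
proof -
  define n where "n i = mat_app T (x i)" for i
  define \<psi> where "\<psi> i k = (\<Sum>l<8. Y i l * S l k)" for i k
  have dot_\<psi>: "dot (\<psi> i) v = dot (Y i) (mat_app S v)" for i v
    unfolding \<psi>_def[abs_def] dot_sum_left by (simp add: dot_def[of "Y i"] mat_app_def)
  have S_n: "mat_app S (n i) k = 2 ^ t * x i k" if "k < 8" for i k
    using fr that by (simp add: frame_def n_def)
  have \<psi>_n: "dot (\<psi> i) (n j) = (if i = j then 2 ^ t else 0)" if "i < 4" "j < 4" for i j
  proof -
    have "dot (\<psi> i) (n j) = dot (Y i) (\<lambda>k. 2 ^ t * x j k)"
      unfolding dot_\<psi> by (rule dot_cong) (use S_n in auto)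
    then show ?thesis using pr that by (simp add: dot_scale prim_rep8_def)
  qed
  from saturated_basis[where r = 4 and \<psi> = \<psi> and n = n and s = t, OF \<psi>_n]
  obtain e \<epsilon> :: "nat \<Rightarrow> nat \<Rightarrow> padic2" and K b where
    dual: "\<forall>i<4. \<forall>j<4. dot (\<epsilon> i) (e j) = (if i = j then 1 else 0)" and
    span: "\<forall>j<4. \<forall>k<8. 2 ^ K * e j k = (\<Sum>i<4. b j i * n i k)" by blast
  define a where "a i j = dot (\<psi> j) (e i)" for i j
  have a_b: "2 ^ K * a j i = 2 ^ t * b j i" if "j < 4" "i < 4" for i j
  proof -
    have "2 ^ K * a j i = dot (\<psi> i) (\<lambda>k. \<Sum>l<4. b j l * n l k)"
      unfolding a_def dot_scale[symmetric] by (rule dot_cong) (use span that in auto)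
    also have "\<dots> = (\<Sum>l<4. b j l * (if i = l then 2 ^ t else 0))"
      unfolding dot_sum using \<psi>_n that by simp
    finally show ?thesis using that by (simp add: if_distrib[of "\<lambda>x. _ * x"] mult.commute cong: if_cong)
  qed
  have e_a: "2 ^ t * e j k = (\<Sum>i<4. a j i * n i k)" if "j < 4" "k < 8" for j k
  proof -
    have "2 ^ K * (2 ^ t * e j k) = 2 ^ t * (\<Sum>i<4. b j i * n i k)"
      using span that by (simp add: ac_simps)
    also have "\<dots> = (\<Sum>i<4. 2 ^ K * a j i * n i k)"
      unfolding sum_distrib_left using a_b that by (intro sum.cong) (auto simp: mult.assoc)
    also have "\<dots> = 2 ^ K * (\<Sum>i<4. a j i * n i k)"
      by (simp add: sum_distrib_left mult.assoc)
    finally show ?thesis by (rule pow2_mult_cancel)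
  qed
  have gram: "4 ^ t * gram_form G' (e i) (e j) = form4 GL (a i) (a j)" if "i < 4" "j < 4" for i j
  proof -
    have "(4::padic2) ^ t = 2 ^ t * 2 ^ t" by (simp flip: power_mult_distrib)
    then have "4 ^ t * gram_form G' (e i) (e j) = gram_form G' (\<lambda>k. 2 ^ t * e i k) (\<lambda>k. 2 ^ t * e j k)"
      unfolding gram_form_scale by simp
    also have "\<dots> = gram_form G' (\<lambda>k. \<Sum>l<4. a i l * n l k) (\<lambda>k. \<Sum>l<4. a j l * n l k)"
      by (rule gram_form_cong) (use e_a that in auto)
    also have "\<dots> = (\<Sum>k<4. \<Sum>l<4. a i k * GL k l * a j l)"
      unfolding gram_form_sum_left unfolding gram_form_sum_right
      using fr pr by (simp add: frame_def prim_rep8_def n_def sum_distrib_left ac_simps)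
    finally show ?thesis by (simp add: form4_def)
  qed
  have S_e: "mat_app S (e j) k = (\<Sum>i<4. a j i * x i k)" if "j < 4" "k < 8" for j k
  proof -
    have "2 ^ t * mat_app S (e j) k = mat_app S (\<lambda>k. \<Sum>i<4. a j i * n i k) k"
      unfolding mat_app_scale[symmetric] by (rule mat_app_cong) (use e_a that in auto)
    also have "\<dots> = 2 ^ t * (\<Sum>i<4. a j i * x i k)"
      unfolding mat_app_sum using S_n that by (simp add: sum_distrib_left ac_simps)
    finally show ?thesis by (rule pow2_mult_cancel)
  qed
  have "even_vec 4 (lin4 c a) \<longleftrightarrow> even_vec 8 (mat_app S (lin4 c e))" for c
  proof
    assume ev: "even_vec 4 (lin4 c a)"
    have "mat_app S (lin4 c e) k = (\<Sum>i<4. lin4 c a i * x i k)" if "k < 8" for k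
      using that unfolding lin4_eq_sum mat_app_sum
      by (simp add: S_e sum_distrib_left sum_distrib_right mult.assoc) (rule sum.swap)
    then show "even_vec 8 (mat_app S (lin4 c e))"
      using ev unfolding even_vec_def by (auto intro!: dvd_sum)
  next
    assume ev: "even_vec 8 (mat_app S (lin4 c e))"
    have "lin4 c a i = dot (Y i) (mat_app S (lin4 c e))" for i
      unfolding lin4_sum a_def dot_\<psi> lin4_eq_sum mat_app_sum[abs_def] dot_sum ..
    then show "even_vec 4 (lin4 c a)"
      using dot_even[OF ev] by (simp add: even_vec_def dot_commute)
  qed
  with dual gram that[of \<epsilon> e a] show thesis by simp
qed

text \<open>Eight vectors independent modulo 2 form a basis: their dual family gives a left inverse
  matrix, whose determinant must be a unit, so it is a two-sided inverse.\<close>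

lemma basis_expansion:
  assumes "\<And>c. even_vec 8 (\<lambda>k. \<Sum>i<8. c i * q i k) \<Longrightarrow> even_vec 8 c"
  obtains L where "\<And>i j. i < 8 \<Longrightarrow> j < 8 \<Longrightarrow> dot (L i) (q j) = (if i = j then 1 else 0)"
    "\<And>v k. k < 8 \<Longrightarrow> (\<Sum>j<8. dot (L j) v * q j k) = v k"
proof -
  obtain L where L: "\<forall>i<8. \<forall>j<8. dot (L i) (q j) = (if i = j then 1 else 0)"
    using dual_family[where r = 8 and h = q, OF assms] by blast
  define A where "A = mat 8 8 (\<lambda>(i, k). L i k)"
  define P where "P = mat 8 8 (\<lambda>(k, j). q j k)"
  have A: "A \<in> carrier_mat 8 8" and P: "P \<in> carrier_mat 8 8" by (simp_all add: A_def P_def)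
  have AP: "A * P = 1\<^sub>m 8"
  proof (rule eq_matI)
    fix i j assume ij: "i < dim_row (1\<^sub>m 8 :: padic2 mat)" "j < dim_col (1\<^sub>m 8 :: padic2 mat)"
    then have "(A * P) $$ (i, j) = dot (L i) (q j)"
      by (simp add: A_def P_def scalar_prod_def dot_def lessThan_atLeast0)
    then show "(A * P) $$ (i, j) = 1\<^sub>m 8 $$ (i, j)" using L ij by simp
  qed (simp_all add: A_def P_def)
  have "det A * det P = 1" using det_mult[OF A P] AP by simp
  then have "\<not> 2 dvd det A" using odd_1 by (metis dvd_mult2)
  then obtain A' where A': "A' \<in> carrier_mat 8 8" "A' * A = 1\<^sub>m 8"
    using odd_det_inverse[OF A] by blast
  have "A' = A' * (A * P)" using A' AP by simp
  also have "\<dots> = P" using A' A P by (simp add: assoc_mult_mat[of A' 8 8 A 8 P 8, symmetric])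
  finally have PA: "P * A = 1\<^sub>m 8" using A' by simp
  have id: "(\<Sum>j<8. q j k * L j l) = (if k = l then 1 else 0)" if "k < 8" "l < 8" for k l
  proof -
    have "(P * A) $$ (k, l) = (\<Sum>j<8. q j k * L j l)"
      using that by (simp add: A_def P_def scalar_prod_def lessThan_atLeast0)
    then show ?thesis using PA that by simp
  qed
  show thesis
  proof (rule that[of L])
    show "(\<Sum>j<8. dot (L j) v * q j k) = v k" if k: "k < 8" for v k
    proof -
      have "(\<Sum>j<8. dot (L j) v * q j k) = dot (\<lambda>l. \<Sum>j<8. q j k * L j l) v"
        unfolding dot_sum_left by (simp add: mult.commute)
      also have "\<dots> = dot (\<lambda>l. if l = k then 1 else 0) v"
        by (rule dot_cong) (use id k in auto)
      finally show ?thesis using k by (simp add: dot_unit)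
    qed
  qed (use L in auto)
qed

definition interleave :: "(nat \<Rightarrow> nat \<Rightarrow> padic2) \<Rightarrow> (nat \<Rightarrow> nat \<Rightarrow> padic2) \<Rightarrow> nat \<Rightarrow> nat \<Rightarrow> padic2" where
  "interleave e f j = (if even j then e (j div 2) else f (j div 2))"

lemma gram_form_even_right: "even_vec 8 v \<Longrightarrow> par (gram_form A u v) = 0"
  unfolding gram_form_def mat_app_def par_eq_0_iff
  using dot_even[of v] by (subst dot_def) (auto intro!: dvd_sum dvd_mult simp: dot_commute[of _ v])

text \<open>Modulo 2, products with the \<open>e i\<close> read off the coefficients at the
  \<open>f j\<close>; once these vanish, products with the \<open>f i\<close> read off the
  others.\<close>

lemma interleave_independent:
  assumes ee: "\<And>i j. i < 4 \<Longrightarrow> j < 4 \<Longrightarrow> par (gram_form A (e i) (e j)) = 0"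
    and ef: "\<And>i j. i < 4 \<Longrightarrow> j < 4 \<Longrightarrow> par (gram_form A (e i) (f j)) = (if i = j then 1 else 0)"
    and fe: "\<And>i j. i < 4 \<Longrightarrow> j < 4 \<Longrightarrow> par (gram_form A (f i) (e j)) = (if i = j then 1 else 0)"
    and ev: "even_vec 8 (\<lambda>k. \<Sum>i<8. c i * interleave e f i k)"
  shows "even_vec 8 c"
proof -
  have *: "(\<Sum>j<8. par (c j) * par (gram_form A u (interleave e f j))) = 0" for u
    using gram_form_even_right[OF ev, of A u] by (simp add: gram_form_sum_right par_sum)
  have odd: "par (c 1) = 0" "par (c 3) = 0" "par (c 5) = 0" "par (c 7) = 0"
    using *[of "e 0"] *[of "e 1"] *[of "e 2"] *[of "e 3"] ee ef
    by (simp_all add: sum_less_8 interleave_def)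
  have "par (c 0) = 0" "par (c 2) = 0" "par (c 4) = 0" "par (c 6) = 0"
    using *[of "f 0"] *[of "f 1"] *[of "f 2"] *[of "f 3"] fe odd
    by (simp_all add: sum_less_8 interleave_def)
  with odd show ?thesis by (simp add: even_vec_def all_less_8 par_eq_0_iff)
qed

text \<open>Cross terms occur twice by symmetry, so the norm is additive modulo 2.\<close>

lemma par_gram_form_self_sum:
  fixes r :: nat
  assumes "\<And>i j. i < 8 \<Longrightarrow> j < 8 \<Longrightarrow> A i j = A j i"
  shows "par (gram_form A (\<lambda>k. \<Sum>i<r. c i * q i k) (\<lambda>k. \<Sum>i<r. c i * q i k)) = (\<Sum>i<r. par (c i) * par (gram_form A (q i) (q i)))"
proof (induction r)
  case 0
  then show ?case by (simp add: gram_form_expand)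
next
  case (Suc r)
  let ?u = "\<lambda>k. \<Sum>i<r. c i * q i k" and ?v = "\<lambda>k. c r * q r k"
  have add: "gram_form A w (\<lambda>k. ?u k + ?v k) = gram_form A w ?u + gram_form A w ?v"
    "gram_form A (\<lambda>k. ?u k + ?v k) w = gram_form A ?u w + gram_form A ?v w" for w
    unfolding gram_form_expand by (simp_all add: sum.distrib[symmetric] algebra_simps)
  have "gram_form A (\<lambda>k. ?u k + ?v k) (\<lambda>k. ?u k + ?v k) = gram_form A ?u ?u + gram_form A ?u ?v + (gram_form A ?v ?u + gram_form A ?v ?v)"
    unfolding add(2) unfolding add(1) ..
  moreover have "gram_form A ?v ?u = gram_form A ?u ?v" by (rule gram_form_commute) (rule assms)
  moreover have "par (x * x * y) = par x * par y" for x y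
    by (cases "par x") simp_all
  ultimately show ?case using Suc.IH by (simp add: gram_form_scale)
qed

definition G0 :: "nat \<Rightarrow> nat \<Rightarrow> padic2" where
  "G0 i j = (if i div 2 = j div 2 \<and> i \<noteq> j \<or> i = 7 \<and> j = 7 then 1 else 0)"

lemma gram_form_G0: "gram_form G0 u v = b0 u v"
  unfolding gram_form_expand sum_less_8 b0_def G0_def by simp

lemma gram_form_lin4_left: "gram_form A (lin4 c e) v = c 0 * gram_form A (e 0) v + c 1 * gram_form A (e 1) v + c 2 * gram_form A (e 2) v + c 3 * gram_form A (e 3) v"
  unfolding lin4_eq_sum gram_form_sum_left by (simp add: sum_less_4)

lemma gram_form_lin4_right: "gram_form A v (lin4 c e) = c 0 * gram_form A v (e 0) + c 1 * gram_form A v (e 1) + c 2 * gram_form A v (e 2) + c 3 * gram_form A v (e 3)"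
  unfolding lin4_eq_sum gram_form_sum_right by (simp add: sum_less_4)

lemma gram_form_diff_left: "gram_form A (\<lambda>k. u k - v k) w = gram_form A u w - gram_form A v w"
  unfolding gram_form_expand by (simp add: sum_subtractf[symmetric] algebra_simps)

lemma gram_form_diff_right: "gram_form A w (\<lambda>k. u k - v k) = gram_form A w u - gram_form A w v"
  unfolding gram_form_expand by (simp add: sum_subtractf[symmetric] algebra_simps)

section \<open>Normal form modulo 8 of a form with four isotropic vectors and their duals\<close>

locale dual_pair =
  fixes A :: "nat \<Rightarrow> nat \<Rightarrow> padic2" and e f :: "nat \<Rightarrow> nat \<Rightarrow> padic2"
  assumes sym: "\<And>i j. i < 8 \<Longrightarrow> j < 8 \<Longrightarrow> A i j = A j i"
    and ee: "\<And>i j. i < 4 \<Longrightarrow> j < 4 \<Longrightarrow> 8 dvd gram_form A (e i) (e j)"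
    and ef: "\<And>i j. i < 4 \<Longrightarrow> j < 4 \<Longrightarrow> gram_form A (e i) (f j) = (if i = j then 1 else 0)"
begin

lemma fe: "i < 4 \<Longrightarrow> j < 4 \<Longrightarrow> gram_form A (f i) (e j) = (if i = j then 1 else 0)"
  using ef[of j i] gram_form_commute[of A "f i" "e j", OF sym] by auto

lemma ee_8: "8 dvd gram_form A (lin4 c e) (lin4 d e)"
  unfolding gram_form_lin4_left gram_form_lin4_right
  using ee by (auto intro!: dvd_add dvd_mult)

lemma par_ee: "i < 4 \<Longrightarrow> j < 4 \<Longrightarrow> par (gram_form A (e i) (e j)) = 0"
  using ee[of i j] by (auto elim: dvdE)

lemma independent: "even_vec 8 (\<lambda>k. \<Sum>i<8. c i * interleave e f i k) \<Longrightarrow> even_vec 8 c"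
  by (rule interleave_independent[of A e f c]) (simp_all add: par_ee ef fe)

text \<open>The norm is additive modulo 2 and the \<open>e i\<close> have even norm, so a vector of
  norm 1 has some \<open>f p\<close> of odd norm in its expansion.\<close>

lemma odd_index:
  assumes "gram_form A v v = 1"
  shows "\<exists>p<4. \<not> 2 dvd gram_form A (f p) (f p)"
proof -
  obtain L where "\<And>i j. i < 8 \<Longrightarrow> j < 8 \<Longrightarrow> dot (L i) (interleave e f j) = (if i = j then 1 else 0)"
    and L: "\<And>v k. k < 8 \<Longrightarrow> (\<Sum>j<8. dot (L j) v * interleave e f j k) = v k"
    using basis_expansion[of "interleave e f", OF independent] by blast
  let ?c = "\<lambda>j. dot (L j) v"
  have "1 = par (gram_form A (\<lambda>k. \<Sum>j<8. ?c j * interleave e f j k) (\<lambda>k. \<Sum>j<8. ?c j * interleave e f j k))"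
    using assms gram_form_cong[of "\<lambda>k. \<Sum>j<8. ?c j * interleave e f j k" v "\<lambda>k. \<Sum>j<8. ?c j * interleave e f j k" v A, OF L L] by simp
  also have "\<dots> = (\<Sum>j<8. par (?c j) * par (gram_form A (interleave e f j) (interleave e f j)))"
    by (rule par_gram_form_self_sum[OF sym])
  finally have "(\<Sum>j<8. par (?c j) * par (gram_form A (interleave e f j) (interleave e f j))) \<noteq> 0" by simp
  then obtain j where j: "j < 8" "par (gram_form A (interleave e f j) (interleave e f j)) \<noteq> 0"
    by (metis (no_types, lifting) lessThan_iff mult_zero_right sum.neutral)
  have d: "j div 2 < 4" using j(1) by linarith
  have "\<not> even j" using j(2) par_ee[OF d d] by (auto simp: interleave_def)
  then have "\<not> 2 dvd gram_form A (f (j div 2)) (f (j div 2))"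
    using j(2) by (simp add: interleave_def par_eq_0_iff)
  then show ?thesis using d by blast
qed

lemma swap:
  assumes "p < 4"
  defines "\<tau> \<equiv> \<lambda>i. if i = 3 then p else if i = p then 3 else i"
  shows "dual_pair A (\<lambda>i. e (\<tau> i)) (\<lambda>i. f (\<tau> i))"
proof
  have \<tau>: "\<tau> i < 4" if "i < 4" for i using assms that by (simp add: \<tau>_def)
  have inj: "\<tau> i = \<tau> j \<longleftrightarrow> i = j" for i j by (auto simp: \<tau>_def)
  show "8 dvd gram_form A (e (\<tau> i)) (e (\<tau> j))" "gram_form A (e (\<tau> i)) (f (\<tau> j)) = (if i = j then 1 else 0)"
    if "i < 4" "j < 4" for i j
    using ee[OF \<tau> \<tau>] ef[OF \<tau> \<tau>] that inj by simp_all
qed (rule sym)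

text \<open>Moving \<open>e 3\<close> onto the characteristic vector makes all \<open>f i\<close> with \<open>i < 3\<close> even.\<close>

lemma char_pair:
  assumes odd: "\<not> 2 dvd gram_form A (f 3) (f 3)"
  shows "\<exists>e' f'. dual_pair A e' f' \<and> (\<forall>i<3. 2 dvd gram_form A (f' i) (f' i)) \<and> \<not> 2 dvd gram_form A (f' 3) (f' 3)"
proof -
  define \<delta> where "\<delta> i = bit_lift (par (gram_form A (f i) (f i)))" for i
  have \<delta>3: "\<delta> 3 = 1" using odd by (simp add: \<delta>_def bit_lift_def par_eq_0_iff)
  have \<delta>_par: "par (\<delta> i) = par (gram_form A (f i) (f i))" for i by (simp add: \<delta>_def)
  \<comment> \<open>\<open>\<delta>\<close> lists the parities of the norms of the
    \<open>f i\<close>, so the combination \<open>e' 3\<close> has products of these parities with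
    them. \<open>N\<close> is the inverse transpose of \<open>M\<close>, because
    \<open>\<delta> 3 = 1\<close>, and thus keeps the pair dual.\<close>
  define M where "M i = (if i = 3 then \<delta> else (\<lambda>j. if j = i then 1 else 0))" for i :: nat
  define N where "N i = (\<lambda>j. if j = i then 1 else if j = 3 then - \<delta> i else (0::padic2))" for i :: nat
  define e' where "e' i = lin4 (M i) e" for i
  define f' where "f' i = lin4 (N i) f" for i
  have "gram_form A (e' i) (f' j) = (if i = j then 1 else 0)" if "i < 4" "j < 4" for i j
    using less_4_cases[OF that(1)] less_4_cases[OF that(2)] \<delta>3
    unfolding e'_def f'_def gram_form_lin4_left gram_form_lin4_right
    by (elim disjE; simp add: ef M_def N_def)
  then have "dual_pair A e' f'"
    using sym ee_8 by unfold_locales (auto simp: e'_def)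
  moreover have f'3: "gram_form A (f' 3) (f' 3) = gram_form A (f 3) (f 3)"
    unfolding f'_def gram_form_lin4_left gram_form_lin4_right by (simp add: N_def)
  moreover have "2 dvd gram_form A (f' i) (f' i)" if "i < 3" for i
  proof -
    have i: "i = 0 \<or> i = 1 \<or> i = 2" using that by linarith
    have "gram_form A (f' i) (f' i) = gram_form A (f i) (f i) - \<delta> i * gram_form A (f i) (f 3) - \<delta> i * (gram_form A (f 3) (f i) - \<delta> i * gram_form A (f 3) (f 3))"
      using i unfolding f'_def gram_form_lin4_left gram_form_lin4_right
      by (elim disjE; simp add: N_def algebra_simps)
    moreover have "gram_form A (f 3) (f i) = gram_form A (f i) (f 3)" by (rule gram_form_commute) (rule sym)
    moreover have "par (gram_form A (f 3) (f 3)) = 1" using odd by (simp add: par_eq_0_iff[symmetric])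
    ultimately have "par (gram_form A (f' i) (f' i)) = par (\<delta> i) + par (\<delta> i) * par (\<delta> i)"
      by (simp add: \<delta>_par[symmetric] distrib_left ac_simps)
    also have "\<dots> = 0" by (cases "par (\<delta> i)") simp_all
    finally show ?thesis by (simp add: par_eq_0_iff)
  qed
  ultimately show ?thesis using odd by (intro exI[of _ e'] exI[of _ f']) simp
qed

text \<open>Subtracting combinations of the \<open>e k\<close> from the \<open>f i\<close> alters
  their products at will, with an error divisible by 8. The triangular \<open>\<mu>\<close> cancels
  each mixed product once and each norm by twice its half; only the odd unit in the norm of
  \<open>f 3\<close> remains.\<close>

lemma normal_pair:
  assumes even: "\<forall>i<3. 2 dvd gram_form A (f i) (f i)" and odd: "\<not> 2 dvd gram_form A (f 3) (f 3)"
  shows "\<exists>g. (\<forall>i<4. \<forall>j<4. 8 dvd gram_form A (e i) (g j) - (if i = j then 1 else 0)) \<and>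
    (\<forall>i<4. \<forall>j<4. 8 dvd gram_form A (g i) (g j) - (if i = 3 \<and> j = 3 then 1 else 0))"
proof -
  have "\<exists>h. gram_form A (f i) (f i) = 2 * h + (if i = 3 then 1 else 0)" if "i < 4" for i
  proof (cases "i = 3")
    case True
    have "2 dvd gram_form A (f 3) (f 3) - 1" using odd by (simp add: even_diff_iff)
    then show ?thesis using True by (auto elim!: dvdE simp: algebra_simps)
  next
    case False
    then have "i < 3" using that by simp
    then show ?thesis using even False by (auto elim!: dvdE)
  qed
  then obtain h where h: "\<And>i. i < 4 \<Longrightarrow> gram_form A (f i) (f i) = 2 * h i + (if i = 3 then 1 else 0)" by metis
  define \<mu> where "\<mu> i j = (if i < j then gram_form A (f i) (f j) else if i = j then h i else 0)" for i j
  define g where "g i k = f i k - lin4 (\<mu> i) e k" for i k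
  have e_g: "gram_form A (e i) (g j) - (if i = j then 1 else 0) = - gram_form A (lin4 (\<lambda>k. if k = i then 1 else 0) e) (lin4 (\<mu> j) e)"
    if "i < 4" "j < 4" for i j
  proof -
    have "lin4 (\<lambda>k. if k = i then 1 else 0) e = e i"
      using less_4_cases[OF that(1)] by (auto simp: lin4_def fun_eq_iff)
    then show ?thesis using ef that by (simp add: g_def[abs_def] gram_form_diff_right)
  qed
  have f_lin: "gram_form A (f i) (lin4 c e) = c i" "gram_form A (lin4 c e) (f i) = c i" if "i < 4" for i c
    using less_4_cases[OF that] unfolding gram_form_lin4_left gram_form_lin4_right
    by (elim disjE; simp add: ef fe)+
  have g_g: "gram_form A (g i) (g j) - (if i = 3 \<and> j = 3 then 1 else 0) = gram_form A (lin4 (\<mu> i) e) (lin4 (\<mu> j) e)"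
    if "i < 4" "j < 4" for i j
  proof -
    have "gram_form A (g i) (g j) = gram_form A (f i) (f j) - \<mu> i j - \<mu> j i + gram_form A (lin4 (\<mu> i) e) (lin4 (\<mu> j) e)"
      unfolding g_def[abs_def] gram_form_diff_left gram_form_diff_right using f_lin that by (simp add: algebra_simps)
    moreover have "gram_form A (f i) (f j) - \<mu> i j - \<mu> j i = (if i = 3 \<and> j = 3 then 1 else 0)"
      using h[OF that(1)] gram_form_commute[of A "f i" "f j", OF sym] by (auto simp: \<mu>_def)
    ultimately show ?thesis by simp
  qed
  show ?thesis
    by (rule exI[of _ g]) (auto simp: e_g g_g ee_8)
qed

end

text \<open>Passing from a maximal form to a unimodular one: a nonzero vector \<open>lin4 c e\<close> in the radical
  modulo 2 would have norm divisible by 4, against maximality.\<close>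

lemma dual_pair_exists:
  assumes sym: "\<And>i j. i < 8 \<Longrightarrow> j < 8 \<Longrightarrow> A i j = A j i"
    and maximal: "\<And>y. even_vec 8 (mat_app A y) \<Longrightarrow> 4 dvd gram_form A y y \<Longrightarrow> even_vec 8 y"
    and ee: "\<And>i j. i < 4 \<Longrightarrow> j < 4 \<Longrightarrow> 8 dvd gram_form A (e i) (e j)"
    and dual: "\<And>i j. i < 4 \<Longrightarrow> j < 4 \<Longrightarrow> dot (\<epsilon> i) (e j) = (if i = j then 1 else 0)"
  shows "\<exists>f. dual_pair A e f"
proof -
  have "even_vec 4 c" if ev: "even_vec 8 (\<lambda>k. \<Sum>i<4. c i * mat_app A (e i) k)" for c
  proof -
    let ?y = "\<lambda>k. \<Sum>i<4. c i * e i k"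
    have eight: "8 dvd gram_form A ?y ?y"
      unfolding gram_form_sum_left unfolding gram_form_sum_right using ee by (intro dvd_sum dvd_mult) auto
    have "(4::padic2) dvd 8" by (rule dvdI[of _ _ 2]) simp
    then have "4 dvd gram_form A ?y ?y" using eight by (rule dvd_trans)
    moreover have "even_vec 8 (mat_app A ?y)" using ev by (simp add: even_vec_def mat_app_sum)
    ultimately have "even_vec 8 ?y" using maximal[of ?y] by simp
    then show ?thesis using dual_even[where r = 4 and \<epsilon> = \<epsilon> and e = e and c = c] dual by blast
  qed
  from dual_family[where r = 4 and h = "\<lambda>i. mat_app A (e i)", OF this]
  obtain f where f: "\<forall>i<4. \<forall>j<4. dot (f i) (mat_app A (e j)) = (if i = j then 1 else 0)" by blast
  have "gram_form A (e i) (f j) = (if i = j then 1 else 0)" if "i < 4" "j < 4" for i j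
    using f that gram_form_commute[of A "e i" "f j", OF sym] by (auto simp: gram_form_def)
  then show ?thesis
    using sym ee by (intro exI[of _ f]) unfold_locales
qed

lemma char_basis:
  assumes "dual_pair A e f" "gram_form A v v = 1"
  obtains q where "\<And>c. even_vec 8 (\<lambda>k. \<Sum>i<8. c i * q i k) \<Longrightarrow> even_vec 8 c"
    "\<And>i j. i < 8 \<Longrightarrow> j < 8 \<Longrightarrow> 8 dvd gram_form A (q i) (q j) - G0 i j"
proof -
  interpret dual_pair A e f by fact
  obtain p where p: "p < 4" "\<not> 2 dvd gram_form A (f p) (f p)" using odd_index[OF assms(2)] by blast
  interpret s: dual_pair A "\<lambda>i. e (if i = 3 then p else if i = p then 3 else i)" "\<lambda>i. f (if i = 3 then p else if i = p then 3 else i)"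
    by (rule swap[OF p(1)])
  obtain e' f' where pair: "dual_pair A e' f'" and e'f': "\<forall>i<3. 2 dvd gram_form A (f' i) (f' i)" "\<not> 2 dvd gram_form A (f' 3) (f' 3)"
    using s.char_pair p(2) by auto
  interpret n: dual_pair A e' f' by (rule pair)
  obtain g where eg: "\<forall>i<4. \<forall>j<4. 8 dvd gram_form A (e' i) (g j) - (if i = j then 1 else 0)"
    and gg: "\<forall>i<4. \<forall>j<4. 8 dvd gram_form A (g i) (g j) - (if i = 3 \<and> j = 3 then 1 else 0)"
    using n.normal_pair[OF e'f'] by blast
  have ge: "8 dvd gram_form A (g i) (e' j) - (if i = j then 1 else 0)" if "i < 4" "j < 4" for i j
    using eg that gram_form_commute[of A "g i" "e' j", OF sym] by (auto split: if_splits)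
  have par_eqI: "par x = par y" if "8 dvd x - y" for x y
  proof -
    from that obtain z where "x - y = 8 * z" by blast
    then have "par (x - y) = 0" by simp
    then show ?thesis by (cases "par x"; cases "par y"; simp)
  qed
  show thesis
  proof (rule that[of "interleave e' g"])
    show "even_vec 8 c" if "even_vec 8 (\<lambda>k. \<Sum>i<8. c i * interleave e' g i k)" for c
    proof (rule interleave_independent[OF _ _ _ that])
      show "par (gram_form A (e' i) (e' j)) = 0" if "i < 4" "j < 4" for i j using n.par_ee that .
      show "par (gram_form A (e' i) (g j)) = (if i = j then 1 else 0)" if "i < 4" "j < 4" for i j
        using par_eqI[OF eg[rule_format, OF that]] by simp
      show "par (gram_form A (g i) (e' j)) = (if i = j then 1 else 0)" if "i < 4" "j < 4" for i j
        using par_eqI[OF ge[OF that]] by simp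
    qed
    show "8 dvd gram_form A (interleave e' g i) (interleave e' g j) - G0 i j" if "i < 8" "j < 8" for i j
    proof -
      have d: "i div 2 < 4" "j div 2 < 4" using that by linarith+
      have i7: "i = 7 \<longleftrightarrow> odd i \<and> i div 2 = 3" "j = 7 \<longleftrightarrow> odd j \<and> j div 2 = 3" by presburger+
      have ij: "i = j \<longleftrightarrow> (even i \<longleftrightarrow> even j) \<and> i div 2 = j div 2" by presburger
      show ?thesis
        using n.ee[OF d] eg[rule_format, OF d] ge[OF d] gg[rule_format, OF d]
        unfolding interleave_def G0_def i7 ij
        by (cases "even i"; cases "even j"; auto split: if_splits)
    qed
  qed
qed

section \<open>Frames from matrices, change of basis and the minimal exponent\<close>

lemma mat_app_mat:
  assumes "A \<in> carrier_mat 8 8" "k < 8"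
  shows "mat_app (\<lambda>i j. A $$ (i, j)) v k = (A *\<^sub>v vec 8 v) $ k"
  using assms by (simp add: mat_app_def dot_def scalar_prod_def lessThan_atLeast0)

lemma vec_mat_app:
  assumes "A \<in> carrier_mat 8 8"
  shows "vec 8 (mat_app (\<lambda>i j. A $$ (i, j)) v) = A *\<^sub>v vec 8 v"
  by (rule eq_vecI) (use mat_app_mat[OF assms] assms in auto)

lemma dot_vec: "dot u v = vec 8 u \<bullet> vec 8 v"
  by (simp add: dot_def scalar_prod_def lessThan_atLeast0)

lemma gram_form_mat:
  assumes "A \<in> carrier_mat 8 8"
  shows "gram_form (\<lambda>i j. A $$ (i, j)) u v = vec 8 u \<bullet> (A *\<^sub>v vec 8 v)"
  unfolding gram_form_def dot_vec vec_mat_app[OF assms] ..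

text \<open>\<open>S\<close> is the adjugate of \<open>T\<close> divided by the unit part of the
  determinant, so that the products are pure powers of 2.\<close>

lemma maximal_frame:
  assumes sym: "\<forall>i<8. \<forall>j<8. G i j = G j i"
    and nondeg: "\<forall>x. (\<forall>i<8. (\<Sum>j<8. G i j * x j) = 0) \<longrightarrow> (\<forall>j<8. x j = 0)"
  obtains A T S s where "frame G A T S s"
    "\<And>y. even_vec 8 (mat_app A y) \<Longrightarrow> 4 dvd gram_form A y y \<Longrightarrow> even_vec 8 y"
proof -
  define M where "M = mat 8 8 (\<lambda>(i, j). G i j)"
  have M: "M \<in> carrier_mat 8 8" by (simp add: M_def)
  have MG: "gram_form G u v = gram_form (\<lambda>i j. M $$ (i, j)) u v" for u v
    unfolding gram_form_expand by (simp add: M_def)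
  have MT: "transpose_mat M = M" using sym by (intro eq_matI) (auto simp: M_def)
  have det_M: "det M \<noteq> 0"
  proof
    assume "det M = 0"
    then obtain v where v: "v \<in> carrier_vec 8" "v \<noteq> 0\<^sub>v 8" "M *\<^sub>v v = 0\<^sub>v 8"
      using det_0_iff_vec_prod_zero[OF M] by blast
    have "(\<Sum>j<8. G i j * v $ j) = 0" if i: "i < 8" for i
    proof -
      have "(M *\<^sub>v v) $ i = (\<Sum>j<8. G i j * v $ j)"
        using i v(1) by (simp add: M_def scalar_prod_def lessThan_atLeast0)
      then show ?thesis using v(3) i by simp
    qed
    then have "\<forall>j<8. v $ j = 0" using nondeg[rule_format, of "\<lambda>j. v $ j"] by blast
    then have "v = 0\<^sub>v 8" using v(1) by (intro eq_vecI) auto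
    then show False using v(2) by simp
  qed
  obtain A T where A: "A \<in> carrier_mat 8 8" and T: "T \<in> carrier_mat 8 8" and AT: "transpose_mat A = A"
    and eq: "M = transpose_mat T * A * T" and max: "maximal_form 8 A"
    using maximal_overlattice[OF M MT det_M] by blast
  have "det M = det T * det A * det T"
    unfolding eq using A T by (simp add: det_mult[of _ 8] det_transpose)
  then have "det T \<noteq> 0" using det_M by auto
  then obtain s u where s: "det T = 2 ^ s * u" "\<not> 2 dvd u" using padic2_decomp by blast
  obtain u' where u': "u * u' = 1" using odd_inverse[OF s(2)] .
  define S where "S = u' \<cdot>\<^sub>m adj_mat T"
  note adj = adj_mat[OF T]
  have S: "S \<in> carrier_mat 8 8" using adj by (simp add: S_def)
  have u'_det: "u' * det T = 2 ^ s" unfolding s(1) using u' by (simp add: ac_simps)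
  have TS: "T * S = 2 ^ s \<cdot>\<^sub>m 1\<^sub>m 8"
  proof -
    have "T * S = u' \<cdot>\<^sub>m (T * adj_mat T)" unfolding S_def using T adj(1) by (rule mult_smult_distrib)
    then show ?thesis unfolding adj(2) using u'_det by (intro eq_matI) auto
  qed
  have ST: "S * T = 2 ^ s \<cdot>\<^sub>m 1\<^sub>m 8"
  proof -
    have "S * T = u' \<cdot>\<^sub>m (adj_mat T * T)" unfolding S_def using adj(1) T by (rule mult_smult_assoc_mat)
    then show ?thesis unfolding adj(3) using u'_det by (intro eq_matI) auto
  qed
  let ?f = "\<lambda>B i j. B $$ (i, j)"
  have comp: "mat_app (?f B) (mat_app (?f C) v) i = 2 ^ s * v i"
    if "B \<in> carrier_mat 8 8" "C \<in> carrier_mat 8 8" "B * C = 2 ^ s \<cdot>\<^sub>m 1\<^sub>m 8" "i < 8" for B C :: "padic2 mat" and v i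
  proof -
    have "mat_app (?f B) (mat_app (?f C) v) i = (B *\<^sub>v (C *\<^sub>v vec 8 v)) $ i"
      unfolding mat_app_mat[OF that(1,4)] vec_mat_app[OF that(2)] ..
    also have "B *\<^sub>v (C *\<^sub>v vec 8 v) = (B * C) *\<^sub>v vec 8 v"
      by (rule assoc_mult_mat_vec[OF that(1,2), symmetric]) simp
    also have "\<dots> = 2 ^ s \<cdot>\<^sub>v vec 8 v" unfolding that(3) by auto
    finally show ?thesis using that(4) by simp
  qed
  have gram: "gram_form (?f A) (mat_app (?f T) u) (mat_app (?f T) v) = gram_form G u v" for u v
  proof -
    have "vec 8 u \<bullet> (M *\<^sub>v vec 8 v) = vec 8 u \<bullet> (transpose_mat T *\<^sub>v (A *\<^sub>v (T *\<^sub>v vec 8 v)))"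
      unfolding eq using A T by (simp add: assoc_mult_mat_vec[of _ 8 8 _ 8])
    also have "\<dots> = (T *\<^sub>v vec 8 u) \<bullet> (A *\<^sub>v (T *\<^sub>v vec 8 v))"
      using transpose_vec_mult_scalar[OF T, of "vec 8 u" "A *\<^sub>v (T *\<^sub>v vec 8 v)"] A T
      by (simp add: comm_scalar_prod[of _ 8])
    finally show ?thesis unfolding MG gram_form_mat[OF M] gram_form_mat[OF A] vec_mat_app[OF T] by simp
  qed
  have "A $$ (i, j) = A $$ (j, i)" if "i < 8" "j < 8" for i j
    using AT A that by (metis carrier_matD index_transpose_mat(1))
  then have "frame G (?f A) (?f T) (?f S) s"
    unfolding frame_def using comp[OF T S TS] comp[OF S T ST] gram by simp
  moreover have "even_vec 8 y" if "even_vec 8 (mat_app (?f A) y)" "4 dvd gram_form (?f A) y y" for y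
  proof -
    have "\<forall>r<8. 2 dvd (A *\<^sub>v vec 8 y) $ r"
      using that(1) A by (simp add: even_vec_def mat_app_mat[OF A])
    moreover have "4 dvd vec 8 y \<bullet> (A *\<^sub>v vec 8 y)"
      using that(2) by (simp only: gram_form_mat[OF A])
    ultimately have "\<forall>r<8. 2 dvd vec 8 y $ r"
      using max unfolding maximal_form_def by (metis vec_carrier)
    then show ?thesis by (simp add: even_vec_def)
  qed
  ultimately show thesis by (rule that)
qed

lemma frame_change_basis:
  assumes fr: "frame G A T S s"
    and indep: "\<And>c. even_vec 8 (\<lambda>k. \<Sum>i<8. c i * q i k) \<Longrightarrow> even_vec 8 c"
  shows "\<exists>T' S'. frame G (\<lambda>i j. gram_form A (q i) (q j)) T' S' s"
proof -
  obtain L where L1: "\<And>i j. i < 8 \<Longrightarrow> j < 8 \<Longrightarrow> dot (L i) (q j) = (if i = j then 1 else 0)"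
    and L2: "\<And>v k. k < 8 \<Longrightarrow> (\<Sum>j<8. dot (L j) v * q j k) = v k"
    using basis_expansion[OF indep] by blast
  define T' where "T' j k = (\<Sum>l<8. L j l * T l k)" for j k
  define S' where "S' k j = mat_app S (q j) k" for k j
  define Q where "Q u k = (\<Sum>j<8. u j * q j k)" for u :: "nat \<Rightarrow> padic2" and k :: nat
  have T': "mat_app T' v j = dot (L j) (mat_app T v)" for v j
    unfolding mat_app_def[of T'] T'_def dot_sum_left by (simp add: dot_def[of "L j"] mat_app_def)
  have S': "mat_app S' u k = mat_app S (Q u) k" for u k
    unfolding Q_def[abs_def] mat_app_sum by (simp add: mat_app_def[of S'] dot_def S'_def mult.commute)
  have QT: "Q (mat_app T' v) k = mat_app T v k" if "k < 8" for v k
    unfolding Q_def T' using L2[OF that] .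
  have bilQ: "gram_form (\<lambda>i j. gram_form A (q i) (q j)) u v = gram_form A (Q u) (Q v)" for u v
    unfolding Q_def[abs_def] gram_form_sum_left unfolding gram_form_sum_right gram_form_expand[of "\<lambda>i j. gram_form A (q i) (q j)"]
    by (simp add: sum_distrib_left ac_simps)
  have "mat_app T' (mat_app S' u) i = 2 ^ s * u i" if i: "i < 8" for u i
  proof -
    have "dot (L i) (mat_app T (mat_app S' u)) = dot (L i) (\<lambda>k. 2 ^ s * Q u k)"
      by (rule dot_cong) (use fr in \<open>auto simp: S'[abs_def] frame_def\<close>)
    also have "\<dots> = 2 ^ s * (\<Sum>j<8. u j * (if i = j then 1 else 0))"
      unfolding dot_scale unfolding Q_def[abs_def] dot_sum using L1 i by simp
    finally show ?thesis unfolding T' using i by (simp add: if_distrib[of "\<lambda>x. _ * x"] cong: if_cong)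
  qed
  moreover have "mat_app S' (mat_app T' v) i = 2 ^ s * v i" if i: "i < 8" for v i
  proof -
    have "mat_app S (Q (mat_app T' v)) i = mat_app S (mat_app T v) i" by (rule mat_app_cong) (rule QT)
    then show ?thesis unfolding S' using fr i by (simp add: frame_def)
  qed
  moreover have "gram_form (\<lambda>i j. gram_form A (q i) (q j)) (mat_app T' u) (mat_app T' v) = gram_form G u v" for u v
  proof -
    have "gram_form A (Q (mat_app T' u)) (Q (mat_app T' v)) = gram_form A (mat_app T u) (mat_app T v)"
      by (rule gram_form_cong) (auto simp: QT)
    then show ?thesis unfolding bilQ using fr by (simp add: frame_def)
  qed
  moreover have "gram_form A (q i) (q j) = gram_form A (q j) (q i)" for i j
    using fr by (intro gram_form_commute) (simp add: frame_def)
  ultimately show ?thesis unfolding frame_def by blast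
qed

lemma mat_app_even_right: "even_vec 8 v \<Longrightarrow> 2 dvd mat_app A v i"
  using dot_even by (metis mat_app_def dot_commute)

text \<open>At the least exponent \<open>S\<close> cannot be halved, so some entry is odd. At
  exponent 0 it is invertible, so column 6 cannot be even.\<close>

lemma minimal_frame:
  assumes fr: "frame G A T S s"
  obtains S' t where "frame G A T S' t" "\<exists>k<8. \<exists>j<8. \<not> 2 dvd S' k j" "t = 0 \<Longrightarrow> \<exists>k<8. \<not> 2 dvd S' k 6"
proof -
  define t where "t = (LEAST t. \<exists>S. frame G A T S t)"
  have "\<exists>S. frame G A T S t" unfolding t_def by (rule LeastI) (use fr in blast)
  then obtain S' where S': "frame G A T S' t" by blast
  have min: "\<not> frame G A T S'' t'" if "t' < t" for S'' t'
    using not_less_Least[of t' "\<lambda>t. \<exists>S. frame G A T S t"] that unfolding t_def by blast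
  have zero: "\<exists>k<8. \<not> 2 dvd S' k 6" if "t = 0"
  proof (rule ccontr)
    assume "\<not> ?thesis"
    then have "even_vec 8 (mat_app S' (\<lambda>k. if k = 6 then 1 else 0))"
      using dot_unit[of 6] by (simp add: even_vec_def mat_app_def dot_commute[of "S' _"])
    then have "2 dvd mat_app T (mat_app S' (\<lambda>k. if k = 6 then 1 else 0)) 6" by (rule mat_app_even_right)
    then show False using S' that by (simp add: frame_def)
  qed
  have "\<exists>k<8. \<exists>j<8. \<not> 2 dvd S' k j"
  proof (rule ccontr)
    assume neg: "\<not> ?thesis"
    with zero have "t \<noteq> 0" by force
    then obtain t' where t': "t = Suc t'" by (cases t) auto
    have "\<forall>k j. \<exists>x. k < 8 \<and> j < 8 \<longrightarrow> S' k j = 2 * x" using neg unfolding dvd_def by metis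
    then obtain R where R: "\<And>k j. k < 8 \<Longrightarrow> j < 8 \<Longrightarrow> S' k j = 2 * R k j" by metis
    have S'R: "mat_app S' v i = 2 * mat_app R v i" if "i < 8" for v i
      using R[OF that] by (simp add: mat_app_def dot_def sum_distrib_left mult.assoc)
    have "mat_app T (mat_app R v) i = 2 ^ t' * v i" if i: "i < 8" for v i
    proof -
      have "2 ^ 1 * mat_app T (mat_app R v) i = mat_app T (\<lambda>k. 2 * mat_app R v k) i" by (simp add: mat_app_scale)
      also have "\<dots> = mat_app T (mat_app S' v) i" by (rule mat_app_cong) (simp add: S'R)
      also have "\<dots> = 2 ^ 1 * (2 ^ t' * v i)" using S' i t' by (simp add: frame_def)
      finally show ?thesis by (rule pow2_mult_cancel)
    qed
    moreover have "mat_app R (mat_app T v) i = 2 ^ t' * v i" if i: "i < 8" for v i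
    proof -
      have "2 ^ 1 * mat_app R (mat_app T v) i = mat_app S' (mat_app T v) i" using S'R[OF i] by simp
      also have "\<dots> = 2 ^ 1 * (2 ^ t' * v i)" using S' i t' by (simp add: frame_def)
      finally show ?thesis by (rule pow2_mult_cancel)
    qed
    ultimately have "frame G A T R t'" using S' by (simp add: frame_def)
    then show False using min t' by blast
  qed
  with S' zero that show thesis by blast
qed

lemma char_latticeI:
  assumes sym: "\<And>i j. i < 8 \<Longrightarrow> j < 8 \<Longrightarrow> A i j = A j i"
    and A: "\<And>i j. i < 8 \<Longrightarrow> j < 8 \<Longrightarrow> 8 dvd A i j - G0 i j"
  shows "char_lattice (gram_form A)"
proof
  show "gram_form A u (\<lambda>k. c * v k + d * w k) = c * gram_form A u v + d * gram_form A u w" for u v w c d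
    unfolding gram_form_expand by (simp add: sum.distrib[symmetric] sum_distrib_left algebra_simps)
  show "gram_form A u v = gram_form A v u" for u v by (rule gram_form_commute) (rule sym)
  show "8 dvd gram_form A u v - b0 u v" for u v
  proof -
    have "gram_form A u v - b0 u v = (\<Sum>i<8. \<Sum>j<8. u i * (A i j - G0 i j) * v j)"
      unfolding gram_form_G0[symmetric] gram_form_expand by (simp add: sum_subtractf[symmetric] algebra_simps)
    also have "8 dvd \<dots>" using A by (intro dvd_sum) auto
    finally show ?thesis .
  qed
qed

lemma no_universal_form8:
  assumes lat: "z2_lattice 8 G"
    and univ: "\<And>GL. z2_lattice 4 GL \<Longrightarrow> \<exists>x Y. prim_rep8 G GL x Y"
  shows False
proof -
  obtain A T S s where fr: "frame G A T S s"
    and maximal: "\<And>y. even_vec 8 (mat_app A y) \<Longrightarrow> 4 dvd gram_form A y y \<Longrightarrow> even_vec 8 y"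
    using maximal_frame[of G] lat unfolding z2_lattice_def by blast
  have sym: "\<And>i j. i < 8 \<Longrightarrow> j < 8 \<Longrightarrow> A i j = A j i" using fr by (simp add: frame_def)
  \<comment> \<open>Passing to the saturation divides the Gram matrix by 4^s; three further factors
    2 leave it divisible by 8.\<close>
  let ?I = "\<lambda>i j. if i = j then 2 ^ (2 * s + 3) else (0::padic2)"
  have "z2_lattice 4 ?I" by (rule z2_lattice_scaled_one) simp
  then obtain x Y where pr: "prim_rep8 G ?I x Y" using univ by blast
  obtain e a \<epsilon> :: "nat \<Rightarrow> nat \<Rightarrow> padic2" where
    dual: "\<And>i j. i < 4 \<Longrightarrow> j < 4 \<Longrightarrow> dot (\<epsilon> i) (e j) = (if i = j then 1 else 0)" and
    gram: "\<And>i j. i < 4 \<Longrightarrow> j < 4 \<Longrightarrow> 4 ^ s * gram_form A (e i) (e j) = form4 ?I (a i) (a j)"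
    by (rule saturation[OF fr pr]) blast
  have "8 dvd gram_form A (e i) (e j)" if "i < 4" "j < 4" for i j
  proof -
    have "form4 ?I (a i) (a j) = (\<Sum>k<4. a i k * 2 ^ (2 * s + 3) * a j k)"
      unfolding form4_def
      by (simp add: if_distrib[of "\<lambda>x. _ * x"] if_distrib[of "\<lambda>x. x * _"] cong: if_cong)
    also have "\<dots> = 2 ^ (2 * s) * (8 * (\<Sum>k<4. a i k * a j k))"
      by (simp add: power_add sum_distrib_left ac_simps)
    finally have "2 ^ (2 * s) * gram_form A (e i) (e j) = 2 ^ (2 * s) * (8 * (\<Sum>k<4. a i k * a j k))"
      using gram[OF that] by (simp add: power_mult)
    then have "gram_form A (e i) (e j) = 8 * (\<Sum>k<4. a i k * a j k)" by (rule pow2_mult_cancel)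
    then show ?thesis by simp
  qed
  from dual_pair_exists[OF sym maximal this dual] obtain f where f: "dual_pair A e f" by blast
  \<comment> \<open>A vector of norm 1 makes the overlattice odd.\<close>
  obtain x' Y' where "prim_rep8 G (\<lambda>i j. if i = j then 1 else 0) x' Y'" using univ[OF z2_lattice_scaled_one[OF one_neq_zero]] by blast
  then have "gram_form A (mat_app T (x' 0)) (mat_app T (x' 0)) = 1" using fr by (simp add: frame_def prim_rep8_def)
  note norm_1 = this
  obtain q where indep: "\<And>c. even_vec 8 (\<lambda>k. \<Sum>i<8. c i * q i k) \<Longrightarrow> even_vec 8 c"
    and q: "\<And>i j. i < 8 \<Longrightarrow> j < 8 \<Longrightarrow> 8 dvd gram_form A (q i) (q j) - G0 i j"
    by (rule char_basis[OF f norm_1]) blast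
  define B where "B i j = gram_form A (q i) (q j)" for i j
  obtain T1 S1 where "frame G B T1 S1 s"
    using frame_change_basis[OF fr indep] unfolding B_def[abs_def] by blast
  then obtain S2 t where fr2: "frame G B T1 S2 t" and odd: "\<exists>k<8. \<exists>j<8. \<not> 2 dvd S2 k j"
    and t0: "t = 0 \<Longrightarrow> \<exists>k<8. \<not> 2 dvd S2 k 6"
    using minimal_frame by blast
  have symB: "\<And>i j. i < 8 \<Longrightarrow> j < 8 \<Longrightarrow> B i j = B j i" using fr2 by (simp add: frame_def)
  interpret char_lattice "gram_form B"
    by (rule char_latticeI) (use symB q in \<open>simp_all add: B_def\<close>)
  interpret universal_char_lattice "gram_form B" S2 t
  proof
    show "\<exists>k<8. \<not> 2 dvd S2 k 6" if "t = 0" using t0 that .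
    show "\<exists>k<8. \<exists>j<8. \<not> 2 dvd S2 k j" by (rule odd)
    fix GL assume "z2_lattice 4 GL"
    then obtain x Y where pr: "prim_rep8 G GL x Y" using univ by blast
    show "\<exists>n. (\<forall>i<4. \<forall>k<8. 2 ^ t dvd dot (S2 k) (n i)) \<and> (\<forall>i<4. \<forall>j<4. gram_form B (n i) (n j) = GL i j)"
      using fr2 pr unfolding frame_def prim_rep8_def
      by (intro exI[of _ "\<lambda>i. mat_app T1 (x i)"]) (simp add: mat_app_def[of S2, symmetric])
    obtain e a \<epsilon> :: "nat \<Rightarrow> nat \<Rightarrow> padic2" where
      dual: "\<And>i j. i < 4 \<Longrightarrow> j < 4 \<Longrightarrow> dot (\<epsilon> i) (e j) = (if i = j then 1 else 0)" and
      gram: "\<And>i j. i < 4 \<Longrightarrow> j < 4 \<Longrightarrow> 4 ^ t * gram_form B (e i) (e j) = form4 GL (a i) (a j)" and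
      S_even: "\<And>c. even_vec 4 (lin4 c a) \<longleftrightarrow> even_vec 8 (mat_app S2 (lin4 c e))"
      by (rule saturation[OF fr2 pr]) blast
    have "even_vec 4 c" if "even_vec 8 (lin4 c e)" for c
      using dual_even[where r = 4 and \<epsilon> = \<epsilon> and e = e and c = c] dual that unfolding lin4_eq_sum by blast
    then show "\<exists>e a. (\<forall>c. even_vec 8 (lin4 c e) \<longrightarrow> even_vec 4 c) \<and>
      (\<forall>i<4. \<forall>j<4. 4 ^ t * gram_form B (e i) (e j) = form4 GL (a i) (a j)) \<and>
      (\<forall>c. even_vec 4 (lin4 c a) \<longleftrightarrow> (\<forall>k<8. 2 dvd dot (S2 k) (lin4 c e)))"
      using gram S_even
      by (intro exI[of _ e] exI[of _ a]) (simp add: even_vec_def[of 8 "mat_app _ _"] mat_app_def)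
  qed
  show False by (rule contradiction)
qed

section \<open>Ranks at most eight and rank nine\<close>

definition pad_one :: "nat \<Rightarrow> (nat \<Rightarrow> nat \<Rightarrow> padic2) \<Rightarrow> nat \<Rightarrow> nat \<Rightarrow> padic2" where
  "pad_one m G i j = (if i < m \<and> j < m then G i j else if i = j then 1 else 0)"

lemma sum_pad:
  assumes "m \<le> n"
  shows "(\<Sum>i<n. if i < m then f i else 0) = (\<Sum>i<m. f (i::nat) :: padic2)"
  using assms by (subst sum.inter_filter[symmetric]) (auto intro!: sum.cong)

lemma pad_one_lattice:
  assumes "z2_lattice m G" "m \<le> 8"
  shows "z2_lattice 8 (pad_one m G)"
  unfolding z2_lattice_def
proof (intro conjI allI impI)
  show "pad_one m G i j = pad_one m G j i" for i j
    using assms(1) by (auto simp: pad_one_def z2_lattice_def)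
  fix x :: "nat \<Rightarrow> padic2" and j :: nat
  assume *: "\<forall>i<8. (\<Sum>j<8. pad_one m G i j * x j) = 0" and j: "j < 8"
  have "(\<Sum>j<8. pad_one m G i j * x j) = (\<Sum>j<m. G i j * x j)" if "i < m" for i
  proof -
    have "(\<Sum>j<8. pad_one m G i j * x j) = (\<Sum>j<8. if j < m then G i j * x j else 0)"
      using that by (intro sum.cong) (auto simp: pad_one_def)
    then show ?thesis using sum_pad[OF assms(2)] by simp
  qed
  then have "\<forall>i<m. (\<Sum>j<m. G i j * x j) = 0" using * assms(2) by simp
  then have small: "\<forall>j<m. x j = 0" using assms(1) by (simp add: z2_lattice_def)
  show "x j = 0"
  proof (cases "j < m")
    case False
    have "(\<Sum>k<8. pad_one m G j k * x k) = (\<Sum>k<8. (if j = k then 1 else 0) * x k)"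
      using False by (intro sum.cong) (auto simp: pad_one_def)
    also have "\<dots> = x j" using j by (simp add: if_distrib[of "\<lambda>x. x * _"] cong: if_cong)
    finally show ?thesis using * j by simp
  qed (use small in simp)
qed

lemma z2_submodule_sum:
  assumes N: "z2_submodule m N" and u: "\<And>p. p \<in> I \<Longrightarrow> u p \<in> N"
  shows "(\<lambda>i. \<Sum>p\<in>I. c p * u p i) \<in> N"
  using u
proof (induction I rule: infinite_finite_induct)
  case (insert p I)
  have "(\<lambda>i. c p * u p i) \<in> N" using N insert.prems by (simp add: z2_submodule_def)
  moreover have "(\<lambda>i. \<Sum>p\<in>I. c p * u p i) \<in> N" using insert by simp
  ultimately have "(\<lambda>i. c p * u p i + (\<Sum>p\<in>I. c p * u p i)) \<in> N"
    using N[unfolded z2_submodule_def, THEN conjunct2, THEN conjunct2, THEN conjunct1, rule_format] by fast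
  then show ?case using insert by simp
qed (use N in \<open>simp_all add: z2_submodule_def\<close>)

text \<open>A kernel vector of \<open>X\<close> lies in the radical of the represented form, which
  is trivial.\<close>

lemma lin_map_inj:
  assumes GL: "z2_lattice n GL" and X: "is_representation n GL m G X" and 0: "lin_map m n X d = (\<lambda>_. 0)"
  shows "\<forall>a<n. d a = 0"
proof -
  have Xd: "(\<Sum>b<n. X k b * d b) = 0" if "k < m" for k
    using fun_cong[OF 0, of k] that by (simp add: lin_map_def)
  have "(\<Sum>b<n. GL a b * d b) = 0" if a: "a < n" for a
  proof -
    have "(\<Sum>b<n. GL a b * d b) = (\<Sum>b<n. \<Sum>i<m. \<Sum>k<m. X i a * G i k * (X k b * d b))"
      using X a by (simp add: is_representation_def sum_distrib_right[symmetric] mult.assoc[symmetric])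
    also have "\<dots> = (\<Sum>i<m. \<Sum>b<n. \<Sum>k<m. X i a * G i k * (X k b * d b))" by (rule sum.swap)
    also have "\<dots> = (\<Sum>i<m. \<Sum>k<m. \<Sum>b<n. X i a * G i k * (X k b * d b))"
      by (rule sum.cong[OF refl], rule sum.swap)
    also have "\<dots> = 0" by (simp add: sum_distrib_left[symmetric] Xd)
    finally show ?thesis .
  qed
  then show ?thesis using GL by (simp add: z2_lattice_def)
qed

text \<open>\<open>Y\<close> consists of the image coordinates of the unit vectors, projected along
  the complement \<open>N\<close>. For a column of \<open>X\<close> the defect \<open>d\<close> is
  mapped into both the image and \<open>N\<close>, hence to 0, and injectivity gives
  \<open>d = 0\<close>.\<close>

lemma primitive_left_inverse:
  assumes GL: "z2_lattice n GL" and X: "is_representation n GL m G X" and prim: "is_primitive n m X"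
  shows "\<exists>Y. \<forall>a<n. \<forall>b<n. (\<Sum>p<m. Y a p * X p b) = (if a = b then 1 else 0)"
proof -
  obtain N where N: "z2_submodule m N" and
    split: "\<forall>v\<in>z2vecs m. \<exists>c u. u \<in> N \<and> v = (\<lambda>i. lin_map m n X c i + u i)" and
    triv: "lin_map m n X ` UNIV \<inter> N = {\<lambda>_. 0}"
    using prim unfolding is_primitive_def by blast
  define unit :: "nat \<Rightarrow> nat \<Rightarrow> padic2" where "unit p i = (if i = p then 1 else 0)" for p i
  have "\<exists>c u. u \<in> N \<and> unit p = (\<lambda>i. lin_map m n X c i + u i)" if "p < m" for p
    using split that by (simp add: z2vecs_def unit_def)
  then obtain c u where cu: "\<And>p. p < m \<Longrightarrow> u p \<in> N"
    "\<And>p. p < m \<Longrightarrow> unit p = (\<lambda>i. lin_map m n X (c p) i + u p i)" by metis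
  have "(\<Sum>p<m. c p a * X p b) = (if a = b then 1 else 0)" if b: "b < n" and a: "a < n" for a b
  proof -
    define d where "d a = (if a = b then 1 else 0) - (\<Sum>p<m. X p b * c p a)" for a
    have "lin_map m n X d i = (\<Sum>p<m. X p b * u p i)" for i
    proof (cases "i < m")
      case True
      have "(\<Sum>p<m. X p b * u p i) = (\<Sum>p<m. X p b * (unit p i - lin_map m n X (c p) i))"
        using cu(2) by (intro sum.cong refl) (simp add: fun_eq_iff)
      also have "\<dots> = X i b - (\<Sum>p<m. X p b * lin_map m n X (c p) i)"
        using True by (simp add: right_diff_distrib sum_subtractf unit_def if_distrib[of "\<lambda>x. _ * x"] cong: if_cong)
      also have "(\<Sum>p<m. X p b * lin_map m n X (c p) i) = (\<Sum>p<m. \<Sum>a<n. X i a * (X p b * c p a))"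
        using True by (simp add: lin_map_def sum_distrib_left ac_simps)
      also have "\<dots> = (\<Sum>a<n. \<Sum>p<m. X i a * (X p b * c p a))" by (rule sum.swap)
      also have "X i b - \<dots> = lin_map m n X d i"
        using True b by (simp add: lin_map_def d_def right_diff_distrib sum_subtractf sum_distrib_left
            if_distrib[of "\<lambda>x. _ * x"] cong: if_cong)
      finally show ?thesis by simp
    next
      case False
      have "u p i = 0" if "p < m" for p
        using N cu(1)[OF that] False by (auto simp: z2_submodule_def z2vecs_def)
      then show ?thesis using False by (simp add: lin_map_def)
    qed
    then have "lin_map m n X d = (\<lambda>i. \<Sum>p<m. X p b * u p i)" by (simp add: fun_eq_iff)
    moreover have "(\<lambda>i. \<Sum>p\<in>{..<m}. X p b * u p i) \<in> N"
      by (rule z2_submodule_sum[OF N]) (use cu in simp)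
    ultimately have "lin_map m n X d \<in> lin_map m n X ` UNIV \<inter> N" by (intro IntI rangeI) simp
    then have "lin_map m n X d = (\<lambda>_. 0)" unfolding triv by simp
    then have "d a = 0" using lin_map_inj[OF GL X] a by blast
    then show ?thesis by (simp add: d_def mult.commute)
  qed
  then show ?thesis by (intro exI[of _ "\<lambda>a p. c p a"]) simp
qed

lemma prim_represents_pad:
  assumes GL: "z2_lattice 4 GL" and rep: "prim_represents m G 4 GL" and m: "m \<le> 8"
  shows "\<exists>x Y. prim_rep8 (pad_one m G) GL x Y"
proof -
  obtain X where X: "is_representation 4 GL m G X" "is_primitive 4 m X"
    using rep by (auto simp: prim_represents_def)
  obtain Y where Y: "\<forall>a<4. \<forall>b<4. (\<Sum>p<m. Y a p * X p b) = (if a = b then 1 else 0)"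
    using primitive_left_inverse[OF GL X] by blast
  define x where "x a i = (if i < m then X i a else 0)" for a i
  have "gram_form (pad_one m G) (x a) (x b) = GL a b" if "a < 4" "b < 4" for a b
  proof -
    have "gram_form (pad_one m G) (x a) (x b) = (\<Sum>i<8. if i < m then \<Sum>k<8. if k < m then X i a * G i k * X k b else 0 else 0)"
      unfolding gram_form_expand by (intro sum.cong refl) (auto simp: x_def pad_one_def intro!: sum.cong)
    also have "\<dots> = GL a b"
      using X(1) that by (simp add: sum_pad[OF m] is_representation_def)
    finally show ?thesis .
  qed
  moreover have "dot (Y a) (x b) = (if a = b then 1 else 0)" if "a < 4" "b < 4" for a b
  proof -
    have "dot (Y a) (x b) = (\<Sum>p<8. if p < m then Y a p * X p b else 0)"
      unfolding dot_def by (intro sum.cong) (auto simp: x_def)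
    then show ?thesis using Y that by (simp add: sum_pad[OF m])
  qed
  ultimately have "prim_rep8 (pad_one m G) GL x Y" by (simp add: prim_rep8_def)
  then show ?thesis by blast
qed

lemma not_universal_le_8:
  assumes "z2_lattice m G" "m \<le> 8"
  shows "\<not> prim_universal 4 m G"
proof
  assume "prim_universal 4 m G"
  then show False
    using no_universal_form8[OF pad_one_lattice[OF assms]] prim_represents_pad[OF _ _ assms(2)]
    by (auto simp: prim_universal_def)
qed

text \<open>The Gram matrix of \<open>H \<bottom> H \<bottom> H \<bottom> H \<bottom> \<langle>1\<rangle>\<close> with hyperbolic pairs \<open>(i, i + 4)\<close>.\<close>

definition gram9 :: "nat \<Rightarrow> nat \<Rightarrow> padic2" where
  "gram9 i j = (if i = 8 \<and> j = 8 \<or> i < 8 \<and> j < 8 \<and> i \<noteq> j \<and> i mod 4 = j mod 4 then 1 else 0)"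

lemma sum_less_9: "(\<Sum>i<9. f i) = f 0 + f 1 + f 2 + f 3 + f 4 + f 5 + f 6 + f 7 + f (8::nat)"
  by (simp add: eval_nat_numeral)

lemma all_less_9: "(\<forall>k<9. P k) \<longleftrightarrow> P 0 \<and> P 1 \<and> P 2 \<and> P 3 \<and> P 4 \<and> P 5 \<and> P 6 \<and> P 7 \<and> P (8::nat)"
  by (simp add: eval_nat_numeral All_less_Suc conj_ac)

lemma lattice_gram9: "z2_lattice 9 gram9"
  unfolding z2_lattice_def
proof (intro conjI allI impI)
  show "gram9 i j = gram9 j i" for i j by (auto simp: gram9_def)
  fix x :: "nat \<Rightarrow> padic2" and j :: nat
  assume "\<forall>i<9. (\<Sum>j<9. gram9 i j * x j) = 0" and j: "j < 9"
  then have "\<forall>j<9. x j = 0"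
    unfolding all_less_9 by (simp add: sum_less_9 gram9_def)
  then show "x j = 0" using j by blast
qed

lemma universal_gram9: "prim_universal 4 9 gram9"
  unfolding prim_universal_def
proof (intro allI impI)
  fix GL assume GL: "z2_lattice 4 GL"
  have sym: "GL i j = GL j i" if "i < 4" "j < 4" for i j using GL that by (simp add: z2_lattice_def)
  define z where "z i = bit_lift (par (GL i i))" for i
  have "\<exists>h. GL i i - z i * z i = 2 * h" for i
  proof -
    have "par (GL i i - z i * z i) = 0" by (cases "par (GL i i)") (simp_all add: z_def)
    then show ?thesis unfolding par_eq_0_iff by blast
  qed
  then obtain h where h: "\<And>i. GL i i - z i * z i = 2 * h i" by metis
  \<comment> \<open>An upper triangular choice for the matrix \<open>C\<close>; the halves
    \<open>h i\<close> on its diagonal exist because \<open>z i\<close> has the parity of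
    \<open>GL i i\<close>.\<close>
  define A where "A i j = (if i < j then GL i j - z i * z j else if i = j then h i else 0)" for i j
  have A: "A a b + A b a + z a * z b = GL a b" if "a < 4" "b < 4" for a b
    using that h[of a] sym[of a b] by (cases a b rule: linorder_cases) (auto simp: A_def algebra_simps)
  define X where "X i a = (if i < 4 then if i = a then 1 else 0 else if i < 8 then A (i - 4) a else z a)" for i a
  have lin: "lin_map 9 4 X c i = c i" if "i < 4" for c i
    using that by (simp add: lin_map_def X_def if_distrib[of "\<lambda>x. x * _"] cong: if_cong)
  have "is_representation 4 GL 9 gram9 X"
    unfolding is_representation_def
  proof (intro allI impI)
    fix a b :: nat assume ab: "a < 4" "b < 4"
    have "(\<Sum>i<9. \<Sum>k<9. X i a * gram9 i k * X k b) =
      X 0 a * X 4 b + X 1 a * X 5 b + X 2 a * X 6 b + X 3 a * X 7 b +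
      (X 4 a * X 0 b + X 5 a * X 1 b + X 6 a * X 2 b + X 7 a * X 3 b) + X 8 a * X 8 b"
      by (simp add: sum_less_9 gram9_def)
    also have "\<dots> = A a b + A b a + z a * z b"
      using less_4_cases[OF ab(1)] less_4_cases[OF ab(2)] by (elim disjE) (simp_all add: X_def)
    finally show "(\<Sum>i<9. \<Sum>k<9. X i a * gram9 i k * X k b) = GL a b" using A ab by simp
  qed
  moreover have "is_primitive 4 9 X"
    unfolding is_primitive_def
  proof (rule exI, intro conjI ballI)
    \<comment> \<open>The identity block of \<open>X\<close> makes the vectors that vanish in the
      first four coordinates a complement of the image.\<close>
    let ?N = "{v \<in> z2vecs 9. \<forall>i<4. v i = 0}"
    show "z2_submodule 9 ?N" by (auto simp: z2_submodule_def z2vecs_def)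
    show "\<exists>c u. u \<in> ?N \<and> v = (\<lambda>i. lin_map 9 4 X c i + u i)" if "v \<in> z2vecs 9" for v
      using that lin
      by (intro exI[of _ v] exI[of _ "\<lambda>i. v i - lin_map 9 4 X v i"]) (auto simp: z2vecs_def lin_map_def)
    have zero: "lin_map 9 4 X (\<lambda>_. 0) = (\<lambda>_. 0)" by (simp add: lin_map_def fun_eq_iff)
    have "lin_map 9 4 X c = (\<lambda>_. 0)" if "lin_map 9 4 X c \<in> ?N" for c
    proof -
      have "\<forall>i<4. c i = 0" using that lin by auto
      then show ?thesis by (simp add: lin_map_def fun_eq_iff)
    qed
    moreover have "(\<lambda>_. 0) \<in> ?N" by (simp add: z2vecs_def)
    ultimately show "range (lin_map 9 4 X) \<inter> ?N = {\<lambda>_. 0}"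
      using rangeI[of "lin_map 9 4 X" "\<lambda>_. 0"] unfolding zero by auto
  qed
  ultimately show "prim_represents 9 gram9 4 GL" by (auto simp: prim_represents_def)
qed

theorem theorem6p5:
  shows "(\<forall>GM. z2_lattice 8 GM \<longrightarrow> \<not> prim_universal 4 8 GM) \<and> u_star_Z2 4 = 9"
proof
  show "\<forall>GM. z2_lattice 8 GM \<longrightarrow> \<not> prim_universal 4 8 GM"
    using not_universal_le_8 by simp
  show "u_star_Z2 4 = 9"
    unfolding u_star_Z2_def
  proof (rule Least_equality)
    show "\<exists>GM. z2_lattice 9 GM \<and> prim_universal 4 9 GM"
      using lattice_gram9 universal_gram9 by blast
    show "9 \<le> m" if "\<exists>GM. z2_lattice m GM \<and> prim_universal 4 m GM" for m
    proof (rule ccontr)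
      assume "\<not> 9 \<le> m"
      then have "m \<le> 8" by simp
      then show False using that not_universal_le_8 by blast
    qed
  qed
qed

end
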